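(* There is an algorithm, running in time bounded by an elementary function of the input size, that given a finite set $\Sigma$ of guarded dexrs over a schema $\mathbf{S}$ outputs a finite set $\Sigma'$ of linear dexrs over $\mathbf{S}$ that is logically equivalent to $\Sigma$ (i.e., has exactly the same models) if such a set exists, and outputs $\mathsf{fail}$ otherwise.
   Context: A schema $\mathbf{S}$ is a finite set of relation symbols with positive arities; structures over $\mathbf{S}$ have domains contained in a fixed countably infinite set of constants. A disjunctive existential rule (dexr) over $\mathbf{S}$ is a constant-free first-order sentence $\forall\bar x\forall\bar y\,(\phi(\bar x,\bar y)\rightarrow\bigvee_{i=1}^k\exists\bar z_i\,\psi_i(\bar x_i,\bar z_i))$ with $k>0$, $\phi$ a (possibly empty) conjunction of atoms over $\mathbf{S}$ with variable arguments, each $\psi_i$ a non-empty conjunction of atoms over $\mathbf{S}$, the variables of $\bar x_i$ among $\bar x$, and each variable of $\bar x$ occurring in some $\bar x_i$; usual first-order semantics. A dexr is linear if its body has at most one atom, and guarded if its body is empty or contains an atom mentioning all universally quantified variables. Elementary time means time bounded by a tower of exponentials of fixed height. *)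

theory Defs
  imports Main
begin

section \<open>Disjunctive existential rules\<close>

text \<open>
  Relation symbols and variables are natural numbers. A schema is a finite list of
  pairs (relation symbol, arity).
\<close>

type_synonym schema = "(nat \<times> nat) list"

definition is_schema :: "schema \<Rightarrow> bool" where
  "is_schema S \<longleftrightarrow> distinct (map fst S) \<and> (\<forall>(R, n) \<in> set S. n > 0)"

datatype atom = Atom (pred: nat) (args: "nat list")

text \<open>
  \<open>Dexr \<phi> [\<psi>\<^sub>1, \<dots>, \<psi>\<^sub>k]\<close> stands for the sentence
  \<open>\<forall>x y. (\<And>\<phi> \<longrightarrow> (\<exists>z\<^sub>1. \<And>\<psi>\<^sub>1) \<or> \<dots> \<or> (\<exists>z\<^sub>k. \<And>\<psi>\<^sub>k))\<close>. The quantifier prefixes are left implicit: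
  the universally quantified variables are those occurring in the body \<open>\<phi>\<close>, and
  \<open>z\<^sub>i\<close> consists of the variables of \<open>\<psi>\<^sub>i\<close> that do not occur in \<open>\<phi>\<close>. The tuple \<open>x\<close> consists of
  the body variables that occur in some \<open>\<psi>\<^sub>i\<close>, the tuple \<open>y\<close> of the other ones.
\<close>

datatype dexr = Dexr (body: "atom list") (heads: "atom list list")

definition universal_vars :: "dexr \<Rightarrow> nat set" where
  "universal_vars r = (\<Union>a \<in> set (body r). set (args a))"

definition atom_over :: "schema \<Rightarrow> atom \<Rightarrow> bool" where
  "atom_over S a \<longleftrightarrow> (pred a, length (args a)) \<in> set S"

definition dexr_over :: "schema \<Rightarrow> dexr \<Rightarrow> bool" where
  "dexr_over S r \<longleftrightarrow>
     (\<forall>a \<in> set (body r). atom_over S a) \<and>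
     heads r \<noteq> [] \<and>
     (\<forall>\<psi> \<in> set (heads r). \<psi> \<noteq> [] \<and> (\<forall>a \<in> set \<psi>. atom_over S a))"

definition linear :: "dexr \<Rightarrow> bool" where
  "linear r \<longleftrightarrow> length (body r) \<le> 1"

definition guarded :: "dexr \<Rightarrow> bool" where
  "guarded r \<longleftrightarrow> body r = [] \<or> (\<exists>a \<in> set (body r). universal_vars r \<subseteq> set (args a))"


section \<open>Semantics\<close>

text \<open>
  The type \<open>nat\<close> also serves as the fixed countably infinite set of constants. A structure
  is a non-empty set \<open>D\<close> of constants with an interpretation \<open>I\<close> of the relation symbols.
\<close>

definition is_structure :: "schema \<Rightarrow> nat set \<Rightarrow> (nat \<Rightarrow> nat list set) \<Rightarrow> bool" where
  "is_structure S D I \<longleftrightarrow>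
     D \<noteq> {} \<and>
     (\<forall>R t. t \<in> I R \<longrightarrow> (R, length t) \<in> set S \<and> set t \<subseteq> D)"

definition sat_atoms :: "(nat \<Rightarrow> nat list set) \<Rightarrow> (nat \<Rightarrow> nat) \<Rightarrow> atom list \<Rightarrow> bool" where
  "sat_atoms I \<sigma> as \<longleftrightarrow> (\<forall>a \<in> set as. map \<sigma> (args a) \<in> I (pred a))"

definition sat_dexr :: "nat set \<Rightarrow> (nat \<Rightarrow> nat list set) \<Rightarrow> dexr \<Rightarrow> bool" where
  "sat_dexr D I r \<longleftrightarrow>
     (\<forall>\<sigma>. range \<sigma> \<subseteq> D \<and> sat_atoms I \<sigma> (body r) \<longrightarrow>
        (\<exists>\<psi> \<in> set (heads r). \<exists>\<tau>. range \<tau> \<subseteq> D \<and>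
           (\<forall>x \<in> universal_vars r. \<tau> x = \<sigma> x) \<and> sat_atoms I \<tau> \<psi>))"

definition is_model :: "nat set \<Rightarrow> (nat \<Rightarrow> nat list set) \<Rightarrow> dexr set \<Rightarrow> bool" where
  "is_model D I \<Sigma> \<longleftrightarrow> (\<forall>r \<in> \<Sigma>. sat_dexr D I r)"

definition equivalent_over :: "schema \<Rightarrow> dexr set \<Rightarrow> dexr set \<Rightarrow> bool" where
  "equivalent_over S \<Sigma> \<Sigma>' \<longleftrightarrow>
     (\<forall>D I. is_structure S D I \<longrightarrow> (is_model D I \<Sigma> \<longleftrightarrow> is_model D I \<Sigma>'))"

definition linear_rewriting :: "schema \<Rightarrow> dexr set \<Rightarrow> dexr set \<Rightarrow> bool" where
  "linear_rewriting S \<Sigma> \<Sigma>' \<longleftrightarrow>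
     finite \<Sigma>' \<and> (\<forall>r \<in> \<Sigma>'. dexr_over S r \<and> linear r) \<and> equivalent_over S \<Sigma> \<Sigma>'"


section \<open>Words encoding inputs and outputs\<close>

datatype letter = Zero | One | Comma | Open | Close | Fail

fun binary :: "nat \<Rightarrow> letter list" where
  "binary n = (if n = 0 then [] else (if even n then Zero else One) # binary (n div 2))"

declare binary.simps [simp del]

definition enc_nat :: "nat \<Rightarrow> letter list" where
  "enc_nat n = binary n @ [Comma]"

definition enc_list :: "('a \<Rightarrow> letter list) \<Rightarrow> 'a list \<Rightarrow> letter list" where
  "enc_list f xs = Open # concat (map f xs) @ [Close]"

definition enc_schema :: "schema \<Rightarrow> letter list" where
  "enc_schema S = enc_list (\<lambda>(R, n). enc_list enc_nat [R, n]) S"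

definition enc_atom :: "atom \<Rightarrow> letter list" where
  "enc_atom a = enc_list enc_nat (pred a # args a)"

definition enc_dexr :: "dexr \<Rightarrow> letter list" where
  "enc_dexr r = enc_list (enc_list enc_atom) (body r # heads r)"

definition enc_dexrs :: "dexr list \<Rightarrow> letter list" where
  "enc_dexrs rs = enc_list enc_dexr rs"

definition enc_input :: "schema \<Rightarrow> dexr list \<Rightarrow> letter list" where
  "enc_input S rs = enc_schema S @ enc_dexrs rs"

text \<open>
  The encoding is uniquely decodable: no encoded object starts with \<open>Close\<close>, and no
  encoding is a proper prefix of another one.
\<close>

definition decodable :: "('a \<Rightarrow> letter list) \<Rightarrow> bool" where
  "decodable f \<longleftrightarrow>
     (\<forall>x. f x \<noteq> [] \<and> hd (f x) \<noteq> Close) \<and>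
     (\<forall>x y v w. f x @ v = f y @ w \<longrightarrow> x = y \<and> v = w)"

lemma binary_append_eq:
  "binary m @ Comma # v = binary n @ Comma # w \<Longrightarrow> m = n \<and> v = w"
proof (induction m arbitrary: n rule: less_induct)
  case (less m)
  show ?case
  proof (cases "m = 0 \<or> n = 0")
    case True
    with less.prems show ?thesis
      by (auto simp: binary.simps[of m] binary.simps[of n] split: if_splits)
  next
    case False
    with less.prems have par: "even m = even n"
      and eq: "binary (m div 2) @ Comma # v = binary (n div 2) @ Comma # w"
      by (auto simp: binary.simps[of m] binary.simps[of n] split: if_splits)
    from less.IH[OF _ eq] False have "m div 2 = n div 2 \<and> v = w" by auto
    with par show ?thesis by (metis dvd_div_eq_iff even_succ_div_two odd_two_times_div_two_succ
          dvd_mult_div_cancel)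
  qed
qed

lemma decodable_nat: "decodable enc_nat"
proof -
  have "enc_nat n \<noteq> [] \<and> hd (enc_nat n) \<noteq> Close" for n
    by (auto simp: enc_nat_def binary.simps[of n])
  then show ?thesis
    by (auto simp: decodable_def enc_nat_def dest: binary_append_eq)
qed

lemma decodable_list:
  assumes "decodable f"
  shows "decodable (enc_list f)"
proof -
  have ne: "f x \<noteq> []" "hd (f x) \<noteq> Close" for x
    using assms by (auto simp: decodable_def)
  have inj: "x = y \<and> v = w" if "f x @ v = f y @ w" for x y v w
    using assms that by (auto simp: decodable_def)
  have close: "f x @ v \<noteq> Close # w" for x v w
    using ne[of x] by (cases "f x") auto
  have "xs = ys \<and> v = w"
    if "concat (map f xs) @ Close # v = concat (map f ys) @ Close # w" for xs ys v w
    using that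
  proof (induction xs arbitrary: ys)
    case Nil
    then show ?case using close by (cases ys) (auto, metis)
  next
    case (Cons x xs)
    then show ?case
    proof (cases ys)
      case Nil
      with Cons.prems close show ?thesis by auto
    next
      case (Cons y ys')
      with Cons.prems have
        "f x @ (concat (map f xs) @ Close # v) = f y @ (concat (map f ys') @ Close # w)"
        by simp
      from inj[OF this] Cons.IH[of ys'] \<open>ys = y # ys'\<close> show ?thesis by auto
    qed
  qed
  then show ?thesis by (auto simp: decodable_def enc_list_def)
qed

lemma decodable_via:
  assumes "decodable f" "inj g"
  shows "decodable (\<lambda>x. f (g x))"
  using assms unfolding decodable_def inj_def by blast

lemma decodable_atom: "decodable enc_atom"
proof -
  have "inj (\<lambda>a. pred a # args a)" by (auto simp: inj_def intro: atom.expand)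
  from decodable_via[OF decodable_list[OF decodable_nat] this] show ?thesis
    by (simp add: enc_atom_def[abs_def])
qed

lemma decodable_dexr: "decodable enc_dexr"
proof -
  have "inj (\<lambda>r. body r # heads r)" by (auto simp: inj_def intro: dexr.expand)
  from decodable_via[OF decodable_list[OF decodable_list[OF decodable_atom]] this] show ?thesis
    by (simp add: enc_dexr_def[abs_def])
qed

lemma decodable_dexrs: "decodable enc_dexrs"
  using decodable_list[OF decodable_dexr] by (simp add: enc_dexrs_def[abs_def])

lemma decodable_schema: "decodable enc_schema"
proof -
  have "inj (\<lambda>(R, n). [R, n :: nat])" by (auto simp: inj_def)
  from decodable_list[OF decodable_via[OF decodable_list[OF decodable_nat] this]] show ?thesis
    by (simp add: enc_schema_def[abs_def] case_prod_unfold)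
qed

lemma enc_input_inject: "enc_input S rs = enc_input S' rs' \<longleftrightarrow> S = S' \<and> rs = rs'"
  using decodable_schema decodable_dexrs unfolding decodable_def enc_input_def
  by (metis append_Nil2)


section \<open>Deterministic multi-tape Turing machines\<close>

text \<open>
  Symbol 0 is the blank, symbol 1 marks the left end of every tape initially, the letters
  are the symbols 2 to 7, and further work symbols are allowed. States are
  numbered from 0 (initial) to \<open>states M\<close> (halting). Tapes are infinite to the right; the
  input is on tape 0, the output on tape 1. A transition depends on the state and the
  symbols under the heads; it yields a state and, per tape, a symbol and a head move.
\<close>

datatype move = MoveLeft | Stay | MoveRight

record machine =
  tapes :: nat
  symbols :: nat
  states :: nat
  trans :: "nat \<Rightarrow> nat list \<Rightarrow> nat \<times> (nat \<times> move) list"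

definition turing_machine :: "machine \<Rightarrow> bool" where
  "turing_machine M \<longleftrightarrow>
     2 \<le> tapes M \<and> 8 \<le> symbols M \<and> 0 < states M \<and>
     (\<forall>q ss. q < states M \<and> length ss = tapes M \<and> (\<forall>s \<in> set ss. s < symbols M) \<longrightarrow>
        fst (trans M q ss) \<le> states M \<and>
        length (snd (trans M q ss)) = tapes M \<and>
        (\<forall>(s, d) \<in> set (snd (trans M q ss)). s < symbols M))"

type_synonym tape = "(nat \<Rightarrow> nat) \<times> nat"
type_synonym config = "nat \<times> tape list"

fun letter_symbol :: "letter \<Rightarrow> nat" where
  "letter_symbol Zero = 2"
| "letter_symbol One = 3"
| "letter_symbol Comma = 4"
| "letter_symbol Open = 5"
| "letter_symbol Close = 6"
| "letter_symbol Fail = 7"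

definition word_content :: "letter list \<Rightarrow> nat \<Rightarrow> nat" where
  "word_content w i =
     (if i = 0 then 1 else if i \<le> length w then letter_symbol (w ! (i - 1)) else 0)"

definition initial_config :: "machine \<Rightarrow> letter list \<Rightarrow> config" where
  "initial_config M w =
     (0, map (\<lambda>i. (word_content (if i = 0 then w else []), 0)) [0..<tapes M])"

fun move_head :: "move \<Rightarrow> nat \<Rightarrow> nat" where
  "move_head MoveLeft p = p - 1"
| "move_head Stay p = p"
| "move_head MoveRight p = p + 1"

fun act :: "nat \<times> move \<Rightarrow> tape \<Rightarrow> tape" where
  "act (s, d) (c, p) = (c(p := s), move_head d p)"

definition step :: "machine \<Rightarrow> config \<Rightarrow> config" where
  "step M = (\<lambda>(q, ts).
     if q < states M
     then (let (q', as) = trans M q (map (\<lambda>(c, p). c p) ts) in (q', map2 act as ts))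
     else (q, ts))"

definition halted :: "machine \<Rightarrow> config \<Rightarrow> bool" where
  "halted M c \<longleftrightarrow> fst c = states M"

text \<open>
  The output is the word that occupies cells 1, 2, \dots of tape 1 up to the first blank.
\<close>

definition has_output :: "config \<Rightarrow> letter list \<Rightarrow> bool" where
  "has_output c v \<longleftrightarrow>
     (let content = fst (snd c ! 1) in
        (\<forall>i < length v. content (i + 1) = letter_symbol (v ! i)) \<and> content (length v + 1) = 0)"

definition computes_in :: "machine \<Rightarrow> letter list \<Rightarrow> letter list \<Rightarrow> nat \<Rightarrow> bool" where
  "computes_in M w v t \<longleftrightarrow>
     (\<exists>k \<le> t. halted M ((step M ^^ k) (initial_config M w)) \<and>
        has_output ((step M ^^ k) (initial_config M w)) v)"


section \<open>Elementary bounds\<close>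

fun tower :: "nat \<Rightarrow> nat \<Rightarrow> nat" where
  "tower 0 n = n"
| "tower (Suc h) n = 2 ^ tower h n"

definition elementary_bound :: "(nat \<Rightarrow> nat) \<Rightarrow> bool" where
  "elementary_bound T \<longleftrightarrow> (\<exists>h. \<forall>n. T n \<le> tower h n)"

end

(*
  Call the truth of a conjunctive query with few existential variables at a tuple of slots the
  type of that tuple. A model of guarded rules can be unravelled into a tree of bags of bounded
  size, so which finite pointed structures ("mosaics") occur in models is decided by a greatest
  fixed point: a set of mosaics is closed if every rule that fires on slots is satisfied in some
  mosaic of the set with the same type on the shared slots. Conversely the mosaics of a closed
  set can be glued along shared slots into a tree model without new queries becoming true,
  because swapping a part of a structure for another one with a larger type at the interface
  preserves all queries.

  For an atom b over the slots let H(b) be the finite set of mosaics that contain b and occur in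
  models. The rules Sigma entail that b implies the disjunction of H(b). These linear rules,
  together with the rules of Sigma with empty body, entail Sigma iff, for each rule with body
  b1, ..., bn and all Ci in H(bi), the free union of the Ci satisfies some head. If Sigma has a
  linear rewriting, then its models are closed under unions, and the union of models realizing
  C1, ..., Cn shows that this condition holds.

  All of this is a search through iterated power sets of finite sets. Functions on data encoded
  by numbers that are composed of pairing and iteration, with elementary bounds on the
  intermediate values, are run in elementary time by counter programs, and a counter is the
  position of a head on a tape. Inputs are decoded by searching for the input with the given
  encoding.
*)

theory Submission
  imports Defs "HOL-Library.Countable" "HOL-Library.Nat_Bijection" "HOL-Library.More_List"
begin

section \<open>Queries at an interface, and their preservation when a part is replaced\<close>

section \<open>Types and mosaics\<close>

text \<open>Disjunction rules out a canonical model, and a rule with several body atoms may combine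
  facts whose surroundings were built separately. What must be controlled is which queries become
  true: types are compared by inclusion, and a tree model must realize at its root no query beyond
  those of the mosaic there. Only then does a head found in a union of such models say something
  about the mosaics.

  The number of existential variables never exceeds K. When a match is cut at an interface,
  existential variables that land on shared elements become answer variables and the others stay
  existential, so the pieces are queries of the same kind. K exceeds all variables of the rules,
  hence every head is such a query. The algorithm takes K = 2^n for an input of length n, because
  its binary numerals denote numbers below 2^n.

  Elements of a mosaic beyond the slots exist only to witness queries. They are never unfolded:
  rules are required to hold at slots only, and the tree model keeps only the facts on
  slots.\<close>

abbreviation at :: "nat list \<Rightarrow> nat \<Rightarrow> nat" where
  "at \<equiv> nth_default 0"

lemma at_map [simp]: "at (map f [0..<L]) x = (if x < L then f x else 0)"
  by (simp add: nth_default_def)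


definition ren :: "(nat \<Rightarrow> nat) \<Rightarrow> atom \<Rightarrow> atom" where
  "ren f a = Atom (pred a) (map f (args a))"

lemma pred_ren [simp]: "pred (ren f a) = pred a"
  and args_ren [simp]: "args (ren f a) = map f (args a)"
  by (simp_all add: ren_def)

lemma ren_ren [simp]: "ren f (ren g a) = ren (\<lambda>x. f (g x)) a"
  by (simp add: ren_def comp_def)

lemma ren_id [simp]: "ren (\<lambda>x. x) a = a"
  by (simp add: ren_def)

lemma ren_cong: "(\<And>x. x \<in> set (args a) \<Longrightarrow> f x = g x) \<Longrightarrow> ren f a = ren g a"
  by (simp add: ren_def)

lemma atom_over_ren [simp]: "atom_over S (ren f a) = atom_over S a"
  by (simp add: atom_over_def)

definition facts :: "(nat \<Rightarrow> nat list set) \<Rightarrow> atom set" where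
  "facts I = {a. args a \<in> I (pred a)}"

definition interp :: "atom set \<Rightarrow> nat \<Rightarrow> nat list set" where
  "interp G R = {t. Atom R t \<in> G}"

lemma facts_interp [simp]: "facts (interp G) = G"
  by (auto simp: facts_def interp_def)

lemma sat_atoms_iff: "sat_atoms I s as \<longleftrightarrow> (\<forall>a \<in> set as. ren s a \<in> facts I)"
  by (auto simp: sat_atoms_def facts_def)

definition elems :: "atom set \<Rightarrow> nat set" where
  "elems G = (\<Union>a \<in> G. set (args a))"

lemma elems_Un [simp]: "elems (A \<union> B) = elems A \<union> elems B"
  and elems_UN [simp]: "elems (\<Union>i \<in> F. H i) = (\<Union>i \<in> F. elems (H i))"
  and elems_image [simp]: "elems (ren f ` A) = f ` elems A"
  by (auto simp: elems_def)

lemma elemsI: "a \<in> G \<Longrightarrow> x \<in> set (args a) \<Longrightarrow> x \<in> elems G"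
  by (auto simp: elems_def)

text \<open>
  Sets of atoms serve as structures and as conjunctive queries. A query has answer variables \<open>X\<close>
  among the slots \<open>0, \<dots>, K - 1\<close> and existential variables among \<open>K, \<dots>, 2 * K - 1\<close>.
\<close>

definition type_le ::
    "schema \<Rightarrow> nat \<Rightarrow> nat set \<Rightarrow> atom set \<Rightarrow> (nat \<Rightarrow> nat) \<Rightarrow> atom set \<Rightarrow> (nat \<Rightarrow> nat) \<Rightarrow> bool" where
  "type_le S K X A f B g \<longleftrightarrow>
     (\<forall>q. (\<forall>a \<in> q. atom_over S a \<and> set (args a) \<subseteq> X \<union> {K..<2*K}) \<longrightarrow>
        (\<exists>t. (\<forall>x \<in> X. t x = f x) \<and> ren t ` q \<subseteq> A) \<longrightarrow>
        (\<exists>t. (\<forall>x \<in> X. t x = g x) \<and> ren t ` q \<subseteq> B))"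

lemma type_leD:
  assumes "type_le S K X A f B g"
    and "\<And>a. a \<in> q \<Longrightarrow> atom_over S a \<and> set (args a) \<subseteq> X \<union> {K..<2*K}"
    and "\<And>x. x \<in> X \<Longrightarrow> t x = f x" "\<And>a. a \<in> q \<Longrightarrow> ren t a \<in> A"
  obtains t' where "\<And>x. x \<in> X \<Longrightarrow> t' x = g x" "\<And>a. a \<in> q \<Longrightarrow> ren t' a \<in> B"
proof -
  have "\<exists>t. (\<forall>x \<in> X. t x = f x) \<and> ren t ` q \<subseteq> A" using assms by blast
  then have "\<exists>t. (\<forall>x \<in> X. t x = g x) \<and> ren t ` q \<subseteq> B"
    by (intro assms(1)[unfolded type_le_def, THEN spec, THEN mp, THEN mp]) (use assms(2) in blast)
  with that show ?thesis by blast
qed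

lemma type_leI:
  assumes "\<And>q t. (\<And>a. a \<in> q \<Longrightarrow> atom_over S a \<and> set (args a) \<subseteq> X \<union> {K..<2*K}) \<Longrightarrow>
     (\<And>x. x \<in> X \<Longrightarrow> t x = f x) \<Longrightarrow> (\<And>a. a \<in> q \<Longrightarrow> ren t a \<in> A) \<Longrightarrow>
     \<exists>t. (\<forall>x \<in> X. t x = g x) \<and> (\<forall>a \<in> q. ren t a \<in> B)"
  shows "type_le S K X A f B g"
  unfolding type_le_def
proof (intro allI impI)
  fix q assume 1: "\<forall>a\<in>q. atom_over S a \<and> set (args a) \<subseteq> X \<union> {K..<2 * K}"
    and 2: "\<exists>t. (\<forall>x\<in>X. t x = f x) \<and> ren t ` q \<subseteq> A"
  from 2 obtain t where "\<forall>x\<in>X. t x = f x" "\<forall>a\<in>q. ren t a \<in> A" by blast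
  with 1 assms[of q t] have "\<exists>t. (\<forall>x \<in> X. t x = g x) \<and> (\<forall>a \<in> q. ren t a \<in> B)" by simp
  then show "\<exists>t. (\<forall>x\<in>X. t x = g x) \<and> ren t ` q \<subseteq> B" by blast
qed

lemma type_le_trans:
  assumes "type_le S K X A f B g" "type_le S K X B g C h"
  shows "type_le S K X A f C h"
proof (rule type_leI)
  fix q t
  assume q: "\<And>a. a \<in> q \<Longrightarrow> atom_over S a \<and> set (args a) \<subseteq> X \<union> {K..<2*K}"
    and t: "\<And>x. x \<in> X \<Longrightarrow> t x = f x" "\<And>a. a \<in> q \<Longrightarrow> ren t a \<in> A"
  obtain t1 where t1: "\<And>x. x \<in> X \<Longrightarrow> t1 x = g x" "\<And>a. a \<in> q \<Longrightarrow> ren t1 a \<in> B"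
    using type_leD[OF assms(1) q t] by blast
  obtain t2 where "\<And>x. x \<in> X \<Longrightarrow> t2 x = h x" "\<And>a. a \<in> q \<Longrightarrow> ren t2 a \<in> C"
    using type_leD[OF assms(2) q t1] by blast
  then show "\<exists>t. (\<forall>x \<in> X. t x = h x) \<and> (\<forall>a \<in> q. ren t a \<in> C)" by blast
qed

lemma type_le_hom:
  assumes "\<And>a. a \<in> A \<Longrightarrow> ren r a \<in> B" "\<And>x. x \<in> X \<Longrightarrow> r (f x) = g x"
  shows "type_le S K X A f B g"
proof (rule type_leI)
  fix q t assume "\<And>x. x \<in> X \<Longrightarrow> t x = f x" "\<And>a. a \<in> q \<Longrightarrow> ren t a \<in> A"
  then have "\<forall>x \<in> X. r (t x) = g x" "\<forall>a \<in> q. ren (\<lambda>x. r (t x)) a \<in> B"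
    using assms(1)[of "ren t a" for a] assms(2) by auto
  then show "\<exists>t. (\<forall>x \<in> X. t x = g x) \<and> (\<forall>a \<in> q. ren t a \<in> B)"
    by (intro exI[of _ "\<lambda>x. r (t x)"]) simp
qed

lemma type_le_restrict:
  assumes "type_le S K X A f B g" "Y \<subseteq> X" "X \<subseteq> {..<K}"
  shows "type_le S K Y A f B g"
proof (rule type_leI)
  fix q t
  assume q: "\<And>a. a \<in> q \<Longrightarrow> atom_over S a \<and> set (args a) \<subseteq> Y \<union> {K..<2*K}"
    and t: "\<And>x. x \<in> Y \<Longrightarrow> t x = f x" "\<And>a. a \<in> q \<Longrightarrow> ren t a \<in> A"
  \<comment> \<open>Slots in \<open>X - Y\<close> do not occur in \<open>q\<close>, because
    \<open>X\<close> lies below \<open>K\<close> and existential variables start at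
    \<open>K\<close>; so \<open>t\<close> may be redefined there to agree with
    \<open>f\<close>.\<close>
  define t1 where "t1 x = (if x \<in> X then f x else t x)" for x
  have eq: "ren t1 a = ren t a" if "a \<in> q" for a
  proof (rule ren_cong)
    fix x assume x: "x \<in> set (args a)"
    have "x \<in> Y" if "x \<in> X"
    proof -
      have "x \<in> Y \<union> {K..<2*K}" "x < K" using q[OF \<open>a \<in> q\<close>] x that assms(3) by auto
      then show ?thesis by simp
    qed
    with t(1) show "t1 x = t x" by (auto simp: t1_def)
  qed
  obtain t' where "\<And>x. x \<in> X \<Longrightarrow> t' x = g x" "\<And>a. a \<in> q \<Longrightarrow> ren t' a \<in> B"
  proof (rule type_leD[OF assms(1), where q = q and t = t1])
    fix a assume "a \<in> q"
    then show "atom_over S a \<and> set (args a) \<subseteq> X \<union> {K..<2*K}" using q[of a] assms(2) by blast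
    show "ren t1 a \<in> A" using eq[OF \<open>a \<in> q\<close>] t(2)[OF \<open>a \<in> q\<close>] by simp
  qed (auto simp: t1_def)
  with assms(2) show "\<exists>t. (\<forall>x \<in> Y. t x = g x) \<and> (\<forall>a \<in> q. ren t a \<in> B)" by blast
qed

text \<open>
  The part of a query matched in \<open>A\<close> but not in \<open>G\<close> is a query about the interface \<open>f ` X\<close>, so
  its match can be moved to \<open>B\<close>.
\<close>

lemma type_le_replace:
  assumes le: "type_le S K X A f B f"
    and X: "X \<subseteq> {..<K}" and Y: "Y \<subseteq> {..<K}"
    and sep: "(elems G \<union> g ` Y) \<inter> elems A \<subseteq> f ` X"
  shows "type_le S K Y (G \<union> A) g (G \<union> B) g"
proof (rule type_leI)
  fix q t
  assume q: "\<And>a. a \<in> q \<Longrightarrow> atom_over S a \<and> set (args a) \<subseteq> Y \<union> {K..<2*K}"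
    and t: "\<And>x. x \<in> Y \<Longrightarrow> t x = g x" "\<And>a. a \<in> q \<Longrightarrow> ren t a \<in> G \<union> A"
  \<comment> \<open>The existential variables with a value strictly inside \<open>A\<close>. By
    \<open>sep\<close>, all other variables of an atom in \<open>qA\<close> take their value on the
    interface.\<close>
  define Z where "Z = {v. v \<notin> Y \<and> t v \<in> elems A \<and> t v \<notin> f ` X}"
  define qA where "qA = {a \<in> q. ren t a \<notin> G}"
  \<comment> \<open>A variable with a value on the interface is renamed to a slot with that value,
    so the renamed \<open>qA\<close> has its answer variables in \<open>X\<close>.\<close>
  define c where "c v = (if v \<in> Z then v else SOME x. x \<in> X \<and> f x = t v)" for v
  define t1 where "t1 v = (if v \<in> X then f v else t v)" for v
  have inA: "v \<in> Z \<or> (c v \<in> X \<and> f (c v) = t v)" if "a \<in> qA" "v \<in> set (args a)" for a v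
  proof -
    have "ren t a \<in> A" using that t(2) by (auto simp: qA_def)
    then have "t v \<in> elems A" using elemsI[of "ren t a" A "t v"] that(2) by simp
    then have "v \<in> Z \<or> t v \<in> f ` X" using sep t(1) by (fastforce simp: Z_def)
    moreover have "c v \<in> X \<and> f (c v) = t v" if "v \<notin> Z" "t v \<in> f ` X"
    proof -
      have "\<exists>x. x \<in> X \<and> f x = t v" using that(2) by auto
      from someI_ex[OF this] that(1) show ?thesis by (simp add: c_def)
    qed
    ultimately show ?thesis by blast
  qed
  have ZW: "v \<in> {K..<2*K}" if "a \<in> q" "v \<in> set (args a)" "v \<in> Z" for a v
    using q[OF that(1)] that(2,3) by (auto simp: Z_def)
  have t1c: "t1 (c v) = t v" if "a \<in> qA" "v \<in> set (args a)" for a v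
    using inA[OF that] ZW[of a v] that X by (fastforce simp: t1_def c_def qA_def)
  obtain t2 where t2: "\<And>x. x \<in> X \<Longrightarrow> t2 x = f x" "\<And>a. a \<in> ren c ` qA \<Longrightarrow> ren t2 a \<in> B"
  proof (rule type_leD[OF le, where q = "ren c ` qA" and t = t1])
    fix a assume "a \<in> ren c ` qA"
    then obtain b where b: "a = ren c b" "b \<in> qA" by auto
    then have "ren t1 a = ren t b" using t1c by (auto intro: ren_cong)
    then show "ren t1 a \<in> A" using b t(2) by (auto simp: qA_def)
    have "c v \<in> X \<union> {K..<2*K}" if "v \<in> set (args b)" for v
      using inA[OF b(2) that] ZW[of b v] that b(2) by (auto simp: c_def qA_def)
    then show "atom_over S a \<and> set (args a) \<subseteq> X \<union> {K..<2*K}"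
      using b q[of b] by (force simp: qA_def)
  qed (auto simp: t1_def)
  \<comment> \<open>Only the inner variables move. Atoms already matched in \<open>G\<close> contain
    none of them, by \<open>sep\<close>.\<close>
  define t3 where "t3 v = (if v \<in> Z then t2 v else t v)" for v
  have "ren t3 a \<in> G \<union> B" if "a \<in> q" for a
  proof (cases "a \<in> qA")
    case True
    have "ren t3 a = ren t2 (ren c a)"
      unfolding ren_ren using inA[OF True] t2(1) by (intro ren_cong) (fastforce simp: t3_def c_def)
    moreover have "ren t2 (ren c a) \<in> B" using t2(2) True by blast
    ultimately show ?thesis by simp
  next
    case False
    then have G: "ren t a \<in> G" using that by (auto simp: qA_def)
    have "v \<notin> Z" if "v \<in> set (args a)" for v
      using elemsI[OF G, of "t v"] that sep by (auto simp: Z_def)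
    then have "ren t3 a = ren t a" by (intro ren_cong) (auto simp: t3_def)
    then show ?thesis using G by simp
  qed
  moreover have "t3 x = g x" if "x \<in> Y" for x using that t(1) by (auto simp: t3_def Z_def)
  ultimately show "\<exists>t. (\<forall>x \<in> Y. t x = g x) \<and> (\<forall>a \<in> q. ren t a \<in> G \<union> B)" by blast
qed

section \<open>The finite objects that the algorithm searches through\<close>

definition atoms_upto :: "schema \<Rightarrow> nat \<Rightarrow> atom list" where
  "atoms_upto S M = concat (map (\<lambda>Rn. map (Atom (fst Rn)) (List.n_lists (snd Rn) [0..<M])) S)"

lemma set_atoms_upto: "set (atoms_upto S M) = {a. atom_over S a \<and> set (args a) \<subseteq> {..<M}}"
proof -
  have "a \<in> set (atoms_upto S M) \<longleftrightarrow> atom_over S a \<and> set (args a) \<subseteq> {..<M}" for a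
    by (cases a) (force simp: atoms_upto_def atom_over_def set_n_lists lessThan_atLeast0)
  then show ?thesis by blast
qed

definition uvars :: "dexr \<Rightarrow> nat list" where
  "uvars r = concat (map args (body r))"

lemma set_uvars: "set (uvars r) = universal_vars r"
  by (simp add: uvars_def universal_vars_def)

text \<open>Assignments are lists, so that the search is finite. Total access by \<open>at\<close>
  allows the function to be treated as elementary on all arguments; the value of \<open>!\<close>
  outside a list is unspecified.\<close>

definition hom_exists :: "nat \<Rightarrow> nat \<Rightarrow> nat list \<Rightarrow> atom list \<Rightarrow> atom list \<Rightarrow> bool" where
  "hom_exists N L X q C \<longleftrightarrow>
     (\<exists>l \<in> set (List.n_lists L [0..<N]).
        (\<forall>x \<in> set X. at l x = x) \<and> (\<forall>a \<in> set q. ren (at l) a \<in> set C))"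

lemma map_in_n_lists [simp]:
  "map f [0..<L] \<in> set (List.n_lists L [0..<N]) \<longleftrightarrow> (\<forall>x < L. f x < N)"
proof -
  have "set (map f [0..<L]) \<subseteq> set [0..<N] \<longleftrightarrow> (\<forall>x < L. f x < N)"
    unfolding set_map set_upt image_subset_iff by (metis atLeastLessThan_iff zero_le)
  then show ?thesis by (simp add: set_n_lists)
qed

lemma n_lists_nth_less:
  assumes "l \<in> set (List.n_lists L [0..<N])" "x < L"
  shows "at l x < N"
proof -
  have "length l = L" "set l \<subseteq> {0..<N}" using assms(1) by (auto simp: set_n_lists)
  then show ?thesis using nth_mem[of x l] assms(2) by (fastforce simp: nth_default_def)
qed

text \<open>Atoms of \<open>C\<close> have their arguments below \<open>N\<close>, so a homomorphism
  may be cut down to variables below \<open>L\<close> and values below \<open>N\<close>; a variable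
  that is reset to 0 occurs in no atom of \<open>q\<close> and not in \<open>X\<close>.\<close>

lemma hom_exists_iff:
  assumes "0 < N" and q: "\<And>a. a \<in> set q \<Longrightarrow> set (args a) \<subseteq> {..<L}"
    and X: "set X \<subseteq> {..<L}" "set X \<subseteq> {..<N}" and C: "elems (set C) \<subseteq> {..<N}"
  shows "hom_exists N L X q C \<longleftrightarrow> (\<exists>t. (\<forall>x \<in> set X. t x = x) \<and> (\<forall>a \<in> set q. ren t a \<in> set C))"
proof
  assume "\<exists>t. (\<forall>x \<in> set X. t x = x) \<and> (\<forall>a \<in> set q. ren t a \<in> set C)"
  then obtain t where t: "\<And>x. x \<in> set X \<Longrightarrow> t x = x" "\<And>a. a \<in> set q \<Longrightarrow> ren t a \<in> set C" by blast
  define l where "l = map (\<lambda>x. if t x < N then t x else 0) [0..<L]"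
  have "l \<in> set (List.n_lists L [0..<N])" using assms(1) by (simp add: l_def)
  moreover have "at l x = x" if "x \<in> set X" for x
    using t(1)[OF that] that X by (auto simp: l_def subset_iff)
  moreover have "ren (at l) a \<in> set C" if "a \<in> set q" for a
  proof -
    have "ren (at l) a = ren t a"
    proof (rule ren_cong)
      fix x assume x: "x \<in> set (args a)"
      then have "t x \<in> elems (set C)" using elemsI[OF t(2)[OF that], of "t x"] by simp
      then have "t x < N" "x < L" using C q[OF that] x by auto
      then show "at l x = t x" by (simp add: l_def)
    qed
    with t(2)[OF that] show ?thesis by simp
  qed
  ultimately show "hom_exists N L X q C" unfolding hom_exists_def by blast
next
  assume "hom_exists N L X q C"
  then show "\<exists>t. (\<forall>x \<in> set X. t x = x) \<and> (\<forall>a \<in> set q. ren t a \<in> set C)"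
    unfolding hom_exists_def by blast
qed

definition queries :: "schema \<Rightarrow> nat \<Rightarrow> atom list list" where
  "queries S K = subseqs (atoms_upto S (2 * K))"

text \<open>
  A mosaic is a finite structure whose elements below \<open>K\<close> are the slots. The width suffices for
  the slots and \<open>K\<close> witnesses for each query, so that each tuple of elements of a structure has
  the same type as the slots of some mosaic.
\<close>

definition width :: "schema \<Rightarrow> nat \<Rightarrow> nat" where
  "width S K = K + K * length (queries S K)"

definition mosaics :: "schema \<Rightarrow> nat \<Rightarrow> atom list list" where
  "mosaics S K = subseqs (atoms_upto S (width S K))"

text \<open>Slots outside \<open>X\<close> are excluded from the queries because they name unrelated
  elements in the two mosaics.\<close>

definition same_type :: "schema \<Rightarrow> nat \<Rightarrow> nat list \<Rightarrow> atom list \<Rightarrow> atom list \<Rightarrow> bool" where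
  "same_type S K X C C' \<longleftrightarrow>
     (\<forall>q \<in> set (queries S K).
        (\<forall>a \<in> set q. \<forall>v \<in> set (args a). v \<in> set X \<or> K \<le> v) \<longrightarrow>
        hom_exists (width S K) (2 * K) X q C = hom_exists (width S K) (2 * K) X q C')"

text \<open>\<open>h\<close> places the rule variables on slots of \<open>C\<close>. The universal
  variables keep their slots in \<open>C'\<close>, so that a tree node and its child can share them
  under the same names.\<close>

definition closed :: "schema \<Rightarrow> nat \<Rightarrow> dexr list \<Rightarrow> atom list list \<Rightarrow> bool" where
  "closed S K \<Sigma> T \<longleftrightarrow>
     (\<forall>C \<in> set T. \<forall>r \<in> set \<Sigma>. \<forall>h \<in> set (List.n_lists K [0..<K]).
        (\<forall>a \<in> set (body r). ren (at h) a \<in> set C) \<longrightarrow>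
        (\<exists>\<psi> \<in> set (heads r). \<exists>g \<in> set (List.n_lists K [0..<K]).
           (\<forall>x \<in> set (uvars r). at g x = at h x) \<and>
           (\<exists>C' \<in> set T. (\<forall>a \<in> set \<psi>. ren (at g) a \<in> set C') \<and>
              same_type S K (map (at h) (uvars r)) C C')))"

text \<open>The union of all closed sets, hence the greatest one; enumerating the subsets replaces a
  fixed point iteration.\<close>

definition coherent :: "schema \<Rightarrow> nat \<Rightarrow> dexr list \<Rightarrow> atom list list" where
  "coherent S K \<Sigma> =
     filter (\<lambda>C. \<exists>T \<in> set (subseqs (mosaics S K)). closed S K \<Sigma> T \<and> C \<in> set T) (mosaics S K)"

definition heads_for :: "schema \<Rightarrow> nat \<Rightarrow> dexr list \<Rightarrow> atom \<Rightarrow> atom list list" where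
  "heads_for S K \<Sigma> b = filter (\<lambda>C. b \<in> set C) (coherent S K \<Sigma>)"

definition rewriting :: "schema \<Rightarrow> nat \<Rightarrow> dexr list \<Rightarrow> dexr list" where
  "rewriting S K \<Sigma> =
     filter (\<lambda>r. body r = []) \<Sigma> @ map (\<lambda>b. Dexr [b] (heads_for S K \<Sigma> b)) (atoms_upto S K)"

text \<open>Block 0 holds the rule variables, which the copies share. Block \<open>Suc i\<close>
  holds the remaining elements of the \<open>i\<close>-th mosaic, so copies meet only in common
  variables of their atoms.\<close>

definition glue :: "nat \<Rightarrow> atom list \<Rightarrow> atom list list \<Rightarrow> atom list" where
  "glue N bs Cs =
     concat (map (\<lambda>i. map (ren (\<lambda>v. if v \<in> set (args (nth_default (Atom 0 []) bs i)) then v else Suc i * N + v))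
         (nth_default [] Cs i))
       [0..<length bs])"

text \<open>The glued structure consists of block 0 and one block of size \<open>width S K\<close>
  per body atom, and head variables lie below \<open>K\<close>; this explains the bounds of the
  search.\<close>

definition separable :: "schema \<Rightarrow> nat \<Rightarrow> dexr list \<Rightarrow> bool" where
  "separable S K \<Sigma> \<longleftrightarrow>
     (\<forall>r \<in> set \<Sigma>. body r \<noteq> [] \<longrightarrow>
        (\<forall>Cs \<in> set (List.n_lists (length (body r)) (mosaics S K)).
           (\<forall>i \<in> set [0..<length (body r)]. nth_default [] Cs i \<in> set (heads_for S K \<Sigma> (nth_default (Atom 0 []) (body r) i))) \<longrightarrow>
           (\<exists>\<psi> \<in> set (heads r).
              hom_exists (Suc (length (body r)) * width S K) K (uvars r) \<psi>
                (glue (width S K) (body r) Cs))))"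

section \<open>Mosaics realized in models are coherent, and the linear rules are sound\<close>

section \<open>Mosaics of models\<close>

lemma subseqs_exists:
  assumes "A \<subseteq> set xs"
  obtains ys where "ys \<in> set (subseqs xs)" "set ys = A"
proof -
  have "A \<in> set ` set (subseqs xs)" using assms by (simp add: subseqs_powset)
  with that show ?thesis by auto
qed

lemma subseqs_subset: "ys \<in> set (subseqs xs) \<Longrightarrow> set ys \<subseteq> set xs"
  using subseqs_powset[of xs] by blast

lemma dexr_over_facts:
  "is_structure S D I \<Longrightarrow> a \<in> facts I \<Longrightarrow> atom_over S a \<and> set (args a) \<subseteq> D"
  by (auto simp: is_structure_def facts_def atom_over_def)

lemma sat_dexrD:
  assumes "sat_dexr D I r" "range s \<subseteq> D" "sat_atoms I s (body r)"
  obtains \<psi> t where "\<psi> \<in> set (heads r)" "range t \<subseteq> D"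
    "\<And>x. x \<in> universal_vars r \<Longrightarrow> t x = s x" "\<And>a. a \<in> set \<psi> \<Longrightarrow> ren t a \<in> facts I"
proof -
  have "\<exists>\<psi> \<in> set (heads r). \<exists>t. range t \<subseteq> D \<and> (\<forall>x \<in> universal_vars r. t x = s x) \<and> sat_atoms I t \<psi>"
    using assms(1)[unfolded sat_dexr_def, THEN spec, THEN mp, OF conjI[OF assms(2,3)]] .
  with that show ?thesis unfolding sat_atoms_iff by blast
qed

locale guarded_rules =
  fixes S :: schema and K :: nat and \<Sigma> :: "dexr list"
  assumes over: "r \<in> set \<Sigma> \<Longrightarrow> dexr_over S r"
    and guarded: "r \<in> set \<Sigma> \<Longrightarrow> guarded r"
    and body_vars: "r \<in> set \<Sigma> \<Longrightarrow> a \<in> set (body r) \<Longrightarrow> set (args a) \<subseteq> {..<K}"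
    and head_vars: "r \<in> set \<Sigma> \<Longrightarrow> \<psi> \<in> set (heads r) \<Longrightarrow> a \<in> set \<psi> \<Longrightarrow> set (args a) \<subseteq> {..<K}"
    and K_pos: "0 < K"
begin

abbreviation N where "N \<equiv> width S K"

lemma K_le_N: "K \<le> N" by (simp add: width_def)

lemma N_pos: "0 < N" using K_pos K_le_N by simp

lemma uvars_less: "r \<in> set \<Sigma> \<Longrightarrow> set (uvars r) \<subseteq> {..<K}"
  using body_vars by (auto simp: uvars_def subset_iff)

lemma mosaic_atoms:
  assumes "C \<in> set (mosaics S K)" "a \<in> set C"
  shows "atom_over S a" "set (args a) \<subseteq> {..<N}"
  using subseqs_subset[of C "atoms_upto S N"] assms by (auto simp: mosaics_def set_atoms_upto)

lemma elems_mosaic: "C \<in> set (mosaics S K) \<Longrightarrow> elems (set C) \<subseteq> {..<N}"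
  using mosaic_atoms(2) by (fastforce simp: elems_def)

lemma query_exists:
  assumes "\<And>a. a \<in> q \<Longrightarrow> atom_over S a \<and> set (args a) \<subseteq> X \<union> {K..<2*K}" "X \<subseteq> {..<K}"
  obtains q' where "q' \<in> set (queries S K)" "set q' = q"
proof -
  have "q \<subseteq> set (atoms_upto S (2 * K))"
    using assms by (fastforce simp: set_atoms_upto)
  with that show ?thesis unfolding queries_def by (metis subseqs_exists)
qed

text \<open>Links the executable comparison to the abstract one: an abstract query is a set of atoms
  over variables below \<open>2 * K\<close>, hence the set of some listed query, and its truth in a
  mosaic is decided by the bounded search.\<close>

lemma same_type_iff:
  assumes X: "set X \<subseteq> {..<K}" and C: "C \<in> set (mosaics S K)" and C': "C' \<in> set (mosaics S K)"
  shows "same_type S K X C C' \<longleftrightarrow>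
    type_le S K (set X) (set C) (\<lambda>x. x) (set C') (\<lambda>x. x) \<and>
    type_le S K (set X) (set C') (\<lambda>x. x) (set C) (\<lambda>x. x)"
proof -
  define H where "H C q \<longleftrightarrow> (\<exists>t. (\<forall>x \<in> set X. t x = x) \<and> ren t ` q \<subseteq> set C)" for C q
  define P where "P q \<longleftrightarrow> (\<forall>a \<in> q. atom_over S a \<and> set (args a) \<subseteq> set X \<union> {K..<2*K})" for q
  have hom: "hom_exists N (2 * K) X q C \<longleftrightarrow> H C (set q)"
    if "q \<in> set (queries S K)" "C \<in> set (mosaics S K)" for q C
  proof -
    have "set (args a) \<subseteq> {..<2*K}" if "a \<in> set q" for a
      using subseqs_subset[of q "atoms_upto S (2 * K)"] that \<open>q \<in> _\<close>
      by (auto simp: queries_def set_atoms_upto)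
    then show ?thesis
      unfolding H_def image_subset_iff using N_pos X K_le_N elems_mosaic[OF that(2)]
      by (intro hom_exists_iff) fastforce+
  qed
  have PI: "P (set q) \<longleftrightarrow> (\<forall>a \<in> set q. \<forall>v \<in> set (args a). v \<in> set X \<or> K \<le> v)"
    if "q \<in> set (queries S K)" for q
    using subseqs_subset[of q "atoms_upto S (2 * K)"] that
    by (fastforce simp: queries_def set_atoms_upto P_def)
  have "same_type S K X C C' \<longleftrightarrow> (\<forall>q. P q \<longrightarrow> H C q = H C' q)"
  proof
    assume st: "same_type S K X C C'"
    show "\<forall>q. P q \<longrightarrow> H C q = H C' q"
    proof (intro allI impI)
      fix q assume "P q"
      then obtain q' where q': "q' \<in> set (queries S K)" "set q' = q"
        using query_exists[of q "set X"] X unfolding P_def by metis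
      with \<open>P q\<close> PI st show "H C q = H C' q"
        unfolding same_type_def using hom[OF q'(1)] C C' by blast
    qed
  next
    assume "\<forall>q. P q \<longrightarrow> H C q = H C' q"
    then show "same_type S K X C C'"
      unfolding same_type_def using hom C C' PI by blast
  qed
  also have "\<dots> \<longleftrightarrow> (\<forall>q. P q \<longrightarrow> H C q \<longrightarrow> H C' q) \<and> (\<forall>q. P q \<longrightarrow> H C' q \<longrightarrow> H C q)"
    by blast
  finally show ?thesis unfolding type_le_def P_def H_def .
qed

text \<open>\<open>C\<close> is the preimage of \<open>J\<close> under \<open>e\<close>, cut to
  width \<open>N\<close>; the last clause says that the cut loses no query at the slots. The
  converse comparison is automatic, since \<open>e\<close> is a homomorphism.\<close>

definition approximates :: "atom list \<Rightarrow> (nat \<Rightarrow> nat) \<Rightarrow> atom set \<Rightarrow> bool" where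
  "approximates C e J \<longleftrightarrow> C \<in> set (mosaics S K) \<and>
     (\<forall>a. a \<in> set C \<longleftrightarrow> a \<in> set (atoms_upto S N) \<and> ren e a \<in> J) \<and>
     type_le S K {..<K} J e (set C) (\<lambda>x. x)"

lemma approximatesD:
  assumes "approximates C e J"
  shows "C \<in> set (mosaics S K)" "a \<in> set C \<Longrightarrow> ren e a \<in> J"
    "atom_over S a \<Longrightarrow> set (args a) \<subseteq> {..<N} \<Longrightarrow> ren e a \<in> J \<Longrightarrow> a \<in> set C"
    "type_le S K {..<K} J e (set C) (\<lambda>x. x)" "type_le S K {..<K} (set C) (\<lambda>x. x) J e"
proof -
  show "type_le S K {..<K} (set C) (\<lambda>x. x) J e"
    using assms by (intro type_le_hom[where r = e]) (auto simp: approximates_def)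
qed (use assms in \<open>auto simp: approximates_def set_atoms_upto\<close>)

text \<open>The slots copy \<open>s\<close>. Behind them comes one block of \<open>K\<close>
  elements for each listed query, which copies a witness of the query if there is one.\<close>

lemma approximant_exists:
  assumes J: "\<And>a. a \<in> J \<Longrightarrow> atom_over S a \<and> set (args a) \<subseteq> D" and s: "range s \<subseteq> D"
  obtains e C where "approximates C e J" "\<And>v. v < K \<Longrightarrow> e v = s v" "range e \<subseteq> D"
proof -
  let ?Q = "queries S K"
  define M where "M q t \<longleftrightarrow> (\<forall>x < K. t x = s x) \<and> (\<forall>a \<in> set q. ren t a \<in> J)" for q t
  define w where "w q = (SOME t. M q t)" for q
  \<comment> \<open>Element \<open>v\<close> behind the slots belongs to query number
    \<open>(v - K) div K\<close> and stands for its existential variable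
    \<open>K + (v - K) mod K\<close>.\<close>
  define u where "u v = w (?Q ! ((v - K) div K)) (K + (v - K) mod K)" for v
  \<comment> \<open>A chosen witness is arbitrary on variables that do not occur in the query; the
    default \<open>s v\<close> keeps the range of \<open>e\<close> inside \<open>D\<close>.\<close>
  define e where "e v = (if K \<le> v \<and> u v \<in> D then u v else s v)" for v
  have e_low: "e v = s v" if "v < K" for v using that by (simp add: e_def)
  have e_D: "range e \<subseteq> D" using s by (auto simp: e_def)
  obtain C where C: "C \<in> set (mosaics S K)" "set C = {a \<in> set (atoms_upto S N). ren e a \<in> J}"
    unfolding mosaics_def by (rule subseqs_exists[of "{a \<in> set (atoms_upto S N). ren e a \<in> J}"]) auto
  have "type_le S K {..<K} J e (set C) (\<lambda>x. x)"
  proof (rule type_leI)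
    fix q t
    assume q: "\<And>a. a \<in> q \<Longrightarrow> atom_over S a \<and> set (args a) \<subseteq> {..<K} \<union> {K..<2*K}"
      and t: "\<And>x. x \<in> {..<K} \<Longrightarrow> t x = e x" "\<And>a. a \<in> q \<Longrightarrow> ren t a \<in> J"
    obtain q' where q': "q' \<in> set ?Q" "set q' = q" using query_exists[of q "{..<K}"] q by blast
    then obtain j where j: "j < length ?Q" "?Q ! j = q'" by (auto simp: in_set_conv_nth)
    have "M q' t" using t q' e_low by (auto simp: M_def)
    then have w: "M q' (w q')" unfolding w_def by (rule someI[of "M q'"])
    define t' where "t' v = (if v < K then v else K + (j * K + (v - K)))" for v
    have v: "t' v < N \<and> e (t' v) = w q' v" if "a \<in> q" "v \<in> set (args a)" for a v
    proof (cases "v < K")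
      case True
      then show ?thesis using w K_le_N by (auto simp: t'_def e_low M_def)
    next
      case False
      then have v: "K \<le> v" "v - K < K" using q that by fastforce+
      have "j * K + (v - K) < Suc j * K" using v(2) by simp
      also have "\<dots> \<le> K * length ?Q"
        using j(1) by (metis Suc_leI mult.commute mult_le_mono2)
      finally have less: "t' v < N" using False by (simp add: t'_def width_def)
      have "t' v - K = j * K + (v - K)" using False by (simp add: t'_def)
      moreover have "(j * K + (v - K)) div K = j" "(j * K + (v - K)) mod K = v - K"
        using v(2) by (simp_all only: div_mult_self3 mod_mult_self3 div_less mod_less)
      ultimately have "u (t' v) = w q' v" unfolding u_def using v j by simp
      moreover have "w q' v \<in> D"
      proof -
        have "ren (w q') a \<in> J" using w that(1) q' by (auto simp: M_def)
        then have "set (args (ren (w q') a)) \<subseteq> D" using J by blast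
        then show ?thesis using that(2) by auto
      qed
      ultimately show ?thesis using less v by (simp add: e_def) (simp add: t'_def)
    qed
    have "ren t' a \<in> set C" if "a \<in> q" for a
    proof -
      have "ren e (ren t' a) = ren (w q') a" unfolding ren_ren using v[OF that] by (intro ren_cong) auto
      moreover have "ren (w q') a \<in> J" using w that q' by (auto simp: M_def)
      ultimately show ?thesis using q[OF that] v[OF that] by (auto simp: C set_atoms_upto)
    qed
    then show "\<exists>t. (\<forall>x\<in>{..<K}. t x = x) \<and> (\<forall>a\<in>q. ren t a \<in> set C)"
      by (intro exI[of _ t']) (simp add: t'_def)
  qed
  then have "approximates C e J" using C by (auto simp: approximates_def)
  with e_low e_D that show ?thesis by blast
qed

text \<open>A rule that fires on slots of \<open>C\<close> fires on their images in the model. The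
  match of its head is approximated by a mosaic again, and both mosaics inherit from the model the
  same type on the shared slots.\<close>

lemma realized_types_closed:
  assumes struct: "is_structure S D I" and model: "is_model D I (set \<Sigma>)"
    and T: "set T = {C. \<exists>e. range e \<subseteq> D \<and> approximates C e (facts I)}"
  shows "closed S K \<Sigma> T"
  unfolding closed_def
proof (intro ballI impI)
  fix C r h
  assume CT: "C \<in> set T" and r: "r \<in> set \<Sigma>" and h: "h \<in> set (List.n_lists K [0..<K])"
    and b: "\<forall>a \<in> set (body r). ren (at h) a \<in> set C"
  obtain e where e: "range e \<subseteq> D" "approximates C e (facts I)" using CT T by auto
  note ap = approximatesD[OF e(2)]
  have "range (\<lambda>x. e (at h x)) \<subseteq> D" using e(1) by auto
  moreover have "sat_atoms I (\<lambda>x. e (at h x)) (body r)" unfolding sat_atoms_iff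
  proof
    fix a assume "a \<in> set (body r)"
    then show "ren (\<lambda>x. e (at h x)) a \<in> facts I"
      using ap(2)[of "ren (at h) a"] b by simp
  qed
  moreover have "sat_dexr D I r" using model r by (simp add: is_model_def)
  ultimately obtain \<psi> t where \<psi>: "\<psi> \<in> set (heads r)" and t: "range t \<subseteq> D"
    "\<And>x. x \<in> universal_vars r \<Longrightarrow> t x = e (at h x)" "\<And>a. a \<in> set \<psi> \<Longrightarrow> ren t a \<in> facts I"
    using sat_dexrD[of D I r "\<lambda>x. e (at h x)"] by metis
  define U where "U = set (uvars r)"
  define X where "X = at h ` U"
  have U: "U \<subseteq> {..<K}" using uvars_less[OF r] by (simp add: U_def)
  have X: "X \<subseteq> {..<K}" using n_lists_nth_less[OF h] U by (auto simp: X_def)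
  \<comment> \<open>\<open>X\<close> is an image of \<open>U\<close>, so there are at least as many
    slots outside \<open>X\<close> as variables outside \<open>U\<close>: every variable that is not
    universal gets a slot of its own.\<close>
  have "card ({..<K} - U) \<le> card ({..<K} - X)"
    using U X card_image_le[of U "at h"] finite_subset[OF U] finite_subset[OF X]
    by (simp add: card_Diff_subset X_def)
  then obtain i where i: "i ` ({..<K} - U) \<subseteq> {..<K} - X" "inj_on i ({..<K} - U)"
    using card_le_inj[of "{..<K} - U" "{..<K} - X"] by auto
  define g where "g = map (\<lambda>x. if x \<in> U then at h x else i x) [0..<K]"
  have g_nth: "at g x = (if x \<in> U then at h x else i x)" if "x < K" for x
    using that by (simp add: g_def)
  have g: "g \<in> set (List.n_lists K [0..<K])"
    unfolding g_def map_in_n_lists using n_lists_nth_less[OF h] i(1) by auto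
  \<comment> \<open>The tuple to be approximated: shared slots keep their elements, the slot of an
    existential variable gets its value under \<open>t\<close>, and the remaining slots may hold any
    element of \<open>D\<close>.\<close>
  define s where "s v = (if v \<in> X then e v else if v \<in> i ` ({..<K} - U) then t (inv_into ({..<K} - U) i v) else e v)" for v
  have s_D: "range s \<subseteq> D" using e(1) t(1) by (auto simp: s_def)
  have s_g: "s (at g x) = t x" if "x < K" for x
  proof (cases "x \<in> U")
    case True
    then show ?thesis using that t(2)[of x] by (simp add: g_nth s_def X_def U_def set_uvars)
  next
    case False
    then have "i x \<notin> X" "i x \<in> i ` ({..<K} - U)" using that i(1) by auto
    then show ?thesis using that False i(2) by (simp add: g_nth s_def)
  qed
  obtain e' C' where ap': "approximates C' e' (facts I)" and e': "\<And>v. v < K \<Longrightarrow> e' v = s v" "range e' \<subseteq> D"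
    using approximant_exists[of "facts I" D s] dexr_over_facts[OF struct] s_D by metis
  have "ren (at g) a \<in> set C'" if "a \<in> set \<psi>" for a
  proof (rule approximatesD(3)[OF ap'])
    have a: "set (args a) \<subseteq> {..<K}" using head_vars[OF r \<psi> that] .
    then have gl: "at g x < K" if "x \<in> set (args a)" for x using that n_lists_nth_less[OF g] by auto
    show "atom_over S (ren (at g) a)"
      using over[OF r] \<psi> that by (auto simp: dexr_over_def)
    show "set (args (ren (at g) a)) \<subseteq> {..<N}" using gl K_le_N by fastforce
    have "ren e' (ren (at g) a) = ren t a"
      unfolding ren_ren using a gl by (intro ren_cong) (auto simp: e' s_g)
    then show "ren e' (ren (at g) a) \<in> facts I" using t(3)[OF that] by simp
  qed
  moreover have "same_type S K (map (at h) (uvars r)) C C'"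
  proof -
    have eq: "e' x = e x" if "x \<in> X" for x using that X e'(1) by (auto simp: s_def)
    have JJ: "type_le S K X (facts I) e (facts I) e'" "type_le S K X (facts I) e' (facts I) e"
      using eq by (auto intro!: type_le_hom[where r = "\<lambda>x. x"])
    have "type_le S K X (set C) (\<lambda>x. x) (set C') (\<lambda>x. x)"
      using type_le_restrict[OF ap(5) X] type_le_restrict[OF approximatesD(4)[OF ap'] X] JJ
      by (blast intro: type_le_trans)
    moreover have "type_le S K X (set C') (\<lambda>x. x) (set C) (\<lambda>x. x)"
      using type_le_restrict[OF ap(4) X] type_le_restrict[OF approximatesD(5)[OF ap'] X] JJ
      by (blast intro: type_le_trans)
    moreover have "set (map (at h) (uvars r)) = X" by (simp add: X_def U_def)
    ultimately show ?thesis using X ap(1) approximatesD(1)[OF ap'] by (subst same_type_iff) auto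
  qed
  moreover have "C' \<in> set T" using T ap' e'(2) by auto
  moreover have "\<forall>x \<in> set (uvars r). at g x = at h x" using g_nth U by (auto simp: U_def)
  ultimately show "\<exists>\<psi> \<in> set (heads r). \<exists>g \<in> set (List.n_lists K [0..<K]).
           (\<forall>x \<in> set (uvars r). at g x = at h x) \<and>
           (\<exists>C' \<in> set T. (\<forall>a \<in> set \<psi>. ren (at g) a \<in> set C') \<and>
              same_type S K (map (at h) (uvars r)) C C')"
    using \<psi> g by blast
qed

lemma approximates_coherent:
  assumes "is_structure S D I" "is_model D I (set \<Sigma>)" "approximates C e (facts I)" "range e \<subseteq> D"
  shows "C \<in> set (coherent S K \<Sigma>)"
proof -
  let ?T = "{C. \<exists>e. range e \<subseteq> D \<and> approximates C e (facts I)}"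
  have "?T \<subseteq> set (mosaics S K)" using approximatesD(1) by blast
  then obtain T where T: "T \<in> set (subseqs (mosaics S K))" "set T = ?T" by (rule subseqs_exists)
  have "closed S K \<Sigma> T" by (rule realized_types_closed[OF assms(1,2) T(2)])
  moreover have "C \<in> set T" using T assms(3,4) by auto
  ultimately show ?thesis
    using T(1) approximatesD(1)[OF assms(3)] unfolding coherent_def by auto
qed

text \<open>Approximate the model around the fact: the resulting mosaic contains \<open>b\<close>
  and is coherent. This makes the linear rules sound and, applied to one particular model, shows
  that they have heads.\<close>

lemma heads_for_real:
  assumes struct: "is_structure S D I" and model: "is_model D I (set \<Sigma>)"
    and b: "b \<in> set (atoms_upto S K)" and s: "range s \<subseteq> D" "ren s b \<in> facts I"
  shows "\<exists>C \<in> set (heads_for S K \<Sigma> b). \<exists>e. range e \<subseteq> D \<and> (\<forall>x \<in> set (args b). e x = s x) \<and>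
           sat_atoms I e C"
proof -
  obtain e C where e: "approximates C e (facts I)" "\<And>v. v < K \<Longrightarrow> e v = s v" "range e \<subseteq> D"
    using approximant_exists[of "facts I" D s] dexr_over_facts[OF struct] s(1) by metis
  have b': "atom_over S b" "set (args b) \<subseteq> {..<K}" using b by (auto simp: set_atoms_upto)
  then have "ren e b = ren s b" using e(2) by (intro ren_cong) auto
  moreover have "set (args b) \<subseteq> {..<N}" using b'(2) K_le_N by auto
  ultimately have "b \<in> set C" using approximatesD(3)[OF e(1), of b] b'(1) s(2) by simp
  then have "C \<in> set (heads_for S K \<Sigma> b)"
    using approximates_coherent[OF struct model e(1,3)] by (simp add: heads_for_def)
  moreover have "sat_atoms I e C" unfolding sat_atoms_iff using approximatesD(2)[OF e(1)] by blast
  moreover have "\<forall>x \<in> set (args b). e x = s x" using e(2) b'(2) by auto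
  ultimately show ?thesis using e(3) by blast
qed

lemma model_rewriting:
  assumes "is_structure S D I" "is_model D I (set \<Sigma>)"
  shows "is_model D I (set (rewriting S K \<Sigma>))"
  unfolding is_model_def
proof
  fix r assume "r \<in> set (rewriting S K \<Sigma>)"
  then consider "r \<in> set \<Sigma>" | b where "b \<in> set (atoms_upto S K)" "r = Dexr [b] (heads_for S K \<Sigma> b)"
    by (auto simp: rewriting_def)
  then show "sat_dexr D I r"
  proof cases
    case 1
    then show ?thesis using assms(2) by (simp add: is_model_def)
  next
    case 2
    show ?thesis unfolding sat_dexr_def
    proof (intro allI impI)
      fix s assume "range s \<subseteq> D \<and> sat_atoms I s (body r)"
      then have "range s \<subseteq> D" "ren s b \<in> facts I" using 2 by (auto simp: sat_atoms_iff)
      from heads_for_real[OF assms 2(1) this] show "\<exists>\<psi>\<in>set (heads r). \<exists>t. range t \<subseteq> D \<and>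
        (\<forall>x\<in>universal_vars r. t x = s x) \<and> sat_atoms I t \<psi>"
        by (simp add: 2 universal_vars_def)
    qed
  qed
qed

text \<open>A dexr needs at least one disjunct. The one-element structure with all facts over the
  schema satisfies every rule and matches every atom, so it supplies a mosaic.\<close>

lemma heads_for_nonempty:
  assumes "b \<in> set (atoms_upto S K)"
  shows "heads_for S K \<Sigma> b \<noteq> []"
proof -
  let ?I = "\<lambda>R. {t. (R, length t) \<in> set S \<and> set t \<subseteq> {0}}"
  have facts: "facts ?I = {a. atom_over S a \<and> set (args a) \<subseteq> {0}}"
    by (auto simp: facts_def atom_over_def)
  have struct: "is_structure S {0} ?I" by (auto simp: is_structure_def)
  have "sat_dexr {0} ?I r" if "r \<in> set \<Sigma>" for r
    unfolding sat_dexr_def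
  proof (intro allI impI)
    fix s :: "nat \<Rightarrow> nat" assume s: "range s \<subseteq> {0} \<and> sat_atoms ?I s (body r)"
    have "hd (heads r) \<in> set (heads r)" and "\<forall>a \<in> set (hd (heads r)). atom_over S a"
      using over[OF that] by (auto simp: dexr_over_def)
    moreover from this(2) have "sat_atoms ?I (\<lambda>_. 0) (hd (heads r))"
      by (auto simp: sat_atoms_iff facts)
    ultimately show "\<exists>\<psi>\<in>set (heads r). \<exists>t. range t \<subseteq> {0} \<and> (\<forall>x\<in>universal_vars r. t x = s x) \<and>
        sat_atoms ?I t \<psi>"
      using s by (intro bexI[of _ "hd (heads r)"] exI[of _ "\<lambda>_. 0"]) auto
  qed
  then have "is_model {0} ?I (set \<Sigma>)" by (simp add: is_model_def)
  moreover have "ren (\<lambda>_. 0) b \<in> facts ?I" using assms by (auto simp: facts set_atoms_upto)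
  ultimately show ?thesis using heads_for_real[OF struct _ assms, of "\<lambda>_. 0"] by auto
qed

end

section \<open>Unfolding a closed set of mosaics into a model with controlled types\<close>

section \<open>Tree models\<close>

instance atom :: countable by countable_datatype

text \<open>
  A node of a tree model is the list of labels on the path to the root, where \<open>(X, C)\<close> stands for
  a copy of the mosaic \<open>C\<close> that shares the slots \<open>X\<close> with its parent. Elements are tagged with the
  node that introduces them and with a number \<open>i\<close> that keeps several trees apart; only the root
  slots \<open>Y\<close>, with tag 0, are common to all trees.
\<close>

type_synonym node = "(nat list \<times> atom list) list"

fun place :: "nat \<Rightarrow> nat set \<Rightarrow> node \<Rightarrow> nat \<Rightarrow> nat" where
  "place i Y [] v =
     (if v \<in> Y then prod_encode (0, v) else prod_encode (Suc (prod_encode (i, to_nat ([] :: node))), v))"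
| "place i Y ((X, C) # p) v =
     (if v \<in> set X then place i Y p v
      else prod_encode (Suc (prod_encode (i, to_nat ((X, C) # p :: node))), v))"

fun label :: "atom list \<Rightarrow> node \<Rightarrow> atom list" where
  "label C0 [] = C0"
| "label C0 ((X, C) # p) = C"

text \<open>An element is a common root slot or is introduced at an ancestor, that is, at a suffix
  of the node. In both cases its name records \<open>v\<close>, which makes \<open>place\<close>
  injective on each node.\<close>

lemma place_cases:
  "(v \<in> Y \<and> place i Y c v = prod_encode (0, v)) \<or>
   (\<exists>p zs. c = zs @ p \<and> place i Y c v = prod_encode (Suc (prod_encode (i, to_nat p)), v))"
proof (induction i Y c v rule: place.induct)
  case (2 i Y X C p v)
  show ?case
  proof (cases "v \<in> set X")
    case True
    with 2[OF True] show ?thesis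
      by (metis append_Cons place.simps(2))
  next
    case False
    then show ?thesis
      by (intro disjI2 exI[of _ "(X, C) # p"] exI[of _ "[]"]) simp
  qed
qed (auto intro: exI[of _ "[]"])

lemma place_inj: "place i Y c v = place i Y c w \<Longrightarrow> v = w"
  using place_cases[of v Y i c] place_cases[of w Y i c] by auto

declare place.simps [simp del]

context guarded_rules
begin

context
  fixes T :: "atom list list" and C0 :: "atom list" and i :: nat and Y :: "nat set"
  assumes T_closed: "closed S K \<Sigma> T" and T_sub: "set T \<subseteq> set (mosaics S K)" and C0: "C0 \<in> set T"
begin

text \<open>A child may share any slots on which the types agree, whether or not a rule asks for it;
  the type bound covers the extra branches as well.\<close>

inductive valid :: "node \<Rightarrow> bool" where
  root: "valid []"
| child: "valid p \<Longrightarrow> C \<in> set T \<Longrightarrow> set X \<subseteq> {..<K} \<Longrightarrow> same_type S K X (label C0 p) C \<Longrightarrow>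
    valid ((X, C) # p)"

abbreviation pl where "pl \<equiv> place i Y"
abbreviation lab where "lab \<equiv> label C0"

lemma valid_label: "valid p \<Longrightarrow> lab p \<in> set T"
  by (cases p rule: valid.cases) (auto simp: C0)

lemma valid_label_mosaic: "valid p \<Longrightarrow> lab p \<in> set (mosaics S K)"
  using valid_label T_sub by blast

text \<open>Finite subtrees, generated by adding one leaf at a time; this is the induction along
  which mosaics are glued.\<close>

inductive prefix_closed :: "node set \<Rightarrow> bool" where
  single: "prefix_closed {[]}"
| extend: "prefix_closed F \<Longrightarrow> p \<in> F \<Longrightarrow> valid ((X, C) # p) \<Longrightarrow> (X, C) # p \<notin> F \<Longrightarrow>
    prefix_closed (insert ((X, C) # p) F)"

lemma prefix_closed_suffix:
  "prefix_closed F \<Longrightarrow> zs @ p \<in> F \<Longrightarrow> p \<in> F"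
proof (induction arbitrary: zs p rule: prefix_closed.induct)
  case (extend F q X C)
  show ?case
  proof (cases zs)
    case (Cons z zs')
    with extend.prems have "zs @ p \<in> F \<or> zs' @ p = q" by auto
    then show ?thesis using extend.IH extend.hyps(2) by blast
  qed (use extend.prems in auto)
qed auto

lemma prefix_closed_valid: "prefix_closed F \<Longrightarrow> c \<in> F \<Longrightarrow> valid c"
  by (induction arbitrary: c rule: prefix_closed.induct) (auto intro: valid.intros)

lemma prefix_closed_insert:
  assumes "prefix_closed F" "valid c"
  shows "\<exists>F'. F \<subseteq> F' \<and> prefix_closed F' \<and> c \<in> F'"
  using assms(2)
proof (induction)
  case root
  have "[] \<in> F" using assms(1) by (induction) auto
  with assms(1) show ?case by blast
next
  case (child p C X)
  then obtain F' where F': "F \<subseteq> F'" "prefix_closed F'" "p \<in> F'" by blast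
  have "valid ((X, C) # p)" using child.hyps by (rule valid.child)
  then show ?case
    using F' prefix_closed.extend[OF F'(2,3), of X C] by (cases "(X, C) # p \<in> F'") blast+
qed

lemma prefix_closed_superset:
  assumes "finite A" "\<And>c. c \<in> A \<Longrightarrow> valid c"
  shows "\<exists>F. A \<subseteq> F \<and> prefix_closed F"
  using assms
proof (induction A)
  case empty
  then show ?case using prefix_closed.single by blast
next
  case (insert c A)
  then obtain F where "A \<subseteq> F" "prefix_closed F" by auto
  with insert.prems prefix_closed_insert[of F c] show ?case by blast
qed

text \<open>Whole mosaics are glued, witnesses included, so that every node has at least the type of
  its label. The facts of \<open>tree_model\<close> lie in such amalgams, which bounds its types
  from above.\<close>

definition amalgam :: "node set \<Rightarrow> atom set" where
  "amalgam F = (\<Union>c \<in> F. ren (pl c) ` set (lab c))"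

text \<open>Facts on witnesses are left out: closedness satisfies rules only at slots, so the image
  of a guard has to lie on slots of one node.\<close>

definition tree_model :: "atom set" where
  "tree_model = (\<Union>c \<in> Collect valid. ren (pl c) ` {a \<in> set (lab c). set (args a) \<subseteq> {..<K}})"

lemma elems_amalgam: "elems (amalgam F) \<subseteq> (\<Union>c \<in> F. range (pl c))"
  by (auto simp: amalgam_def)

text \<open>An element new at a leaf carries the leaf in its name. If an older node used it, the
  leaf would be a suffix of that node and hence already in \<open>F\<close>.\<close>

lemma place_fresh:
  assumes "prefix_closed F" "(X, C) # p \<notin> F" "b \<in> F" "pl ((X, C) # p) v = pl b w" "v \<notin> set X"
  shows False
  using place_cases[of w Y i b] assms prefix_closed_suffix[OF assms(1)] by (auto simp: place.simps)

lemma label_le_amalgam: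
  assumes "c \<in> F" "X \<subseteq> {..<K}" "\<And>x. x \<in> X \<Longrightarrow> f x = pl c x"
    and "type_le S K X A (\<lambda>x. x) (set (lab c)) (\<lambda>x. x)"
  shows "type_le S K X A (\<lambda>x. x) (amalgam F) f"
  using assms by (intro type_le_trans[OF assms(4)] type_le_hom[where r = "pl c"])
    (auto simp: amalgam_def)

lemma type_le_pull:
  "type_le S K X (ren (pl c) ` A) (pl c) A (\<lambda>x. x)"
proof (rule type_le_hom[where r = "inv (pl c)"])
  have inj: "inj (pl c)" using place_inj by (auto simp: inj_def)
  show "inv (pl c) (pl c x) = x" for x using inj by simp
  show "ren (inv (pl c)) a \<in> A" if "a \<in> ren (pl c) ` A" for a
    using that inj by auto
qed

text \<open>A new leaf meets the old part only in the shared slots, where the types agree. Seen from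
  the leaf, the old part may be replaced by the copy of the leaf's mosaic; seen from an old node,
  the leaf may be replaced by the old part.\<close>

lemma amalgam_types:
  assumes "prefix_closed F" "b \<in> F"
  shows "type_le S K {..<K} (amalgam F) (pl b) (set (lab b)) (\<lambda>x. x)"
  using assms
proof (induction arbitrary: b rule: prefix_closed.induct)
  case single
  then show ?case using type_le_pull[of "{..<K}" "[]"] by (simp add: amalgam_def)
next
  case (extend F p X C)
  let ?c = "(X, C) # p"
  let ?A = "ren (pl ?c) ` set C"
  have am: "amalgam (insert ?c F) = amalgam F \<union> ?A" by (auto simp: amalgam_def)
  from extend.hyps(3) have X: "set X \<subseteq> {..<K}" and st: "same_type S K X (lab p) C"
    and C: "C \<in> set T" by (auto elim: valid.cases)
  have ms: "lab p \<in> set (mosaics S K)" "C \<in> set (mosaics S K)"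
    using valid_label_mosaic prefix_closed_valid[OF extend.hyps(1,2)] C T_sub by auto
  note st' = same_type_iff[OF X ms, THEN iffD1, OF st]
  have plX: "pl ?c x = pl p x" if "x \<in> set X" for x using that by (simp add: place.simps)
  have fresh: "range (pl ?c) \<inter> (\<Union>b' \<in> F. range (pl b')) \<subseteq> pl ?c ` set X"
  proof
    fix d assume "d \<in> range (pl ?c) \<inter> (\<Union>b' \<in> F. range (pl b'))"
    then obtain v b' w where d: "d = pl ?c v" "b' \<in> F" "pl ?c v = pl b' w" by blast
    then have "v \<in> set X" using place_fresh[OF extend.hyps(1,4)] by blast
    with d(1) show "d \<in> pl ?c ` set X" by blast
  qed
  have A: "elems ?A \<subseteq> range (pl ?c)" unfolding elems_image by blast
  \<comment> \<open>On \<open>X\<close> the leaf satisfies no more queries than the label of its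
    parent, and a copy of that label is part of \<open>amalgam F\<close>.\<close>
  have lr: "type_le S K (set X) ?A (pl ?c) (amalgam F) (pl ?c)"
    by (rule type_le_trans[OF type_le_pull label_le_amalgam[of p]])
      (use extend.hyps(2) X st' plX in auto)
  consider "b = ?c" | "b \<in> F" using extend.prems by auto
  then show ?case
  proof cases
    case 1
    have "type_le S K (set X) (amalgam F) (pl p) (set C) (\<lambda>x. x)"
      using type_le_restrict[OF extend.IH[OF extend.hyps(2)] X] st' type_le_trans by blast
    then have "type_le S K (set X) (amalgam F) (pl ?c) (set C) (\<lambda>x. x)"
      using plX type_le_trans[OF type_le_hom[of "amalgam F" "\<lambda>x. x" "amalgam F" "set X" "pl ?c" "pl p"]]
      by simp
    moreover have "type_le S K (set X) (set C) (\<lambda>x. x) ?A (pl ?c)"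
      by (rule type_le_hom[where r = "pl ?c"]) auto
    ultimately have "type_le S K (set X) (amalgam F) (pl ?c) ?A (pl ?c)"
      by (rule type_le_trans)
    moreover have "(elems ?A \<union> pl ?c ` {..<K}) \<inter> elems (amalgam F) \<subseteq> pl ?c ` set X"
      by (rule order.trans[OF Int_mono[OF Un_least[OF A image_mono[OF subset_UNIV]] elems_amalgam] fresh])
    ultimately have "type_le S K {..<K} (?A \<union> amalgam F) (pl ?c) (?A \<union> ?A) (pl ?c)"
      by (rule type_le_replace[OF _ X order.refl])
    then show ?thesis
      unfolding am 1 using type_le_trans[OF _ type_le_pull[of "{..<K}" ?c "set C"]]
      by (simp add: Un_commute)
  next
    case 2
    have ran: "pl b ` {..<K} \<subseteq> (\<Union>b' \<in> F. range (pl b'))" using 2 by blast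
    have "(elems (amalgam F) \<union> pl b ` {..<K}) \<inter> elems ?A \<subseteq> pl ?c ` set X"
      unfolding Int_commute[of _ "elems ?A"]
      by (rule order.trans[OF Int_mono[OF A Un_least[OF elems_amalgam ran]] fresh])
    then have "type_le S K {..<K} (amalgam F \<union> ?A) (pl b) (amalgam F \<union> amalgam F) (pl b)"
      by (rule type_le_replace[OF lr X order.refl])
    then show ?thesis unfolding am using type_le_trans[OF _ extend.IH[OF 2]] by simp
  qed
qed

text \<open>A match uses finitely many facts, hence finitely many nodes, and these lie in a finite
  subtree together with \<open>b\<close>.\<close>

lemma tree_model_types:
  assumes "valid b"
  shows "type_le S K {..<K} tree_model (pl b) (set (lab b)) (\<lambda>x. x)"
proof (rule type_leI)
  fix q t
  assume q: "\<And>a. a \<in> q \<Longrightarrow> atom_over S a \<and> set (args a) \<subseteq> {..<K} \<union> {K..<2*K}"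
    and t: "\<And>x. x \<in> {..<K} \<Longrightarrow> t x = pl b x" "\<And>a. a \<in> q \<Longrightarrow> ren t a \<in> tree_model"
  have "q \<subseteq> set (atoms_upto S (2 * K))" using q by (fastforce simp: set_atoms_upto)
  then have fin: "finite q" using finite_subset by blast
  have "\<exists>c. valid c \<and> ren t a \<in> ren (pl c) ` set (lab c)" if "a \<in> q" for a
    using t(2)[OF that] by (auto simp: tree_model_def)
  then obtain n where n: "\<And>a. a \<in> q \<Longrightarrow> valid (n a) \<and> ren t a \<in> ren (pl (n a)) ` set (lab (n a))"
    by metis
  obtain F where F: "insert b (n ` q) \<subseteq> F" "prefix_closed F"
    using prefix_closed_superset[of "insert b (n ` q)"] fin n assms by blast
  have "ren t a \<in> amalgam F" if "a \<in> q" for a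
    using n[OF that] F(1) that unfolding amalgam_def by blast
  moreover have "b \<in> F" using F(1) by simp
  ultimately obtain t' where "\<And>x. x \<in> {..<K} \<Longrightarrow> t' x = x" "\<And>a. a \<in> q \<Longrightarrow> ren t' a \<in> set (lab b)"
    using type_leD[OF amalgam_types[OF F(2)] q t(1)] by blast
  then show "\<exists>t. (\<forall>x\<in>{..<K}. t x = x) \<and> (\<forall>a\<in>q. ren t a \<in> set (lab b))" by blast
qed

lemma tree_model_atoms: "a \<in> tree_model \<Longrightarrow> atom_over S a"
  using mosaic_atoms(1)[OF valid_label_mosaic] by (auto simp: tree_model_def)

text \<open>An atom over slots is a query without existential variables, so the type bound shows
  that the rest of the tree adds no fact on the slots of a node.\<close>

lemma tree_model_slot:
  assumes "valid b" "atom_over S a" "set (args a) \<subseteq> {..<K}" "ren (pl b) a \<in> tree_model"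
  shows "a \<in> set (lab b)"
proof -
  have "\<And>a'. a' \<in> {a} \<Longrightarrow> atom_over S a' \<and> set (args a') \<subseteq> {..<K} \<union> {K..<2*K}"
    and "\<And>a'. a' \<in> {a} \<Longrightarrow> ren (pl b) a' \<in> tree_model"
    using assms(2-4) by auto
  from type_leD[OF tree_model_types[OF assms(1)] this(1) refl this(2)]
  have "\<exists>t. (\<forall>x < K. t x = x) \<and> ren t a \<in> set (lab b)" by (metis lessThan_iff singletonI)
  then obtain t where "\<And>x. x < K \<Longrightarrow> t x = x" "ren t a \<in> set (lab b)" by blast
  moreover from this(1) have "ren t a = ren (\<lambda>x. x) a" using assms(3) by (intro ren_cong) auto
  ultimately show ?thesis by simp
qed

text \<open>The guard is matched by a fact of a single node, so all universal variables take values
  at its slots. By \<open>tree_model_slot\<close> the whole body then holds in the label of that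
  node, whichever nodes its facts come from, and closedness provides a child that satisfies a
  head.\<close>

lemma tree_model_sat:
  assumes r: "r \<in> set \<Sigma>"
  shows "sat_dexr UNIV (interp tree_model) r"
  unfolding sat_dexr_def
proof (intro allI impI)
  fix s assume "range s \<subseteq> UNIV \<and> sat_atoms (interp tree_model) s (body r)"
  then have s: "\<And>a. a \<in> set (body r) \<Longrightarrow> ren s a \<in> tree_model" by (simp add: sat_atoms_iff)
  obtain b where b: "valid b" "\<forall>x \<in> set (uvars r). \<exists>v < K. s x = pl b v"
  proof (cases "body r = []")
    case True
    with that[OF valid.root] show ?thesis by (auto simp: uvars_def)
  next
    case False
    then obtain g where g: "g \<in> set (body r)" "universal_vars r \<subseteq> set (args g)"
      using guarded[OF r] by (auto simp: guarded_def)
    obtain c a where "valid c" "ren s g = ren (pl c) a" "set (args a) \<subseteq> {..<K}"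
      using s[OF g(1)] by (auto simp: tree_model_def)
    moreover have "\<exists>v < K. s x = pl c v" if "x \<in> set (args g)" for x
    proof -
      have "s x \<in> set (args (ren s g))" using that by simp
      then show ?thesis using calculation(2,3) by auto
    qed
    ultimately have "valid c \<and> (\<forall>x \<in> set (uvars r). \<exists>v < K. s x = pl c v)"
      using g(2) by (auto simp: set_uvars)
    with that show ?thesis by blast
  qed
  obtain h' where h': "\<And>x. x \<in> set (uvars r) \<Longrightarrow> h' x < K \<and> s x = pl b (h' x)"
    using b(2) by metis
  define h where "h = map (\<lambda>x. if x \<in> set (uvars r) then h' x else 0) [0..<K]"
  have h: "h \<in> set (List.n_lists K [0..<K])" unfolding h_def map_in_n_lists using h' K_pos by auto
  have h_nth: "at h x < K" "s x = pl b (at h x)" if "x \<in> set (uvars r)" for x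
    using h' that uvars_less[OF r] by (auto simp: h_def)
  have "ren (at h) a \<in> set (lab b)" if a: "a \<in> set (body r)" for a
  proof (rule tree_model_slot[OF b(1)])
    have ua: "set (args a) \<subseteq> set (uvars r)" using a by (auto simp: uvars_def)
    show "set (args (ren (at h) a)) \<subseteq> {..<K}" using ua h_nth by auto
    show "atom_over S (ren (at h) a)" using over[OF r] a by (auto simp: dexr_over_def)
    have "ren (pl b) (ren (at h) a) = ren s a"
      unfolding ren_ren using ua h_nth(2) by (intro ren_cong) auto
    then show "ren (pl b) (ren (at h) a) \<in> tree_model" using s[OF a] by simp
  qed
  then obtain \<psi> g C' where \<psi>: "\<psi> \<in> set (heads r)" and g: "g \<in> set (List.n_lists K [0..<K])"
      "\<forall>x \<in> set (uvars r). at g x = at h x" and C': "C' \<in> set T" "\<forall>a \<in> set \<psi>. ren (at g) a \<in> set C'"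
      "same_type S K (map (at h) (uvars r)) (lab b) C'"
    using T_closed[unfolded closed_def, rule_format, OF valid_label[OF b(1)] r h] by blast
  define X where "X = map (at h) (uvars r)"
  define c where "c = (X, C') # b"
  have "set X \<subseteq> {..<K}" using h_nth(1) by (auto simp: X_def)
  then have c: "valid c" unfolding c_def using b(1) C' by (intro valid.child) (auto simp: X_def)
  have "ren (\<lambda>x. pl c (at g x)) a \<in> tree_model" if "a \<in> set \<psi>" for a
  proof -
    have "set (args (ren (at g) a)) \<subseteq> {..<K}"
      using head_vars[OF r \<psi> that] n_lists_nth_less[OF g(1)] by auto
    then have "ren (pl c) (ren (at g) a) \<in> tree_model"
      using c C'(2) that by (auto simp: tree_model_def c_def simp del: ren_ren intro!: exI[of _ c] imageI)
    then show ?thesis by simp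
  qed
  moreover have "pl c (at g x) = s x" if "x \<in> universal_vars r" for x
    using that g(2) h_nth(2)[of x] by (simp add: c_def X_def set_uvars place.simps)
  ultimately show "\<exists>\<psi>\<in>set (heads r). \<exists>t. range t \<subseteq> UNIV \<and> (\<forall>x\<in>universal_vars r. t x = s x) \<and>
      sat_atoms (interp tree_model) t \<psi>"
    using \<psi> by (intro bexI[of _ \<psi>] exI[of _ "\<lambda>x. pl c (at g x)"]) (auto simp: sat_atoms_iff)
qed

text \<open>Consequently trees with different \<open>i\<close> have only common root slots as shared
  elements.\<close>

lemma tree_model_elems:
  assumes "d \<in> elems tree_model"
  shows "(\<exists>v \<in> Y. d = prod_encode (0, v)) \<or> (\<exists>n v. d = prod_encode (Suc (prod_encode (i, n)), v))"
proof -
  obtain c v where "d = pl c v" using assms by (auto simp: tree_model_def)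
  then show ?thesis using place_cases[of v Y i c] by auto
qed

lemma tree_model_root:
  "a \<in> set C0 \<Longrightarrow> set (args a) \<subseteq> {..<K} \<Longrightarrow> ren (pl []) a \<in> tree_model"
  unfolding tree_model_def using valid.root by fastforce

end

text \<open>\<open>i\<close> and \<open>Y\<close> are left free so that several such models can be
  made to overlap only in chosen root slots. The upper bound on the type at the root is what allows
  the model to be traded for its mosaic later.\<close>

lemma coherent_realized:
  assumes "C \<in> set (coherent S K \<Sigma>)"
  obtains J where "\<And>a. a \<in> J \<Longrightarrow> atom_over S a" "is_model UNIV (interp J) (set \<Sigma>)"
    "\<And>a. a \<in> set C \<Longrightarrow> set (args a) \<subseteq> {..<K} \<Longrightarrow> ren (place i Y []) a \<in> J"
    "type_le S K {..<K} J (place i Y []) (set C) (\<lambda>x. x)"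
    "\<And>d. d \<in> elems J \<Longrightarrow>
      (\<exists>v \<in> Y. d = prod_encode (0, v)) \<or> (\<exists>n v. d = prod_encode (Suc (prod_encode (i, n)), v))"
proof -
  obtain T where T: "closed S K \<Sigma> T" "set T \<subseteq> set (mosaics S K)" "C \<in> set T"
    using assms subseqs_subset by (auto simp: coherent_def)
  show ?thesis
    by (rule that[of "tree_model T C i Y"])
      (use tree_model_atoms[OF T] tree_model_sat[OF T] tree_model_root[OF T]
        tree_model_types[OF T valid.root[OF T]] tree_model_elems[OF T]
       in \<open>auto simp: is_model_def\<close>)
qed

end

section \<open>Separability is equivalent to the existence of a linear rewriting\<close>

section \<open>The linear rewriting\<close>

lemma set_glue:
  "length Cs = length bs \<Longrightarrow> a \<in> set (glue N bs Cs) \<longleftrightarrow>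
     (\<exists>i < length bs. \<exists>c \<in> set (Cs ! i).
        a = ren (\<lambda>v. if v \<in> set (args (bs ! i)) then v else Suc i * N + v) c)"
  by (auto simp: glue_def nth_default_nth)

lemma separable_iff:
  "separable S K \<Sigma> \<longleftrightarrow>
     (\<forall>r \<in> set \<Sigma>. body r \<noteq> [] \<longrightarrow>
        (\<forall>Cs \<in> set (List.n_lists (length (body r)) (mosaics S K)).
           (\<forall>i \<in> set [0..<length (body r)]. Cs ! i \<in> set (heads_for S K \<Sigma> (body r ! i))) \<longrightarrow>
           (\<exists>\<psi> \<in> set (heads r).
              hom_exists (Suc (length (body r)) * width S K) K (uvars r) \<psi>
                (glue (width S K) (body r) Cs))))"
proof -
  have "(\<forall>i \<in> set [0..<length bs]. nth_default [] Cs i \<in> set (heads_for S K \<Sigma> (nth_default (Atom 0 []) bs i))) \<longleftrightarrow>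
      (\<forall>i \<in> set [0..<length bs]. Cs ! i \<in> set (heads_for S K \<Sigma> (bs ! i)))"
    if "Cs \<in> set (List.n_lists (length bs) (mosaics S K))" for Cs bs
    using that by (auto simp: set_n_lists nth_default_nth)
  then show ?thesis unfolding separable_def by simp
qed

lemma sat_dexrI:
  assumes "\<psi> \<in> set (heads r)" "range t \<subseteq> D" "\<And>x. x \<in> universal_vars r \<Longrightarrow> t x = s x"
    "\<And>a. a \<in> set \<psi> \<Longrightarrow> ren t a \<in> facts I"
  shows "\<exists>\<psi> \<in> set (heads r). \<exists>t. range t \<subseteq> D \<and> (\<forall>x \<in> universal_vars r. t x = s x) \<and> sat_atoms I t \<psi>"
  using assms unfolding sat_atoms_iff by blast

text \<open>A body of at most one atom is matched inside a single \<open>J i\<close>, and the head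
  found there stays true in the union. An empty body needs some \<open>J i\<close> to exist.\<close>

lemma linear_union:
  assumes "linear r" "F \<noteq> {}" "\<And>i. i \<in> F \<Longrightarrow> sat_dexr UNIV (interp (J i)) r"
  shows "sat_dexr UNIV (interp (\<Union>i \<in> F. J i)) r"
  unfolding sat_dexr_def
proof (intro allI impI)
  fix s assume "range s \<subseteq> UNIV \<and> sat_atoms (interp (\<Union>i \<in> F. J i)) s (body r)"
  then have s: "\<forall>a \<in> set (body r). \<exists>i \<in> F. ren s a \<in> J i" by (simp add: sat_atoms_iff)
  obtain i where i: "i \<in> F" "\<forall>a \<in> set (body r). ren s a \<in> J i"
  proof (cases "body r")
    case Nil
    with assms(2) that show ?thesis by auto
  next
    case (Cons b bs)
    with assms(1) have "body r = [b]" by (simp add: linear_def)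
    with s that show ?thesis by auto
  qed
  then have "sat_atoms (interp (J i)) s (body r)" by (simp add: sat_atoms_iff)
  then obtain \<psi> t where "\<psi> \<in> set (heads r)" "\<And>x. x \<in> universal_vars r \<Longrightarrow> t x = s x"
      "\<And>a. a \<in> set \<psi> \<Longrightarrow> ren t a \<in> facts (interp (J i))"
    using sat_dexrD[OF assms(3)[OF i(1)], of s] by (metis subset_UNIV)
  with i(1) show "\<exists>\<psi>\<in>set (heads r). \<exists>t. range t \<subseteq> UNIV \<and> (\<forall>x\<in>universal_vars r. t x = s x) \<and>
      sat_atoms (interp (\<Union>i \<in> F. J i)) t \<psi>"
    by (intro sat_dexrI[of \<psi> r t]) auto
qed

context guarded_rules
begin

lemma body_atom:
  assumes "r \<in> set \<Sigma>" "b \<in> set (body r)"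
  shows "b \<in> set (atoms_upto S K)"
  using over[OF assms(1)] body_vars[OF assms] assms(2) by (auto simp: set_atoms_upto dexr_over_def)

lemma heads_for_mosaic: "C \<in> set (heads_for S K \<Sigma> b) \<Longrightarrow> C \<in> set (mosaics S K)"
  by (simp add: heads_for_def coherent_def)

lemma heads_for_rule:
  assumes model: "is_model D I (set (rewriting S K \<Sigma>))" and b: "b \<in> set (atoms_upto S K)"
    and s: "range s \<subseteq> D" "ren s b \<in> facts I"
  shows "\<exists>C t. C \<in> set (heads_for S K \<Sigma> b) \<and> range t \<subseteq> D \<and> (\<forall>x \<in> set (args b). t x = s x) \<and>
           (\<forall>c \<in> set C. ren t c \<in> facts I)"
proof -
  let ?r = "Dexr [b] (heads_for S K \<Sigma> b)"
  have "sat_dexr D I ?r" using model b by (auto simp: is_model_def rewriting_def)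
  moreover have "sat_atoms I s (body ?r)" using s(2) by (simp add: sat_atoms_iff)
  ultimately show ?thesis
    using sat_dexrD[of D I ?r s] s(1) by (metis dexr.sel(2) dexr.sel(1) set_uvars uvars_def
        list.simps(8,9) concat.simps append_Nil2)
qed

text \<open>Each body atom fires its own linear rule and yields a match of a mosaic. Together these
  matches map the glued structure into the model and carry along the head that separability finds in
  it.\<close>

lemma model_of_rewriting:
  assumes sep: "separable S K \<Sigma>" and model: "is_model D I (set (rewriting S K \<Sigma>))"
  shows "is_model D I (set \<Sigma>)"
  unfolding is_model_def
proof
  fix r assume r: "r \<in> set \<Sigma>"
  show "sat_dexr D I r"
  proof (cases "body r = []")
    case True
    with r model show ?thesis by (simp add: is_model_def rewriting_def)
  next
    case False
    show ?thesis unfolding sat_dexr_def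
    proof (intro allI impI)
      fix s assume s: "range s \<subseteq> D \<and> sat_atoms I s (body r)"
      let ?n = "length (body r)"
      have "\<forall>i. \<exists>C t. i < ?n \<longrightarrow> C \<in> set (heads_for S K \<Sigma> (body r ! i)) \<and> range t \<subseteq> D \<and>
          (\<forall>x \<in> set (args (body r ! i)). t x = s x) \<and> (\<forall>c \<in> set C. ren t c \<in> facts I)"
        using heads_for_rule[OF model body_atom[OF r nth_mem]] s
        by (auto simp: sat_atoms_iff)
      then obtain C t where Ct: "\<And>i. i < ?n \<Longrightarrow> C i \<in> set (heads_for S K \<Sigma> (body r ! i))"
        "\<And>i. i < ?n \<Longrightarrow> range (t i) \<subseteq> D"
        "\<And>i x. i < ?n \<Longrightarrow> x \<in> set (args (body r ! i)) \<Longrightarrow> t i x = s x"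
        "\<And>i c. i < ?n \<Longrightarrow> c \<in> set (C i) \<Longrightarrow> ren (t i) c \<in> facts I"
        by metis
      define Cs where "Cs = map C [0..<?n]"
      have Cs: "Cs \<in> set (List.n_lists ?n (mosaics S K))"
        using heads_for_mosaic[OF Ct(1)] by (auto simp: Cs_def set_n_lists)
      have "\<forall>i \<in> set [0..<?n]. Cs ! i \<in> set (heads_for S K \<Sigma> (body r ! i))"
        using Ct(1) by (simp add: Cs_def)
      then obtain \<psi> where \<psi>: "\<psi> \<in> set (heads r)"
          "hom_exists (Suc ?n * N) K (uvars r) \<psi> (glue N (body r) Cs)"
        using sep[unfolded separable_iff] r False Cs by blast
      then obtain l where l: "\<And>x. x \<in> set (uvars r) \<Longrightarrow> at l x = x"
          "\<And>a. a \<in> set \<psi> \<Longrightarrow> ren (at l) a \<in> set (glue N (body r) Cs)"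
        unfolding hom_exists_def by blast
      \<comment> \<open>Quotient \<open>Suc i\<close> selects the \<open>i\<close>-th match, and
        block 0 consists of rule variables and is read by \<open>s\<close>. Beyond the last block
        the value only has to lie in \<open>D\<close>.\<close>
      define k where "k d = (if N \<le> d \<and> d div N - 1 < ?n then t (d div N - 1) (d mod N) else s d)" for d
      have k_D: "k d \<in> D" for d using Ct(2) s by (auto simp: k_def)
      define u where "u x = (if x < K then k (at l x) else s x)" for x
      have "ren u a \<in> facts I" if a: "a \<in> set \<psi>" for a
      proof -
        obtain i c where ic: "i < ?n" "c \<in> set (C i)"
          "ren (at l) a = ren (\<lambda>v. if v \<in> set (args (body r ! i)) then v else Suc i * N + v) c"
          using l(2)[OF a] by (auto simp: set_glue Cs_def)
        have "ren u a = ren k (ren (at l) a)"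
          unfolding ren_ren using head_vars[OF r \<psi>(1) a] by (intro ren_cong) (auto simp: u_def)
        also have "\<dots> = ren (t i) c"
          unfolding ic(3) ren_ren
        proof (rule ren_cong)
          fix v assume "v \<in> set (args c)"
          then have v: "v < N"
            using mosaic_atoms(2)[OF heads_for_mosaic[OF Ct(1)[OF ic(1)]] ic(2)] by auto
          then have "(Suc i * N + v) div N = Suc i" "(Suc i * N + v) mod N = v"
            by (simp_all only: div_mult_self3 mod_mult_self3 div_less mod_less)
          then have "k (Suc i * N + v) = t i v" using ic(1) by (simp add: k_def)
          moreover have "k v = s v" using v by (simp add: k_def)
          ultimately show "k (if v \<in> set (args (body r ! i)) then v else Suc i * N + v) = t i v"
            using Ct(3)[OF ic(1), of v] by simp
        qed
        finally show ?thesis using Ct(4)[OF ic(1,2)] by simp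
      qed
      moreover have "u x = s x" if "x \<in> universal_vars r" for x
      proof -
        have "x < K" using that uvars_less[OF r] by (auto simp: set_uvars)
        then show ?thesis using l(1)[of x] that K_le_N by (simp add: u_def k_def set_uvars)
      qed
      moreover have "range u \<subseteq> D" using k_D s by (auto simp: u_def)
      ultimately show "\<exists>\<psi>\<in>set (heads r). \<exists>t. range t \<subseteq> D \<and>
          (\<forall>x\<in>universal_vars r. t x = s x) \<and> sat_atoms I t \<psi>"
        using \<psi>(1) by (intro sat_dexrI[of \<psi> r u]) auto
    qed
  qed
qed

lemma interp_structure:
  assumes "\<And>a. a \<in> J \<Longrightarrow> atom_over S a"
  shows "is_structure S UNIV (interp J)"
  using assms[of "Atom R t" for R t] by (auto simp: is_structure_def interp_def atom_over_def)

text \<open>Tree models of the chosen mosaics are united, sharing only body variables. The union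
  satisfies \<open>\<Lambda>\<close> by \<open>linear_union\<close>, hence \<open>\<Sigma>\<close>,
  so a head of \<open>r\<close> is true in it. Replacing the tree models by their root mosaics, one
  at a time, keeps this head true.\<close>

lemma separable_if_rewritable:
  assumes \<Lambda>: "linear_rewriting S (set \<Sigma>) \<Lambda>"
  shows "separable S K \<Sigma>"
  unfolding separable_iff
proof (intro ballI impI)
  fix r Cs
  assume r: "r \<in> set \<Sigma>" and ne: "body r \<noteq> []"
    and Cs: "Cs \<in> set (List.n_lists (length (body r)) (mosaics S K))"
    and Ch: "\<forall>i \<in> set [0..<length (body r)]. Cs ! i \<in> set (heads_for S K \<Sigma> (body r ! i))"
  let ?n = "length (body r)"
  have len: "length Cs = ?n" using Cs by (simp add: set_n_lists)
  define Y where "Y i = set (args (body r ! i))" for i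
  define p where "p i = place i (Y i) []" for i
  have C: "Cs ! i \<in> set (coherent S K \<Sigma>)" "body r ! i \<in> set (Cs ! i)" "Cs ! i \<in> set (mosaics S K)"
    if "i < ?n" for i
    using Ch that by (auto simp: heads_for_def coherent_def)
  have Yi: "Y i \<subseteq> {..<K}" if "i < ?n" for i
    unfolding Y_def by (rule body_vars[OF r nth_mem[OF that]])
  have "\<forall>i. \<exists>J. i < ?n \<longrightarrow> (\<forall>a \<in> J. atom_over S a) \<and> is_model UNIV (interp J) (set \<Sigma>) \<and>
      ren (p i) (body r ! i) \<in> J \<and> type_le S K {..<K} J (p i) (set (Cs ! i)) (\<lambda>x. x) \<and>
      (\<forall>d \<in> elems J. (\<exists>v \<in> Y i. d = prod_encode (0, v)) \<or>
         (\<exists>n v. d = prod_encode (Suc (prod_encode (i, n)), v)))" (is "\<forall>i. \<exists>J. _ \<longrightarrow> ?P i J")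
  proof
    fix i show "\<exists>J. i < ?n \<longrightarrow> ?P i J"
    proof (cases "i < ?n")
      case True
      obtain J where J: "\<And>a. a \<in> J \<Longrightarrow> atom_over S a" "is_model UNIV (interp J) (set \<Sigma>)"
        "\<And>a. a \<in> set (Cs ! i) \<Longrightarrow> set (args a) \<subseteq> {..<K} \<Longrightarrow> ren (place i (Y i) []) a \<in> J"
        "type_le S K {..<K} J (place i (Y i) []) (set (Cs ! i)) (\<lambda>x. x)"
        "\<And>d. d \<in> elems J \<Longrightarrow>
          (\<exists>v \<in> Y i. d = prod_encode (0, v)) \<or> (\<exists>n v. d = prod_encode (Suc (prod_encode (i, n)), v))"
        using coherent_realized[OF C(1)[OF True], of i "Y i"] by metis
      have "ren (p i) (body r ! i) \<in> J"
        unfolding p_def by (rule J(3)[OF C(2)[OF True] body_vars[OF r nth_mem[OF True]]])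
      with J(1,2,4,5) have "?P i J" unfolding p_def by blast
      then show ?thesis by blast
    qed simp
  qed
  then obtain J where J: "\<And>i. i < ?n \<Longrightarrow> ?P i (J i)" by metis
  define U where "U = (\<Union>i \<in> {..<?n}. J i)"
  define s where "s x = prod_encode (0 :: nat, x :: nat)" for x
  define X0 where "X0 = set (uvars r)"
  have X0: "X0 \<subseteq> {..<K}" using uvars_less[OF r] by (simp add: X0_def)
  have p_s: "p i x = s x" if "x \<in> Y i" for i x using that by (simp add: p_def s_def place.simps)
  have "is_model UNIV (interp U) \<Lambda>"
    unfolding is_model_def
  proof
    fix \<rho> assume \<rho>: "\<rho> \<in> \<Lambda>"
    then have "linear \<rho>" using \<Lambda> by (simp add: linear_rewriting_def)
    moreover have "{..<?n} \<noteq> {}" using ne by (simp add: lessThan_empty_iff)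
    moreover have "sat_dexr UNIV (interp (J i)) \<rho>" if "i \<in> {..<?n}" for i
    proof -
      have i: "i < ?n" using that by simp
      have "is_structure S UNIV (interp (J i))" using J[OF i] by (intro interp_structure) blast
      then have "is_model UNIV (interp (J i)) \<Lambda>"
        using J[OF i] \<Lambda> unfolding linear_rewriting_def equivalent_over_def by blast
      with \<rho> show ?thesis by (simp add: is_model_def)
    qed
    ultimately show "sat_dexr UNIV (interp U) \<rho>" unfolding U_def by (rule linear_union)
  qed
  moreover have "is_structure S UNIV (interp U)"
    using J by (intro interp_structure) (auto simp: U_def)
  ultimately have "is_model UNIV (interp U) (set \<Sigma>)"
    using \<Lambda> unfolding linear_rewriting_def equivalent_over_def by blast
  then have "sat_dexr UNIV (interp U) r" using r by (simp add: is_model_def)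
  moreover have "sat_atoms (interp U) s (body r)"
    unfolding sat_atoms_iff facts_interp
  proof
    fix b assume "b \<in> set (body r)"
    then obtain i where i: "i < ?n" "body r ! i = b" by (auto simp: in_set_conv_nth)
    have "ren s b = ren (p i) b" using p_s i(2) by (intro ren_cong) (auto simp: Y_def)
    then show "ren s b \<in> U" using J[OF i(1)] i by (auto simp: U_def)
  qed
  ultimately obtain \<psi> t where \<psi>: "\<psi> \<in> set (heads r)" and t: "\<And>x. x \<in> X0 \<Longrightarrow> t x = s x"
      "\<And>a. a \<in> set \<psi> \<Longrightarrow> ren t a \<in> U"
    using sat_dexrD[of UNIV "interp U" r s] unfolding facts_interp X0_def set_uvars by (metis subset_UNIV)
  define A where "A i = ren (p i) ` set (Cs ! i)" for i
  have A_tag: "(\<exists>v \<in> Y i. d = prod_encode (0, v)) \<or> (\<exists>n v. d = prod_encode (Suc (prod_encode (i, n)), v))"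
    if "d \<in> elems (A i)" for d i
    using that by (auto simp: A_def p_def place.simps)
  define G where "G k = (\<Union>i \<in> {..<k}. A i) \<union> (\<Union>i \<in> {k..<?n}. J i)" for k
  have "type_le S K X0 U s (G k) s" if "k \<le> ?n" for k
    using that
  proof (induction k)
    case 0
    have "G 0 = U" by (simp add: G_def U_def atLeast0LessThan)
    then show ?case by (simp add: type_le_hom[where r = "\<lambda>x. x"])
  next
    case (Suc k)
    then have k: "k < ?n" by simp
    define R where "R = (\<Union>i \<in> {..<k}. A i) \<union> (\<Union>i \<in> {Suc k..<?n}. J i)"
    have "{k..<?n} = insert k {Suc k..<?n}" using k by auto
    then have G: "G k = R \<union> J k" "G (Suc k) = R \<union> A k" by (auto simp: G_def R_def lessThan_Suc)
    have "type_le S K {..<K} J' (p k) (A k) (p k)"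
      if "type_le S K {..<K} J' (p k) (set (Cs ! k)) (\<lambda>x. x)" for J'
      by (rule type_le_trans[OF that type_le_hom[where r = "p k"]]) (auto simp: A_def)
    then have le: "type_le S K (Y k) (J k) (p k) (A k) (p k)"
      using J[OF k] type_le_restrict[OF _ Yi[OF k] order.refl] by blast
    \<comment> \<open>Elements outside tag 0 carry the number of their component, so component
      \<open>k\<close> meets the rest only in tag 0 elements, and its own ones come from
      \<open>Y k\<close>.\<close>
    have "(elems R \<union> s ` X0) \<inter> elems (J k) \<subseteq> p k ` Y k"
    proof
      fix d assume d: "d \<in> (elems R \<union> s ` X0) \<inter> elems (J k)"
      have "\<not> (\<exists>n v. d = prod_encode (Suc (prod_encode (k, n)), v))"
      proof
        assume *: "\<exists>n v. d = prod_encode (Suc (prod_encode (k, n)), v)"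
        then have "d \<in> elems R" using d by (auto simp: s_def)
        then have "(\<exists>i < k. d \<in> elems (A i)) \<or> (\<exists>i \<in> {Suc k..<?n}. d \<in> elems (J i))"
          by (auto simp: R_def)
        then obtain i where "i \<noteq> k" "d \<in> elems (A i) \<or> i < ?n \<and> d \<in> elems (J i)"
          by (metis Suc_n_not_le_n atLeastLessThan_iff less_irrefl)
        then show False using * A_tag[of d i] J[of i] by fastforce
      qed
      then obtain v where "v \<in> Y k" "d = prod_encode (0, v)" using d J[OF k] by blast
      then show "d \<in> p k ` Y k" using p_s[of v k] by (auto simp: s_def image_iff intro!: bexI[of _ v])
    qed
    from type_le_replace[OF le Yi[OF k] X0 this]
    have "type_le S K X0 (G k) s (G (Suc k)) s" by (simp add: G)
    with Suc k show ?case by (auto intro: type_le_trans)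
  qed
  from this[of ?n] have le: "type_le S K X0 U s (\<Union>i \<in> {..<?n}. A i) s" by (simp add: G_def)
  \<comment> \<open>The existential variables of the head are shifted into \<open>{K..<2*K}\<close>,
    which turns the head into a query with answer variables \<open>X0\<close>.\<close>
  define e where "e x = (if x \<in> X0 then x else K + x)" for x
  obtain t' where t': "\<And>x. x \<in> X0 \<Longrightarrow> t' x = s x"
      "\<And>a. a \<in> ren e ` set \<psi> \<Longrightarrow> ren t' a \<in> (\<Union>i \<in> {..<?n}. A i)"
  proof (rule type_leD[OF le, where q = "ren e ` set \<psi>" and t = "\<lambda>x. if x \<in> X0 then t x else t (x - K)"])
    fix a assume "a \<in> ren e ` set \<psi>"
    then obtain c where c: "c \<in> set \<psi>" "a = ren e c" by auto
    have vars: "set (args c) \<subseteq> {..<K}" by (rule head_vars[OF r \<psi> c(1)])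
    then show "atom_over S a \<and> set (args a) \<subseteq> X0 \<union> {K..<2*K}"
      using over[OF r] \<psi> c by (auto simp: dexr_over_def e_def)
    have "ren (\<lambda>x. if x \<in> X0 then t x else t (x - K)) a = ren t c"
      unfolding c(2) ren_ren using vars X0 by (intro ren_cong) (auto simp: e_def)
    then show "ren (\<lambda>x. if x \<in> X0 then t x else t (x - K)) a \<in> U" using t(2)[OF c(1)] by simp
  qed (use t(1) in auto)
  \<comment> \<open>Translates names of root elements into the numbering of \<open>glue\<close>: tag
    0 goes to block 0, and a nonzero tag with tree number \<open>i\<close> to block
    \<open>Suc i\<close>.\<close>
  define z where "z d = (let (m, v) = prod_decode d in
      if m = 0 then v else Suc (fst (prod_decode (m - 1))) * N + v)" for d
  have z: "z (p i v) = (if v \<in> Y i then v else Suc i * N + v)" for i v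
    by (simp add: z_def p_def place.simps)
  show "\<exists>\<psi> \<in> set (heads r). hom_exists (Suc ?n * N) K (uvars r) \<psi> (glue N (body r) Cs)"
  proof (rule bexI[OF _ \<psi>], subst hom_exists_iff)
    show "0 < Suc ?n * N" using N_pos by simp
    show "set (uvars r) \<subseteq> {..<K}" using X0 by (simp add: X0_def)
    have "K \<le> Suc ?n * N" using K_le_N by (simp add: trans_le_add1)
    then show "set (uvars r) \<subseteq> {..<Suc ?n * N}" using X0 by (auto simp: X0_def)
    show "set (args a) \<subseteq> {..<K}" if "a \<in> set \<psi>" for a by (rule head_vars[OF r \<psi> that])
    show "elems (set (glue N (body r) Cs)) \<subseteq> {..<Suc ?n * N}"
    proof
      fix d assume "d \<in> elems (set (glue N (body r) Cs))"
      then obtain a where a: "a \<in> set (glue N (body r) Cs)" "d \<in> set (args a)" by (auto simp: elems_def)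
      then obtain i c v where i: "i < ?n" "c \<in> set (Cs ! i)" "v \<in> set (args c)"
          "d = (if v \<in> set (args (body r ! i)) then v else Suc i * N + v)"
        by (auto simp: set_glue[OF len])
      have "v < N" using mosaic_atoms(2)[OF C(3)[OF i(1)] i(2)] i(3) by auto
      then have "d < Suc (Suc i) * N" using i(4) by (auto simp: trans_less_add1)
      also have "\<dots> \<le> Suc ?n * N" using i(1) by (intro mult_le_mono1) simp
      finally show "d \<in> {..<Suc ?n * N}" by simp
    qed
    show "\<exists>t. (\<forall>x \<in> set (uvars r). t x = x) \<and> (\<forall>a \<in> set \<psi>. ren t a \<in> set (glue N (body r) Cs))"
    proof (intro exI[of _ "\<lambda>x. z (t' (e x))"] conjI ballI)
      show "z (t' (e x)) = x" if "x \<in> set (uvars r)" for x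
        using that t'(1)[of x] by (simp add: e_def X0_def z_def s_def)
      fix a assume a: "a \<in> set \<psi>"
      then obtain i c where i: "i < ?n" "c \<in> set (Cs ! i)" "ren t' (ren e a) = ren (p i) c"
        using t'(2)[of "ren e a"] by (auto simp: A_def)
      have "ren (\<lambda>x. z (t' (e x))) a = ren z (ren t' (ren e a))" by simp
      also have "\<dots> = ren z (ren (p i) c)" by (simp only: i(3))
      also have "\<dots> = ren (\<lambda>v. if v \<in> set (args (body r ! i)) then v else Suc i * N + v) c"
        by (simp add: z Y_def)
      finally show "ren (\<lambda>x. z (t' (e x))) a \<in> set (glue N (body r) Cs)"
        unfolding set_glue[OF len] using i(1,2) by blast
    qed
  qed
qed

lemma rewriting_correct:
  assumes "separable S K \<Sigma>"
  shows "linear_rewriting S (set \<Sigma>) (set (rewriting S K \<Sigma>))"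
  unfolding linear_rewriting_def equivalent_over_def
proof (intro conjI ballI allI impI)
  show "dexr_over S r" "linear r" if in_rw: "r \<in> set (rewriting S K \<Sigma>)" for r
  proof -
    have "r \<in> set \<Sigma> \<and> body r = [] \<or>
        (\<exists>b \<in> set (atoms_upto S K). r = Dexr [b] (heads_for S K \<Sigma> b))"
      using in_rw by (auto simp: rewriting_def)
    then consider "r \<in> set \<Sigma>" "body r = []"
      | b where "b \<in> set (atoms_upto S K)" "r = Dexr [b] (heads_for S K \<Sigma> b)"
      by blast
    then have "dexr_over S r \<and> linear r"
    proof cases
      case 1
      then show ?thesis using over by (simp add: linear_def)
    next
      case 2
      then have "atom_over S b" by (simp add: set_atoms_upto)
      moreover have "C \<noteq> []" "\<forall>a \<in> set C. atom_over S a" if "C \<in> set (heads_for S K \<Sigma> b)" for C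
        using that mosaic_atoms(1)[OF heads_for_mosaic[OF that]] by (auto simp: heads_for_def)
      ultimately show ?thesis
        using 2 heads_for_nonempty[OF 2(1)] by (simp add: dexr_over_def linear_def)
    qed
    then show "dexr_over S r" "linear r" by auto
  qed
  show "is_model D I (set \<Sigma>) \<longleftrightarrow> is_model D I (set (rewriting S K \<Sigma>))"
    if "is_structure S D I" for D I
    using model_rewriting[OF that] model_of_rewriting[OF assms] by blast
qed simp

end

section \<open>A small imperative language and its compilation to Turing machines\<close>

section \<open>While programs on Turing machines\<close>

text \<open>
  While programs over the tapes of a machine. A register is the position of a head on a tape
  that is never written, so it is zero iff the head sees the left end marker 1. \<open>While r k\<close> loops
  as long as head \<open>r\<close> does not see \<open>k\<close>; \<open>Wr k\<close> appends \<open>k\<close> to the output on tape 1.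
\<close>

datatype com = Skip | Inc nat | Dec nat | Wr nat | Seq com com (infixr \<open>;;\<close> 60)
  | While nat nat com | If nat nat com com

type_synonym store = "(nat \<Rightarrow> nat \<Rightarrow> nat) \<times> (nat \<Rightarrow> nat)"

text \<open>The count is the exact number of steps of the compiled code: a test takes one step, and
  a then-branch or a loop body is followed by one jump.\<close>

inductive exec :: "com \<Rightarrow> store \<Rightarrow> nat \<Rightarrow> store \<Rightarrow> bool" where
  Skip: "exec Skip st 0 st"
| Inc: "exec (Inc r) (T, s) 1 (T, s(r := s r + 1))"
| Dec: "exec (Dec r) (T, s) 1 (T, s(r := s r - 1))"
| Wr: "exec (Wr k) (T, s) 1 (T(1 := (T 1)(s 1 := k)), s(1 := s 1 + 1))"
| Seq: "exec c st t st' \<Longrightarrow> exec c' st' t' st'' \<Longrightarrow> exec (c ;; c') st (t + t') st''"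
| IfT: "fst st r (snd st r) = k \<Longrightarrow> exec c st t st' \<Longrightarrow> exec (If r k c c') st (t + 2) st'"
| IfF: "fst st r (snd st r) \<noteq> k \<Longrightarrow> exec c' st t st' \<Longrightarrow> exec (If r k c c') st (t + 1) st'"
| WhileF: "fst st r (snd st r) = k \<Longrightarrow> exec (While r k c) st 1 st"
| WhileT: "fst st r (snd st r) \<noteq> k \<Longrightarrow> exec c st t st' \<Longrightarrow> exec (While r k c) st' t' st'' \<Longrightarrow>
    exec (While r k c) st (t + 2 + t') st''"

datatype instr = IInc nat | IDec nat | IWr nat | IJmp nat | IJne nat nat nat | IJeq nat nat nat

fun csize :: "com \<Rightarrow> nat" where
  "csize Skip = 0"
| "csize (Inc r) = 1"
| "csize (Dec r) = 1"
| "csize (Wr k) = 1"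
| "csize (c ;; c') = csize c + csize c'"
| "csize (While r k c) = csize c + 2"
| "csize (If r k c c') = csize c + csize c' + 2"

text \<open>Jump targets are absolute, so the address \<open>q\<close> of the first instruction is a
  parameter.\<close>

fun compile :: "com \<Rightarrow> nat \<Rightarrow> instr list" where
  "compile Skip q = []"
| "compile (Inc r) q = [IInc r]"
| "compile (Dec r) q = [IDec r]"
| "compile (Wr k) q = [IWr k]"
| "compile (c ;; c') q = compile c q @ compile c' (q + csize c)"
| "compile (While r k c) q = [IJeq r k (q + csize c + 2)] @ compile c (q + 1) @ [IJmp q]"
| "compile (If r k c c') q = [IJne r k (q + csize c + 2)] @ compile c (q + 1) @
     [IJmp (q + csize c + csize c' + 2)] @ compile c' (q + csize c + 2)"

lemma length_comp [simp]: "length (compile c q) = csize c"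
  by (induction c arbitrary: q) auto

fun istep :: "instr \<Rightarrow> nat \<times> store \<Rightarrow> nat \<times> store" where
  "istep (IInc r) (q, T, s) = (q + 1, T, s(r := s r + 1))"
| "istep (IDec r) (q, T, s) = (q + 1, T, s(r := s r - 1))"
| "istep (IWr k) (q, T, s) = (q + 1, T(1 := (T 1)(s 1 := k)), s(1 := s 1 + 1))"
| "istep (IJmp a) (q, T, s) = (a, T, s)"
| "istep (IJne r k a) (q, T, s) = (if T r (s r) = k then q + 1 else a, T, s)"
| "istep (IJeq r k a) (q, T, s) = (if T r (s r) = k then a else q + 1, T, s)"

definition seg :: "instr list \<Rightarrow> nat \<Rightarrow> instr list \<Rightarrow> bool" where
  "seg P q xs \<longleftrightarrow> (\<exists>us vs. P = us @ xs @ vs \<and> length us = q)"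

lemma seg_append: "seg P q (xs @ ys) \<Longrightarrow> seg P q xs \<and> seg P (q + length xs) ys"
  unfolding seg_def by (metis append.assoc length_append)

lemma seg_Cons: "seg P q (x # xs) \<Longrightarrow> q < length P \<and> P ! q = x \<and> seg P (Suc q) xs"
proof -
  assume "seg P q (x # xs)"
  then obtain us vs where "P = us @ (x # xs) @ vs" "length us = q" by (auto simp: seg_def)
  then have "P = (us @ [x]) @ xs @ vs" "length (us @ [x]) = Suc q" "q < length P" "P ! q = x" by auto
  then show ?thesis unfolding seg_def by blast
qed

abbreviation prog_step :: "instr list \<Rightarrow> nat \<times> store \<Rightarrow> nat \<times> store" where
  "prog_step P \<equiv> \<lambda>c. if fst c < length P then istep (P ! fst c) c else c"

lemma funpow_add_eq: "(f ^^ m) x = y \<Longrightarrow> (f ^^ n) y = z \<Longrightarrow> (f ^^ (m + n)) x = z"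
  by (simp add: add.commute[of m n] funpow_add)

text \<open>\<open>P\<close> may extend beyond the code of \<open>c\<close> on both sides; this lets
  the induction pass to subprograms.\<close>

lemma comp_correct:
  "exec c st t st' \<Longrightarrow> seg P q (compile c q) \<Longrightarrow> (prog_step P ^^ t) (q, st) = (q + csize c, st')"
proof (induction arbitrary: q rule: exec.induct)
  case (Seq c st t st' c' t' st'')
  note sg = seg_append[OF Seq.prems[unfolded compile.simps], simplified]
  from funpow_add_eq[OF Seq.IH(1)[OF sg[THEN conjunct1]] Seq.IH(2)[OF sg[THEN conjunct2]]]
  show ?case by (simp add: add.assoc)
next
  case (IfT st r k c t st' c')
  obtain T s where st: "st = (T, s)" by force
  from seg_Cons[of P q] IfT.prems have P: "q < length P" "P ! q = IJne r k (q + csize c + 2)"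
    "seg P (Suc q) (compile c (q + 1) @ [IJmp (q + csize c + csize c' + 2)] @ compile c' (q + csize c + 2))"
    by auto
  note sg = seg_append[OF P(3)]
  from seg_Cons[of P "q + 1 + csize c"] sg have P': "q + 1 + csize c < length P"
    "P ! (q + 1 + csize c) = IJmp (q + csize c + csize c' + 2)" by auto
  have 1: "(prog_step P ^^ 1) (q, st) = (q + 1, st)" using P IfT.hyps by (simp add: st)
  have 2: "(prog_step P ^^ t) (q + 1, st) = (q + 1 + csize c, st')" using IfT.IH sg by simp
  obtain T' s' where st': "st' = (T', s')" by force
  have 3: "(prog_step P ^^ 1) (q + 1 + csize c, st') = (q + csize c + csize c' + 2, st')"
    using P' by (simp add: st')
  from funpow_add_eq[OF 1 funpow_add_eq[OF 2 3]] show ?case by (simp add: add.assoc)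
next
  case (IfF st r k c' t st' c)
  obtain T s where st: "st = (T, s)" by force
  from seg_Cons[of P q] IfF.prems have P: "q < length P" "P ! q = IJne r k (q + csize c + 2)"
    "seg P (Suc q) ((compile c (q + 1) @ [IJmp (q + csize c + csize c' + 2)]) @ compile c' (q + csize c + 2))"
    by auto
  note sg = seg_append[OF P(3)]
  have 1: "(prog_step P ^^ 1) (q, st) = (q + csize c + 2, st)" using P IfF.hyps by (simp add: st)
  have 2: "(prog_step P ^^ t) (q + csize c + 2, st) = (q + csize c + 2 + csize c', st')"
    using IfF.IH sg by simp
  from funpow_add_eq[OF 1 2] show ?case by (simp add: add.assoc add.commute add.left_commute)
next
  case (WhileF st r k c)
  obtain T s where st: "st = (T, s)" by force
  from seg_Cons[of P q] WhileF.prems have P: "q < length P" "P ! q = IJeq r k (q + csize c + 2)"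
    by auto
  then show ?case using WhileF.hyps by (simp add: st)
next
  case (WhileT st r k c t st' t' st'')
  obtain T s where st: "st = (T, s)" by force
  from seg_Cons[of P q] WhileT.prems have P: "q < length P" "P ! q = IJeq r k (q + csize c + 2)"
    "seg P (Suc q) (compile c (q + 1) @ [IJmp q])" by auto
  note sg = seg_append[OF P(3)]
  from seg_Cons[of P "q + 1 + csize c"] sg have P': "q + 1 + csize c < length P"
    "P ! (q + 1 + csize c) = IJmp q" by auto
  have 1: "(prog_step P ^^ 1) (q, st) = (q + 1, st)" using P WhileT.hyps by (simp add: st)
  have 2: "(prog_step P ^^ t) (q + 1, st) = (q + 1 + csize c, st')" using WhileT.IH(1) sg by simp
  obtain T' s' where st': "st' = (T', s')" by force
  have 3: "(prog_step P ^^ 1) (q + 1 + csize c, st') = (q, st')" using P' by (simp add: st')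
  from funpow_add_eq[OF 1 funpow_add_eq[OF 2 funpow_add_eq[OF 3 WhileT.IH(2)[OF WhileT.prems]]]]
  show ?case by (simp add: add.assoc)
qed (use seg_Cons[of P] in \<open>auto\<close>)

fun registers :: "com \<Rightarrow> nat" where
  "registers Skip = 0"
| "registers (Inc r) = Suc r"
| "registers (Dec r) = Suc r"
| "registers (Wr k) = 0"
| "registers (c ;; c') = max (registers c) (registers c')"
| "registers (While r k c) = max (Suc r) (registers c)"
| "registers (If r k c c') = max (Suc r) (max (registers c) (registers c'))"

fun writes :: "com \<Rightarrow> nat set" where
  "writes (Wr k) = {k}"
| "writes (c ;; c') = writes c \<union> writes c'"
| "writes (While r k c) = writes c"
| "writes (If r k c c') = writes c \<union> writes c'"
| "writes _ = {}"

fun instr_ok :: "nat \<Rightarrow> nat \<Rightarrow> instr \<Rightarrow> bool" where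
  "instr_ok R l (IInc r) = (r < R)"
| "instr_ok R l (IDec r) = (r < R)"
| "instr_ok R l (IWr k) = (k < 8)"
| "instr_ok R l (IJmp a) = (a \<le> l)"
| "instr_ok R l (IJne r k a) = (r < R \<and> a \<le> l)"
| "instr_ok R l (IJeq r k a) = (r < R \<and> a \<le> l)"

lemma instr_ok_comp:
  "registers c \<le> R \<Longrightarrow> writes c \<subseteq> {..<8} \<Longrightarrow> q + csize c \<le> l \<Longrightarrow> x \<in> set (compile c q) \<Longrightarrow>
    instr_ok R l x"
proof (induction c arbitrary: q)
  case (Seq c c')
  then show ?case using Seq.IH(1)[of q] Seq.IH(2)[of "q + csize c"] by auto
next
  case (If r k c c')
  then show ?case using If.IH(1)[of "q + 1"] If.IH(2)[of "q + csize c + 2"] by auto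
next
  case (While r k c)
  then show ?case using While.IH[of "q + 1"] by auto
qed auto

text \<open>A transition writes on every tape, so idle heads write back the symbol that they read;
  \<open>act 0 Stay\<close> changes nothing.\<close>

definition instr_trans :: "nat \<Rightarrow> instr \<Rightarrow> nat \<Rightarrow> nat list \<Rightarrow> nat \<times> (nat \<times> move) list" where
  "instr_trans R x q ss =
     (let act = (\<lambda>j d. map (\<lambda>i. (ss ! i, if i = j then d else Stay)) [0..<R]) in
      case x of
        IInc r \<Rightarrow> (q + 1, act r MoveRight)
      | IDec r \<Rightarrow> (q + 1, act r MoveLeft)
      | IWr k \<Rightarrow> (q + 1, map (\<lambda>i. if i = 1 then (k, MoveRight) else (ss ! i, Stay)) [0..<R])
      | IJmp a \<Rightarrow> (a, act 0 Stay)
      | IJne r k a \<Rightarrow> (if ss ! r = k then q + 1 else a, act 0 Stay)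
      | IJeq r k a \<Rightarrow> (if ss ! r = k then a else q + 1, act 0 Stay))"

text \<open>The state is the program counter. The address behind the last instruction is
  \<open>csize c\<close>, which is the halting state.\<close>

definition com_machine :: "com \<Rightarrow> machine" where
  "com_machine c =
     (let R = max 2 (registers c) in
      \<lparr>tapes = R, symbols = 8, states = csize c,
       trans = (\<lambda>q. instr_trans R (compile c 0 ! q) q)\<rparr>)"

lemma turing_machine_com:
  assumes "writes c \<subseteq> {..<8}" "0 < csize c"
  shows "turing_machine (com_machine c)"
proof -
  define R where "R = max 2 (registers c)"
  have "fst (instr_trans R x q ss) \<le> csize c \<and> length (snd (instr_trans R x q ss)) = R \<and>
      (\<forall>(s, d) \<in> set (snd (instr_trans R x q ss)). s < 8)"
    if "x \<in> set (compile c 0)" "q < csize c" "length ss = R" "\<forall>s \<in> set ss. s < 8" for x q ss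
  proof -
    have "instr_ok R (csize c) x"
      by (rule instr_ok_comp[OF _ assms(1) _ that(1)]) (auto simp: R_def)
    moreover have "ss ! i < 8" if "i < R" for i using \<open>length ss = R\<close> that \<open>\<forall>s \<in> set ss. s < 8\<close> by simp
    ultimately show ?thesis using that(2) by (cases x) (auto simp: instr_trans_def)
  qed
  moreover have "compile c 0 ! q \<in> set (compile c 0)" if "q < csize c" for q
    using that by simp
  ultimately have main: "fst (instr_trans R (compile c 0 ! q) q ss) \<le> csize c \<and>
      length (snd (instr_trans R (compile c 0 ! q) q ss)) = R \<and>
      (\<forall>(s, d) \<in> set (snd (instr_trans R (compile c 0 ! q) q ss)). s < 8)"
    if "q < csize c \<and> length ss = R \<and> (\<forall>s \<in> set ss. s < 8)" for q ss
    using that by blast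
  have "2 \<le> R" by (simp add: R_def)
  with main assms(2) show ?thesis
    unfolding turing_machine_def com_machine_def Let_def R_def[symmetric] machine.select_convs
    by (intro conjI) (assumption | rule order.refl | blast)+
qed

definition conf :: "nat \<Rightarrow> nat \<times> store \<Rightarrow> config" where
  "conf R c = (fst c, map (\<lambda>i. (fst (snd c) i, snd (snd c) i)) [0..<R])"

lemma step_com_machine:
  assumes "writes c \<subseteq> {..<8}"
  shows "step (com_machine c) (conf (max 2 (registers c)) x) =
    conf (max 2 (registers c)) (prog_step (compile c 0) x)"
proof (cases "fst x < csize c")
  case True
  define R where "R = max 2 (registers c)"
  obtain q T s where x: "x = (q, T, s)" by (metis prod.exhaust)
  have q: "q < csize c" using True by (simp add: x)
  have ok: "instr_ok R (csize c) (compile c 0 ! q)"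
    by (rule instr_ok_comp[OF _ assms]) (use q in \<open>auto simp: R_def\<close>)
  have R: "2 \<le> R" by (simp add: R_def)
  have upd: "map2 act (map f [0..<R]) (map g [0..<R]) = map (\<lambda>i. act (f i) (g i)) [0..<R]" for f g
    by (simp add: map2_map_map)
  have syms: "map (\<lambda>(c, p). c p) (map (\<lambda>i. (T i, s i)) [0..<R]) = map (\<lambda>i. T i (s i)) [0..<R]"
    by simp
  have "step (com_machine c) (conf R x) = conf R (prog_step (compile c 0) x)"
    using ok q R unfolding step_def com_machine_def Let_def R_def[symmetric] conf_def x
    by (cases "compile c 0 ! q") (auto simp: instr_trans_def syms upd comp_def)
  then show ?thesis by (simp add: R_def)
next
  case False
  then show ?thesis by (simp add: step_def com_machine_def conf_def Let_def)
qed

definition initial_store :: "letter list \<Rightarrow> store" where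
  "initial_store w = ((\<lambda>i. word_content (if i = 0 then w else [])), (\<lambda>_. 0))"

lemma com_machine_computes:
  assumes "writes c \<subseteq> {..<8}" "exec c (initial_store w) k (T', s')" "k \<le> t"
    and "\<And>i. i < length v \<Longrightarrow> T' 1 (i + 1) = letter_symbol (v ! i)" "T' 1 (length v + 1) = 0"
  shows "computes_in (com_machine c) w v t"
proof -
  define R where "R = max 2 (registers c)"
  have init: "initial_config (com_machine c) w = conf R (0, initial_store w)"
    by (simp add: initial_config_def initial_store_def conf_def com_machine_def R_def Let_def)
  have "(step (com_machine c) ^^ n) (conf R x) = conf R ((prog_step (compile c 0) ^^ n) x)" for n x
    by (induction n) (simp_all add: step_com_machine[OF assms(1)] R_def)
  moreover have "seg (compile c 0) 0 (compile c 0)" unfolding seg_def by (metis append_Nil append_Nil2 list.size(3))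
  ultimately have "(step (com_machine c) ^^ k) (initial_config (com_machine c) w) = conf R (csize c, T', s')"
    unfolding init using comp_correct[OF assms(2), of "compile c 0" 0] by simp
  moreover have "halted (com_machine c) (conf R (csize c, T', s'))"
    by (simp add: halted_def conf_def com_machine_def Let_def)
  moreover have "has_output (conf R (csize c, T', s')) v"
    using assms(4,5) by (simp add: has_output_def conf_def R_def)
  ultimately show ?thesis using assms(3) unfolding computes_in_def by metis
qed

section \<open>Arithmetic on registers: pairing, projections and iteration\<close>

section \<open>Recursive functions as while programs\<close>

text \<open>For programs that leave all tape contents unchanged, so that only head positions matter;
  an upper bound on the time is easier to compose than an exact count.\<close>

definition runs :: "com \<Rightarrow> (nat \<Rightarrow> nat \<Rightarrow> nat) \<Rightarrow> (nat \<Rightarrow> nat) \<Rightarrow> (nat \<Rightarrow> nat) \<Rightarrow> nat \<Rightarrow> bool" where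
  "runs c T s s' n \<longleftrightarrow> (\<exists>t \<le> n. exec c (T, s) t (T, s'))"

lemma runs_Skip: "runs Skip T s s 0"
  unfolding runs_def using exec.Skip by blast

lemma runs_Inc: "s' = s(r := s r + 1) \<Longrightarrow> runs (Inc r) T s s' 1"
  unfolding runs_def using exec.Inc by blast

lemma runs_Dec: "s' = s(r := s r - 1) \<Longrightarrow> runs (Dec r) T s s' 1"
  unfolding runs_def using exec.Dec by blast

lemma runs_Seq: "runs c T s s' n \<Longrightarrow> runs c' T s' s'' n' \<Longrightarrow> runs (c ;; c') T s s'' (n + n')"
  unfolding runs_def by (metis add_mono exec.Seq)

lemma runs_mono: "runs c T s s' n \<Longrightarrow> n \<le> n' \<Longrightarrow> runs c T s s' n'"
  unfolding runs_def by (metis le_trans)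

lemma runs_IfT: "T r (s r) = k \<Longrightarrow> runs c T s s' n \<Longrightarrow> runs (If r k c c') T s s' (n + 2)"
  unfolding runs_def using exec.IfT[of "(T, s)" r k c _ "(T, s')" c'] by fastforce

lemma runs_IfF: "T r (s r) \<noteq> k \<Longrightarrow> runs c' T s s' n \<Longrightarrow> runs (If r k c c') T s s' (n + 1)"
  unfolding runs_def using exec.IfF[of "(T, s)" r k c' _ "(T, s')" c] by fastforce

lemma runs_WhileF: "T r (s r) = k \<Longrightarrow> runs (While r k c) T s s 1"
  unfolding runs_def using exec.WhileF[of "(T, s)" r k c] by fastforce

lemma runs_WhileT:
  assumes "T r (s r) \<noteq> k" "runs c T s s' n" "runs (While r k c) T s' s'' n'"
  shows "runs (While r k c) T s s'' (n + 2 + n')"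
  using assms exec.WhileT[of "(T, s)" r k c _ "(T, s')" _ "(T, s'')"]
  unfolding runs_def fst_conv snd_conv by (meson add_mono order.refl)

text \<open>Register tapes hold nothing but the left end marker, which makes the zero test a look at
  one symbol.\<close>

definition plain :: "(nat \<Rightarrow> nat \<Rightarrow> nat) \<Rightarrow> bool" where
  "plain T \<longleftrightarrow> (\<forall>r \<ge> 2. T r = word_content [])"

lemma plain_zero: "plain T \<Longrightarrow> 2 \<le> r \<Longrightarrow> T r x = 1 \<longleftrightarrow> x = 0"
  by (auto simp: plain_def word_content_def)

text \<open>\<open>F j\<close> is the store after \<open>j\<close> rounds, up to the counter
  \<open>r\<close>. The body may use \<open>r\<close> if it restores it. Besides the body, a round
  takes 3 steps: test, decrement and jump.\<close>

lemma runs_loop: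
  assumes T: "plain T" "2 \<le> r"
    and body: "\<And>j. j < n \<Longrightarrow> runs c T ((F j)(r := n - 1 - j)) ((F (Suc j))(r := n - 1 - j)) (k j)"
    and s: "s = (F 0)(r := n)" and s': "s' = (F n)(r := 0)" and N: "(\<Sum>j<n. k j + 3) + 1 \<le> N"
  shows "runs (While r 1 (Dec r ;; c)) T s s' N"
proof -
  have "runs (While r 1 (Dec r ;; c)) T ((F (n - i))(r := i)) ((F n)(r := 0)) ((\<Sum>j\<in>{n-i..<n}. k j + 3) + 1)"
    if "i \<le> n" for i
    using that
  proof (induction i)
    case 0
    have "T r (((F n)(r := 0)) r) = 1" using plain_zero[OF T, of 0] by simp
    then have "runs (While r 1 (Dec r ;; c)) T ((F n)(r := 0)) ((F n)(r := 0)) 1"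
      by (rule runs_WhileF)
    then show ?case by (simp add: fun_upd_def)
  next
    case (Suc i)
    let ?j = "n - Suc i"
    have j: "?j < n" "Suc ?j = n - i" "n - 1 - ?j = i" using Suc.prems by auto
    have 1: "runs (Dec r ;; c) T ((F ?j)(r := Suc i)) ((F (n - i))(r := i)) (1 + k ?j)"
      using body[OF j(1)] unfolding j(2,3) by (intro runs_Seq[OF runs_Dec]) auto
    have 2: "T r (((F ?j)(r := Suc i)) r) \<noteq> 1" using plain_zero[OF T, of "Suc i"] by simp
    have "runs (While r 1 (Dec r ;; c)) T ((F ?j)(r := Suc i)) ((F n)(r := 0))
        (1 + k ?j + 2 + ((\<Sum>j\<in>{n-i..<n}. k j + 3) + 1))"
      by (rule runs_WhileT[OF 2 1 Suc.IH[OF Suc_leD[OF Suc.prems]]])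
    moreover have "{?j..<n} = insert ?j {n-i..<n}" using Suc.prems by auto
    then have "(\<Sum>j\<in>{?j..<n}. k j + 3) = k ?j + 3 + (\<Sum>j\<in>{n-i..<n}. k j + 3)" using j(2) by simp
    then have "1 + k ?j + 2 + ((\<Sum>j\<in>{n-i..<n}. k j + 3) + 1) \<le> (\<Sum>j\<in>{?j..<n}. k j + 3) + 1"
      by linarith
    ultimately show ?case by (rule runs_mono)
  qed
  from this[of n] show ?thesis using N unfolding s s' by (intro runs_mono[OF _ N]) (simp add: atLeast0LessThan)
qed

definition clear :: "nat \<Rightarrow> com" where
  "clear r = While r 1 (Dec r ;; Skip)"

definition move :: "nat \<Rightarrow> nat \<Rightarrow> com" where
  "move r r' = While r 1 (Dec r ;; Inc r')"

definition copy :: "nat \<Rightarrow> nat \<Rightarrow> nat \<Rightarrow> com" where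
  "copy r r1 r2 = While r 1 (Dec r ;; Inc r1 ;; Inc r2)"

lemma runs_clear:
  "plain T \<Longrightarrow> 2 \<le> r \<Longrightarrow> s' = s(r := 0) \<Longrightarrow> runs (clear r) T s s' (3 * s r + 1)"
  unfolding clear_def
  by (rule runs_loop[where F = "\<lambda>_. s" and k = "\<lambda>_. 0" and n = "s r"]) (auto intro: runs_Skip)

lemma runs_move:
  "plain T \<Longrightarrow> 2 \<le> r \<Longrightarrow> r \<noteq> r' \<Longrightarrow> s' = s(r := 0, r' := s r' + s r) \<Longrightarrow>
    runs (move r r') T s s' (4 * s r + 1)"
  unfolding move_def
proof (rule runs_loop[where F = "\<lambda>j. s(r' := s r' + j)" and k = "\<lambda>_. 1" and n = "s r"])
  fix j assume "r \<noteq> r'"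
  then show "runs (Inc r') T ((s(r' := s r' + j))(r := s r - 1 - j)) ((s(r' := s r' + Suc j))(r := s r - 1 - j)) 1"
    by (intro runs_Inc) (auto simp: fun_eq_iff)
qed (auto simp: fun_eq_iff)

lemma runs_copy:
  "plain T \<Longrightarrow> 2 \<le> r \<Longrightarrow> r \<noteq> r1 \<Longrightarrow> r \<noteq> r2 \<Longrightarrow> r1 \<noteq> r2 \<Longrightarrow>
    s' = s(r := 0, r1 := s r1 + s r, r2 := s r2 + s r) \<Longrightarrow>
    runs (copy r r1 r2) T s s' (5 * s r + 1)"
  unfolding copy_def
proof (rule runs_loop[where F = "\<lambda>j. s(r1 := s r1 + j, r2 := s r2 + j)" and k = "\<lambda>_. 1 + 1" and n = "s r"])
  fix j assume "r \<noteq> r1" "r \<noteq> r2" "r1 \<noteq> r2"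
  then show "runs (Inc r1 ;; Inc r2) T ((s(r1 := s r1 + j, r2 := s r2 + j))(r := s r - 1 - j))
     ((s(r1 := s r1 + Suc j, r2 := s r2 + Suc j))(r := s r - 1 - j)) (1 + 1)"
    by (intro runs_Seq[OF runs_Inc[OF refl] runs_Inc]) (auto simp: fun_eq_iff)
qed (auto simp: fun_eq_iff)

definition clean :: "nat \<Rightarrow> (nat \<Rightarrow> nat) \<Rightarrow> bool" where
  "clean b s \<longleftrightarrow> (\<forall>r > b. s r = 0)"

text \<open>Walks along the diagonal enumeration of pairs from \<open>(0, 0)\<close>, one step for
  each unit of the argument: \<open>(a, Suc c)\<close> is followed by \<open>(Suc a, c)\<close>, and
  \<open>(a, 0)\<close> by \<open>(0, Suc a)\<close>.\<close>

definition unpair :: "nat \<Rightarrow> com" where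
  "unpair b = move b (b + 2) ;; While (b + 2) 1 (Dec (b + 2) ;;
     If (b + 1) 1 (move b (b + 1) ;; Inc (b + 1)) (Inc b ;; Dec (b + 1)))"

lemma prod_decode_Suc:
  "prod_decode (Suc n) = (case prod_decode n of (a, 0) \<Rightarrow> (0, Suc a) | (a, Suc c) \<Rightarrow> (Suc a, c))"
proof -
  obtain a c where ac: "prod_decode n = (a, c)" by force
  then have n: "n = prod_encode (a, c)" by (metis prod_decode_inverse)
  show ?thesis
  proof (cases c)
    case 0
    then have "Suc n = prod_encode (0, Suc a)" by (simp add: n prod_encode_def)
    then show ?thesis by (simp add: ac 0)
  next
    case (Suc c')
    then have "Suc n = prod_encode (Suc a, c')" by (simp add: n prod_encode_def)
    then show ?thesis by (simp add: ac Suc)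
  qed
qed

lemma triangle_mono: "m \<le> n \<Longrightarrow> triangle m \<le> triangle n"
  by (induction rule: dec_induct) simp_all

lemma le_prod_encode: "a \<le> prod_encode (a, c)" "c \<le> prod_encode (a, c)"
  by (rule le_prod_encode_1, rule le_prod_encode_2)

lemma prod_decode_le: "fst (prod_decode n) \<le> n" "snd (prod_decode n) \<le> n"
  using le_prod_encode(1)[of "fst (prod_decode n)" "snd (prod_decode n)"]
    le_prod_encode(2)[of "snd (prod_decode n)" "fst (prod_decode n)"] by simp_all

text \<open>A crude bound that covers both unpairing and pairing.\<close>

abbreviation quad :: "nat \<Rightarrow> nat" where
  "quad x \<equiv> 20 * (x + 1) * (x + 1)"

lemma runs_unpair:
  assumes T: "plain T" "2 \<le> b" and c: "s (b + 1) = 0" "s (b + 2) = 0"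
    and s': "s' = s(b := fst (prod_decode (s b)), b + 1 := snd (prod_decode (s b)))"
  shows "runs (unpair b) T s s' (quad (s b))"
proof -
  define x where "x = s b"
  define F where "F j = s(b := fst (prod_decode j), b + 1 := snd (prod_decode j))" for j
  have zero: "prod_decode 0 = (0, 0)" by (simp add: prod_decode_def prod_decode_aux.simps)
  have 1: "runs (move b (b + 2)) T s ((F 0)(b + 2 := x)) (4 * x + 1)"
    unfolding x_def F_def using T c by (intro runs_move) (auto simp: zero)
  have 2: "runs (While (b + 2) 1 (Dec (b + 2) ;;
     If (b + 1) 1 (move b (b + 1) ;; Inc (b + 1)) (Inc b ;; Dec (b + 1)))) T
     ((F 0)(b + 2 := x)) s' (x * (4 * x + 7) + 1)"
  proof (rule runs_loop[where F = F and k = "\<lambda>_. 4 * x + 4" and n = x])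
    fix j assume j: "j < x"
    let ?s = "(F j)(b + 2 := x - 1 - j)" and ?s' = "(F (Suc j))(b + 2 := x - 1 - j)"
    obtain a c where ac: "prod_decode j = (a, c)" by force
    have "a \<le> j" using prod_decode_le(1)[of j] by (simp add: ac)
    show "runs (If (b + 1) 1 (move b (b + 1) ;; Inc (b + 1)) (Inc b ;; Dec (b + 1))) T ?s ?s' (4 * x + 4)"
    proof (cases c)
      case 0
      have "runs (move b (b + 1) ;; Inc (b + 1)) T ?s ?s' (4 * ?s b + 1 + 1)"
        by (rule runs_Seq[OF runs_move[OF _ _ _ refl] runs_Inc])
          (use T in \<open>auto simp: F_def ac 0 prod_decode_Suc fun_eq_iff\<close>)
      then have "runs (If (b + 1) 1 (move b (b + 1) ;; Inc (b + 1)) (Inc b ;; Dec (b + 1))) T ?s ?s'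
          (4 * ?s b + 1 + 1 + 2)"
        by (rule runs_IfT[rotated]) (use T plain_zero[OF T(1), of "b + 1" 0] in \<open>simp add: F_def ac 0\<close>)
      then show ?thesis by (rule runs_mono) (use \<open>a \<le> j\<close> j in \<open>simp add: F_def ac\<close>)
    next
      case (Suc c')
      have "runs (Inc b ;; Dec (b + 1)) T ?s ?s' (1 + 1)"
        by (rule runs_Seq[OF runs_Inc[OF refl] runs_Dec])
          (use T in \<open>auto simp: F_def ac Suc prod_decode_Suc fun_eq_iff\<close>)
      then have "runs (If (b + 1) 1 (move b (b + 1) ;; Inc (b + 1)) (Inc b ;; Dec (b + 1))) T ?s ?s'
          (1 + 1 + 1)"
        by (rule runs_IfF[rotated]) (use T plain_zero[OF T(1), of "b + 1" c] in \<open>simp add: F_def ac Suc\<close>)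
      then show ?thesis by (rule runs_mono) simp
    qed
  qed (use T c in \<open>auto simp: F_def x_def s' fun_eq_iff algebra_simps\<close>)
  from runs_Seq[OF 1 2] show ?thesis
    unfolding unpair_def x_def[symmetric] by (rule runs_mono) (simp add: algebra_simps)
qed

text \<open>Evaluates \<open>u + triangle (u + v)\<close> by adding \<open>u + v\<close>,
  \<open>u + v - 1\<close>, ..., 1 to \<open>u\<close>. Copying destroys its source, so the
  remaining count is copied to \<open>b + 1\<close> as well and moved back.\<close>

definition mkpair :: "nat \<Rightarrow> com" where
  "mkpair b = copy (b + 1) b (b + 2) ;; While (b + 2) 1 (Dec (b + 2) ;;
     (Inc b ;; copy (b + 2) b (b + 1)) ;; move (b + 1) (b + 2))"

lemma runs_mkpair:
  assumes T: "plain T" "2 \<le> b" and c: "s b = 0"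
    and y: "y = prod_encode (s (b + 1), s (b + 2))"
    and s': "s' = s(b := y, b + 1 := 0, b + 2 := 0)"
  shows "runs (mkpair b) T s s' (quad y)"
proof -
  define u where "u = s (b + 1)"
  define n where "n = u + s (b + 2)"
  have y': "y = u + triangle n" by (simp add: y u_def n_def prod_encode_def)
  have un: "u \<le> y" "n \<le> y"
    using triangle_Suc[of "n - 1"] by (cases n; simp add: y')+
  define F where "F j = s(b := u + (triangle n - triangle (n - j)), b + 1 := 0)" for j
  have 1: "runs (copy (b + 1) b (b + 2)) T s ((F 0)(b + 2 := n)) (5 * u + 1)"
    unfolding u_def F_def n_def using T c by (intro runs_copy) (auto simp: fun_eq_iff)
  have 2: "runs (While (b + 2) 1 (Dec (b + 2) ;;
     (Inc b ;; copy (b + 2) b (b + 1)) ;; move (b + 1) (b + 2))) T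
     ((F 0)(b + 2 := n)) s' (n * (9 * n + 6) + 1)"
  proof (rule runs_loop[where F = F and k = "\<lambda>_. 9 * n + 3" and n = n])
    fix j assume j: "j < n"
    obtain m where n: "n = Suc (j + m)" using j by (auto dest: less_imp_Suc_add)
    then have m: "n - 1 - j = m" "n - j = Suc m" "n - Suc j = m" by auto
    let ?s = "(F j)(b + 2 := m)" and ?s' = "(F (Suc j))(b + 2 := m)"
    let ?s1 = "?s(b := ?s b + 1)"
    let ?s2 = "?s1(b + 2 := 0, b := ?s1 b + m, b + 1 := m)"
    have tri: "triangle (Suc m) \<le> triangle n" using n by (intro triangle_mono) simp
    have F: "F j = s(b := u + (triangle n - triangle (Suc m)), b + 1 := 0)"
      "F (Suc j) = s(b := u + (triangle n - triangle m), b + 1 := 0)"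
      by (simp_all only: F_def m)
    have a: "runs (Inc b) T ?s ?s1 1" by (rule runs_Inc[OF refl])
    have b: "runs (copy (b + 2) b (b + 1)) T ?s1 ?s2 (5 * ?s1 (b + 2) + 1)"
      by (rule runs_copy) (use T in \<open>auto simp: F fun_eq_iff\<close>)
    have c: "runs (move (b + 1) (b + 2)) T ?s2 ?s' (4 * ?s2 (b + 1) + 1)"
      by (rule runs_move) (use T tri in \<open>auto simp: F fun_eq_iff\<close>)
    from runs_Seq[OF runs_Seq[OF a b] c]
    show "runs ((Inc b ;; copy (b + 2) b (b + 1)) ;; move (b + 1) (b + 2)) T ((F j)(b + 2 := n - 1 - j))
        ((F (Suc j))(b + 2 := n - 1 - j)) (9 * n + 3)"
      unfolding m by (rule runs_mono) (simp add: n)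
  qed (use T c in \<open>auto simp: F_def s' y' fun_eq_iff algebra_simps\<close>)
  have "5 * u + 1 + (n * (9 * n + 6) + 1) \<le> 5 * y + 1 + (y * (9 * y + 6) + 1)"
    using un by (intro add_mono mult_mono) auto
  also have "\<dots> \<le> quad y" by (simp add: algebra_simps)
  finally show ?thesis
    using runs_mono[OF runs_Seq[OF 1 2]] unfolding mkpair_def by blast
qed

text \<open>The number of rounds of \<open>Iter\<close> is fixed before the loop starts, so all
  these programs terminate; their growth is controlled separately through
  \<open>cost\<close>.\<close>

datatype pf = Null | Ident | Succ | Pred | Fst | Snd | Fork pf pf | Comp pf pf | Iter pf

fun sem :: "pf \<Rightarrow> nat \<Rightarrow> nat" where
  "sem Null x = 0"
| "sem Ident x = x"
| "sem Succ x = Suc x"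
| "sem Pred x = x - 1"
| "sem Fst x = fst (prod_decode x)"
| "sem Snd x = snd (prod_decode x)"
| "sem (Fork f g) x = prod_encode (sem f x, sem g x)"
| "sem (Comp f g) x = sem f (sem g x)"
| "sem (Iter f) x = (sem f ^^ fst (prod_decode x)) (snd (prod_decode x))"

text \<open>The summands are bracketed like the sequential compositions of the code. The cost of
  \<open>Iter\<close> depends on all intermediate values, which is why these will need
  bounds.\<close>

fun cost :: "pf \<Rightarrow> nat \<Rightarrow> nat" where
  "cost Null x = 3 * x + 1"
| "cost Ident x = 0"
| "cost Succ x = 1"
| "cost Pred x = 1"
| "cost Fst x = quad x + (3 * x + 1)"
| "cost Snd x = quad x + ((3 * x + 1) + (4 * x + 1))"
| "cost (Fork f g) x = (5 * x + 1) + ((4 * x + 1) + (cost f x + ((4 * x + 1) +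
     (cost g x + quad (prod_encode (sem f x, sem g x))))))"
| "cost (Comp f g) x = cost g x + cost f (sem g x)"
| "cost (Iter f) x = quad x + (((\<Sum>j<fst (prod_decode x). cost f ((sem f ^^ j) (snd (prod_decode x))) + 3) + 1) +
     (4 * (sem f ^^ fst (prod_decode x)) (snd (prod_decode x)) + 1))"

text \<open>
  Register \<open>b\<close> holds the argument and then the result; the registers above \<open>b\<close> are scratch space
  that is zero before and after.
\<close>

fun code :: "pf \<Rightarrow> nat \<Rightarrow> com" where
  "code Null b = clear b"
| "code Ident b = Skip"
| "code Succ b = Inc b"
| "code Pred b = Dec b"
| "code Fst b = unpair b ;; clear (b + 1)"
| "code Snd b = unpair b ;; (clear b ;; move (b + 1) b)"
| "code (Fork f g) b = copy b (b + 1) (b + 2) ;; (move (b + 2) b ;; (code f (b + 1) ;; (move b (b + 2) ;;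
     (code g (b + 2) ;; mkpair b))))"
| "code (Comp f g) b = code g b ;; code f b"
| "code (Iter f) b = unpair b ;; (While b 1 (Dec b ;; code f (b + 1)) ;; move (b + 1) b)"

lemma runs_code:
  "plain T \<Longrightarrow> 2 \<le> b \<Longrightarrow> clean b s \<Longrightarrow> s' = s(b := sem p (s b)) \<Longrightarrow>
    runs (code p b) T s s' (cost p (s b))"
proof (induction p arbitrary: b s s')
  case Null
  then show ?case unfolding sem.simps cost.simps code.simps by (blast intro: runs_clear)
next
  case Ident
  then show ?case using runs_Skip[of T s] by simp
next
  case Succ
  then show ?case unfolding sem.simps cost.simps code.simps by (intro runs_Inc) (auto simp: fun_eq_iff)
next
  case Pred
  then show ?case unfolding sem.simps cost.simps code.simps by (intro runs_Dec) (auto simp: fun_eq_iff)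
next
  case Fst
  let ?s1 = "s(b := fst (prod_decode (s b)), b + 1 := snd (prod_decode (s b)))"
  have 1: "runs (unpair b) T s ?s1 (quad (s b))"
    using Fst by (intro runs_unpair) (auto simp: clean_def)
  have 2: "runs (clear (b + 1)) T ?s1 s' (3 * ?s1 (b + 1) + 1)"
    using Fst by (intro runs_clear) (auto simp: clean_def fun_eq_iff)
  show ?case using runs_mono[OF runs_Seq[OF 1 2], of "cost pf.Fst (s b)"] prod_decode_le(2)[of "s b"] by simp
next
  case Snd
  let ?s1 = "s(b := fst (prod_decode (s b)), b + 1 := snd (prod_decode (s b)))"
  let ?s2 = "?s1(b := 0)"
  have 1: "runs (unpair b) T s ?s1 (quad (s b))"
    using Snd by (intro runs_unpair) (auto simp: clean_def)
  have 2: "runs (clear b) T ?s1 ?s2 (3 * ?s1 b + 1)"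
    using Snd by (intro runs_clear) auto
  have 3: "runs (move (b + 1) b) T ?s2 s' (4 * ?s2 (b + 1) + 1)"
    using Snd by (intro runs_move) (auto simp: clean_def fun_eq_iff)
  show ?case
    using runs_mono[OF runs_Seq[OF 1 runs_Seq[OF 2 3]], of "cost pf.Snd (s b)"] prod_decode_le[of "s b"]
    by simp
next
  case (Fork f g)
  note T = Fork.prems(1,2) and cl = Fork.prems(3)[unfolded clean_def]
  let ?x = "s b"
  let ?s1 = "s(b := 0, b + 1 := ?x, b + 2 := ?x)"
  let ?s2 = "s(b + 1 := ?x)"
  let ?s3 = "s(b + 1 := sem f ?x)"
  let ?s4 = "?s3(b := 0, b + 2 := ?x)"
  let ?s5 = "?s3(b := 0, b + 2 := sem g ?x)"
  have 1: "runs (copy b (b + 1) (b + 2)) T s ?s1 (5 * ?x + 1)"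
    using T cl by (intro runs_copy) (auto simp: fun_eq_iff)
  have "runs (move (b + 2) b) T ?s1 ?s2 (4 * ?s1 (b + 2) + 1)"
    using T cl by (intro runs_move) (auto simp: fun_eq_iff)
  then have 2: "runs (move (b + 2) b) T ?s1 ?s2 (4 * ?x + 1)" by (simp only: fun_upd_same)
  have "runs (code f (b + 1)) T ?s2 ?s3 (cost f (?s2 (b + 1)))"
    using T cl by (intro Fork.IH) (auto simp: clean_def fun_eq_iff)
  then have 3: "runs (code f (b + 1)) T ?s2 ?s3 (cost f ?x)" by (simp only: fun_upd_same)
  have "?s3 b = ?x" by simp
  moreover have "runs (move b (b + 2)) T ?s3 ?s4 (4 * ?s3 b + 1)"
    using T cl by (intro runs_move) (auto simp: fun_eq_iff)
  ultimately have 4: "runs (move b (b + 2)) T ?s3 ?s4 (4 * ?x + 1)" by (simp only:)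
  have "runs (code g (b + 2)) T ?s4 ?s5 (cost g (?s4 (b + 2)))"
    using T cl by (intro Fork.IH) (auto simp: clean_def fun_eq_iff)
  then have 5: "runs (code g (b + 2)) T ?s4 ?s5 (cost g ?x)" by (simp only: fun_upd_same)
  have 6: "runs (mkpair b) T ?s5 s' (quad (prod_encode (sem f ?x, sem g ?x)))"
    using T cl Fork.prems(4) by (intro runs_mkpair) (auto simp: fun_eq_iff)
  show ?case unfolding code.simps cost.simps
    by (rule runs_Seq[OF 1 runs_Seq[OF 2 runs_Seq[OF 3 runs_Seq[OF 4 runs_Seq[OF 5 6]]]]])
next
  case (Comp f g)
  let ?s1 = "s(b := sem g (s b))"
  have 1: "runs (code g b) T s ?s1 (cost g (s b))" by (rule Comp.IH(2)[OF Comp.prems(1-3) refl])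
  have 2: "runs (code f b) T ?s1 s' (cost f (?s1 b))"
    using Comp.prems by (intro Comp.IH(1)) (auto simp: clean_def fun_eq_iff)
  show ?case using runs_Seq[OF 1 2] by simp
next
  case (Iter f)
  note T = Iter.prems(1,2) and cl = Iter.prems(3)[unfolded clean_def]
  define n where "n = fst (prod_decode (s b))"
  define x where "x = snd (prod_decode (s b))"
  let ?s1 = "s(b := n, b + 1 := x)"
  define F where "F j = s(b + 1 := (sem f ^^ j) x)" for j
  let ?s2 = "(F n)(b := 0)"
  have 1: "runs (unpair b) T s ?s1 (quad (s b))"
    unfolding n_def x_def using T cl by (intro runs_unpair) auto
  have 2: "runs (While b 1 (Dec b ;; code f (b + 1))) T ?s1 ?s2 ((\<Sum>j<n. cost f ((sem f ^^ j) x) + 3) + 1)"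
  proof (rule runs_loop[where F = F and k = "\<lambda>j. cost f ((sem f ^^ j) x)" and n = n])
    fix j
    let ?s = "(F j)(b := n - 1 - j)"
    have "runs (code f (b + 1)) T ?s ((F (Suc j))(b := n - 1 - j)) (cost f (?s (b + 1)))"
      using T cl by (intro Iter.IH) (auto simp: clean_def F_def fun_eq_iff)
    then show "runs (code f (b + 1)) T ?s ((F (Suc j))(b := n - 1 - j)) (cost f ((sem f ^^ j) x))"
      by (simp add: F_def)
  qed (use T in \<open>auto simp: F_def fun_eq_iff\<close>)
  have 3: "runs (move (b + 1) b) T ?s2 s' (4 * ?s2 (b + 1) + 1)"
    using T cl Iter.prems(4) by (intro runs_move) (auto simp: F_def n_def x_def fun_eq_iff)
  show ?case using runs_Seq[OF 1 runs_Seq[OF 2 3]] by (simp add: F_def n_def x_def)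
qed

section \<open>Closure properties of elementary functions on coded data\<close>

section \<open>Elementary functions\<close>

lemma tower_mono: "m \<le> n \<Longrightarrow> tower h m \<le> tower h n"
  by (induction h) auto

lemma tower_le_Suc: "tower h n \<le> tower (Suc h) n"
  by (simp add: less_imp_le)

lemma tower_height_mono: "h \<le> h' \<Longrightarrow> tower h n \<le> tower h' n"
  by (induction rule: dec_induct) (use tower_le_Suc le_trans in blast)+

lemma tower_tower: "tower h (tower h' n) = tower (h + h') n"
  by (induction h) auto

lemma height_le_tower: "h \<le> tower (Suc h) n"
proof (induction h)
  case (Suc h)
  then have "Suc h \<le> Suc (tower (Suc h) n)" by simp
  also have "\<dots> \<le> tower (Suc (Suc h)) n"
    using less_exp[of "tower (Suc h) n"] by (simp add: Suc_le_eq)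
  finally show ?case .
qed simp

text \<open>Fixing one code for each type makes elementarity a property of the function
  alone.\<close>

class codable =
  fixes cd :: "'a \<Rightarrow> nat"
  assumes cd_inject: "cd x = cd y \<Longrightarrow> x = y"

lemma cd_eq_iff [simp]: "cd x = cd y \<longleftrightarrow> x = y"
  using cd_inject by blast

instantiation nat :: codable
begin
definition "cd_nat (n :: nat) = n"
instance by standard (simp add: cd_nat_def)
end

instantiation bool :: codable
begin
definition "cd_bool b = (if b then 1 else 0 :: nat)"
instance by standard (auto simp: cd_bool_def split: if_splits)
end

instantiation prod :: (codable, codable) codable
begin
definition "cd_prod p = prod_encode (cd (fst p), cd (snd p))"
instance by standard (auto simp: cd_prod_def prod_eq_iff)
end

instantiation list :: (codable) codable
begin
definition "cd_list xs = list_encode (map cd xs)"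
instance proof
  fix x y :: "'a list"
  assume "cd x = cd y"
  then have "map cd x = map cd y" unfolding cd_list_def list_encode_eq .
  moreover have "inj (cd :: 'a \<Rightarrow> nat)" by (simp add: inj_def)
  ultimately show "x = y" by (simp only: inj_map_eq_map)
qed
end

instantiation letter :: codable
begin
definition "cd_letter l = letter_symbol l"
instance proof
  fix x y :: letter
  show "cd x = cd y \<Longrightarrow> x = y" unfolding cd_letter_def by (cases x; cases y) simp_all
qed
end

instantiation atom :: codable
begin
definition "cd_atom a = cd (pred a, args a)"
instance by standard (simp add: cd_atom_def atom.expand)
end

instantiation dexr :: codable
begin
definition "cd_dexr r = cd (body r, heads r)"
instance by standard (simp add: cd_dexr_def dexr.expand)
end

definition elem_bounded :: "('a::codable \<Rightarrow> nat) \<Rightarrow> bool" where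
  "elem_bounded g \<longleftrightarrow> (\<exists>h. \<forall>x. g x \<le> tower h (cd x))"

text \<open>Only the time is bounded explicitly; a bound on the value follows by
  \<open>sem_le_cost\<close>.\<close>

definition elementary :: "('a::codable \<Rightarrow> 'b::codable) \<Rightarrow> bool" where
  "elementary f \<longleftrightarrow> (\<exists>p. (\<forall>x. sem p (cd x) = cd (f x)) \<and> elem_bounded (\<lambda>x :: 'a. cost p (cd x)))"

lemma bnd_le: "elem_bounded f \<Longrightarrow> (\<And>x. g x \<le> f x) \<Longrightarrow> elem_bounded g"
  unfolding elem_bounded_def by (meson le_trans)

lemma bnd_id: "elem_bounded (\<lambda>x :: 'a::codable. cd x)"
  unfolding elem_bounded_def by (rule exI[of _ 0]) simp

lemma bnd_const: "elem_bounded (\<lambda>x :: 'a::codable. c)"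
  unfolding elem_bounded_def using height_le_tower by blast

lemma bnd_common:
  fixes f g :: "'a::codable \<Rightarrow> nat"
  assumes "elem_bounded f" "elem_bounded g"
  obtains h where "\<And>x. f x \<le> tower h (cd x)" "\<And>x. g x \<le> tower h (cd x)"
proof -
  from assms obtain h h' where "\<And>x. f x \<le> tower h (cd x)" "\<And>x. g x \<le> tower h' (cd x)"
    unfolding elem_bounded_def by blast
  then have "f x \<le> tower (max h h') (cd x) \<and> g x \<le> tower (max h h') (cd x)" for x
    using tower_height_mono[of h "max h h'"] tower_height_mono[of h' "max h h'"] le_trans
    by (metis max.cobounded1 max.cobounded2)
  with that show ?thesis by blast
qed

lemma double_le_exp: "2 * n \<le> 2 ^ (n :: nat)"
proof (induction n)
  case (Suc n)
  then show ?case by (cases n) auto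
qed simp

lemma bnd_add: "elem_bounded f \<Longrightarrow> elem_bounded g \<Longrightarrow> elem_bounded (\<lambda>x. f x + g x)"
proof (erule (1) bnd_common)
  fix h assume h: "\<And>x. f x \<le> tower h (cd x)" "\<And>x. g x \<le> tower h (cd x)"
  have "f x + g x \<le> tower (Suc h) (cd x)" for x
    using h[of x] double_le_exp[of "tower h (cd x)"] by simp
  then show ?thesis unfolding elem_bounded_def by blast
qed

lemma bnd_exp: "elem_bounded f \<Longrightarrow> elem_bounded (\<lambda>x. 2 ^ f x)"
  unfolding elem_bounded_def
proof (elim exE)
  fix h assume "\<forall>x. f x \<le> tower h (cd x)"
  then have "2 ^ f x \<le> tower (Suc h) (cd x)" for x by simp
  then show "\<exists>h. \<forall>x. 2 ^ f x \<le> tower h (cd x)" by blast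
qed

lemma bnd_mult:
  assumes "elem_bounded f" "elem_bounded g"
  shows "elem_bounded (\<lambda>x. f x * g x)"
proof (rule bnd_le[OF bnd_exp[OF bnd_add[OF assms]]])
  fix x
  show "f x * g x \<le> 2 ^ (f x + g x)"
    unfolding power_add by (intro mult_le_mono) (simp_all add: less_imp_le)
qed

lemma bnd_power:
  assumes "elem_bounded f" "elem_bounded g"
  shows "elem_bounded (\<lambda>x. f x ^ g x)"
proof (rule bnd_le[OF bnd_exp[OF bnd_mult[OF assms]]])
  fix x
  have "f x ^ g x \<le> (2 ^ f x) ^ g x" by (intro power_mono) (simp_all add: less_imp_le)
  then show "f x ^ g x \<le> 2 ^ (f x * g x)" by (simp add: power_mult)
qed

lemma prod_encode_less: "prod_encode (a, c) < (a + c + 1) * (a + c + 1)"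
proof -
  have "triangle n \<le> n * n" for n by (induction n) auto
  from this[of "a + c"] show ?thesis by (simp add: prod_encode_def algebra_simps)
qed

lemma bnd_prod_encode:
  assumes "elem_bounded f" "elem_bounded g"
  shows "elem_bounded (\<lambda>x. prod_encode (f x, g x))"
  by (rule bnd_le[of "\<lambda>x. (f x + g x + 1) * (f x + g x + 1)"])
    (intro bnd_mult bnd_add bnd_const assms, rule less_imp_le[OF prod_encode_less])

text \<open>Numbers are built up by single steps of a counter, so values grow no faster than time
  passes.\<close>

lemma sem_le_cost: "sem p x \<le> x + cost p x"
proof (induction p arbitrary: x)
  case Fst
  then show ?case using prod_decode_le(1)[of x] by simp
next
  case Snd
  then show ?case using prod_decode_le(2)[of x] by simp
next
  case (Comp f g)
  show ?case using Comp.IH(1)[of "sem g x"] Comp.IH(2)[of x] by simp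
qed auto

lemma bnd_elementary:
  fixes f :: "'a::codable \<Rightarrow> 'b::codable"
  assumes "elementary f"
  shows "elem_bounded (\<lambda>x. cd (f x))"
proof -
  obtain p where p: "\<And>x. sem p (cd x) = cd (f x)" "elem_bounded (\<lambda>x :: 'a. cost p (cd x))"
    using assms unfolding elementary_def by blast
  show ?thesis
    by (rule bnd_le[OF bnd_add[OF bnd_id p(2)]]) (metis p(1) sem_le_cost)
qed

lemma bnd_nat: "elementary (f :: 'a::codable \<Rightarrow> nat) \<Longrightarrow> elem_bounded f"
  using bnd_elementary[of f] by (simp add: cd_nat_def)

text \<open>Stacking towers adds their heights, so the height remains fixed.\<close>

lemma bnd_compose:
  assumes g: "elem_bounded (g :: 'b::codable \<Rightarrow> nat)"
    and f: "elem_bounded (\<lambda>x :: 'a::codable. cd (f x :: 'b))"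
  shows "elem_bounded (\<lambda>x. g (f x))"
proof -
  obtain h h' where h: "\<And>y. g y \<le> tower h (cd y)" "\<And>x. cd (f x) \<le> tower h' (cd x)"
    using f g unfolding elem_bounded_def by blast
  have "g (f x) \<le> tower (h + h') (cd x)" for x
    using h(1)[of "f x"] tower_mono[OF h(2), of h x] by (simp add: tower_tower)
  then show ?thesis unfolding elem_bounded_def by blast
qed

lemma elementaryI:
  assumes "\<And>x. sem p (cd x) = cd (f x)" "elem_bounded (\<lambda>x :: 'a::codable. cost p (cd x))"
  shows "elementary (f :: 'a \<Rightarrow> 'b::codable)"
  using assms unfolding elementary_def by blast

lemma elementary_recode:
  assumes "elementary (f :: 'a::codable \<Rightarrow> 'b::codable)" "\<And>x. cd (g x :: 'c::codable) = cd (f x)"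
  shows "elementary g"
  using assms unfolding elementary_def by auto

lemma el_id: "elementary (\<lambda>x. x)"
  by (rule elementaryI[of Ident]) (auto intro: bnd_const)

lemma el_const: "elementary (\<lambda>x. c)"
proof -
  define K where "K n = (Comp Succ ^^ n) Null" for n
  have "sem (K n) x = n" "cost (K n) x = 3 * x + 1 + n" for n x
    by (induction n) (simp_all add: K_def)
  then show ?thesis
    by (intro elementaryI[of "K (cd c)"]) (simp, simp only:, intro bnd_add bnd_mult bnd_const bnd_id)
qed

lemma el_compose:
  fixes f :: "'b::codable \<Rightarrow> 'c::codable" and g :: "'a::codable \<Rightarrow> 'b"
  assumes "elementary f" "elementary g"
  shows "elementary (\<lambda>x. f (g x))"
proof -
  obtain p where p: "\<And>x. sem p (cd x) = cd (f x)" "elem_bounded (\<lambda>x :: 'b. cost p (cd x))"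
    using assms(1) unfolding elementary_def by blast
  obtain q where q: "\<And>x. sem q (cd x) = cd (g x)" "elem_bounded (\<lambda>x :: 'a. cost q (cd x))"
    using assms(2) unfolding elementary_def by blast
  have "elem_bounded (\<lambda>x. cost q (cd x) + cost p (cd (g x)))"
    by (rule bnd_add[OF q(2) bnd_compose[OF p(2) bnd_elementary[OF assms(2)]]])
  then show ?thesis by (intro elementaryI[of "Comp p q"]) (simp_all add: p(1) q(1))
qed

lemma el_Pair:
  fixes f :: "'a::codable \<Rightarrow> 'b::codable" and g :: "'a::codable \<Rightarrow> 'c::codable"
  assumes "elementary f" "elementary g"
  shows "elementary (\<lambda>x. (f x, g x))"
proof -
  obtain p where p: "\<And>x. sem p (cd x) = cd (f x)" "elem_bounded (\<lambda>x :: 'a. cost p (cd x))"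
    using assms(1) unfolding elementary_def by blast
  obtain q where q: "\<And>x. sem q (cd x) = cd (g x)" "elem_bounded (\<lambda>x :: 'a. cost q (cd x))"
    using assms(2) unfolding elementary_def by blast
  have "elem_bounded (\<lambda>x :: 'a. cost (Fork p q) (cd x))"
    unfolding cost.simps p(1) q(1)
    by (intro bnd_add bnd_mult bnd_const bnd_id p(2) q(2) bnd_prod_encode bnd_elementary assms)
  then show ?thesis by (intro elementaryI[of "Fork p q"]) (simp_all add: p(1) q(1) cd_prod_def)
qed

lemma el_fst_base: "elementary (fst :: 'a::codable \<times> 'b::codable \<Rightarrow> 'a)"
  by (rule elementaryI[of Fst]) (simp add: cd_prod_def, simp only: cost.simps,
      intro bnd_add bnd_mult bnd_const bnd_id)

lemma el_snd_base: "elementary (snd :: 'a::codable \<times> 'b::codable \<Rightarrow> 'b)"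
  by (rule elementaryI[of Snd]) (simp add: cd_prod_def, simp only: cost.simps,
      intro bnd_add bnd_mult bnd_const bnd_id)

lemma el_fst: "elementary (f :: _ \<Rightarrow> 'b::codable \<times> 'c::codable) \<Longrightarrow> elementary (\<lambda>x. fst (f x))"
  by (rule el_compose[OF el_fst_base])

lemma el_snd: "elementary (f :: _ \<Rightarrow> 'b::codable \<times> 'c::codable) \<Longrightarrow> elementary (\<lambda>x. snd (f x))"
  by (rule el_compose[OF el_snd_base])

lemma el_Suc: "elementary f \<Longrightarrow> elementary (\<lambda>x. Suc (f x))"
proof (rule el_compose[of Suc])
  show "elementary Suc" by (rule elementaryI[of Succ]) (auto simp: cd_nat_def intro: bnd_const)
qed

lemma el_pred: "elementary f \<Longrightarrow> elementary (\<lambda>x. f x - (1 :: nat))"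
proof (rule el_compose[of "\<lambda>n. n - 1"])
  show "elementary (\<lambda>n :: nat. n - 1)"
    by (rule elementaryI[of Pred]) (auto simp: cd_nat_def intro: bnd_const)
qed

text \<open>Iteration as such leads beyond every fixed height of towers; it stays elementary if
  \<open>B\<close> bounds all intermediate values. \<open>Iter\<close> passes on a single number, so
  the parameter \<open>x\<close> travels along with the state.\<close>

lemma el_funpow:
  fixes F :: "'a::codable \<Rightarrow> 'b::codable \<Rightarrow> 'b"
  assumes n: "elementary n" and a: "elementary a" and F: "elementary (\<lambda>z. F (fst z) (snd z))"
    and B: "elem_bounded B" and le: "\<And>x i. i \<le> n x \<Longrightarrow> cd ((F x ^^ i) (a x)) \<le> B x"
  shows "elementary (\<lambda>x. (F x ^^ n x) (a x))"
proof -
  obtain p where p: "\<And>z. sem p (cd z) = cd (fst z, F (fst z) (snd z))"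
      "elem_bounded (\<lambda>z :: 'a \<times> 'b. cost p (cd z))"
    using el_Pair[OF el_fst_base F] unfolding elementary_def by blast
  obtain q where q: "\<And>x. sem q (cd x) = cd (n x, x, a x)" "elem_bounded (\<lambda>x :: 'a. cost q (cd x))"
    using el_Pair[OF n el_Pair[OF el_id a]] unfolding elementary_def by blast
  have iter: "(sem p ^^ i) (cd (x, y)) = cd (x, (F x ^^ i) y)" for i x y
    by (induction i) (simp_all add: p(1))
  obtain h where h: "\<And>z :: 'a \<times> 'b. cost p (cd z) \<le> tower h (cd z)"
    using p(2) unfolding elem_bounded_def by blast
  have cdle: "cd (x, (F x ^^ i) (a x)) \<le> (cd x + B x + 1) * (cd x + B x + 1)" if "i \<le> n x" for i x
  proof -
    have "cd (x, (F x ^^ i) (a x)) \<le> (cd x + cd ((F x ^^ i) (a x)) + 1) * (cd x + cd ((F x ^^ i) (a x)) + 1)"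
      unfolding cd_prod_def fst_conv snd_conv by (rule less_imp_le[OF prod_encode_less])
    also have "\<dots> \<le> (cd x + B x + 1) * (cd x + B x + 1)"
      using le[OF that] by (intro mult_le_mono) auto
    finally show ?thesis .
  qed
  \<comment> \<open>Bounds the cost of every round, from a bound on the code of the pair of
    parameter and state.\<close>
  define E where "E x = tower h ((cd x + B x + 1) * (cd x + B x + 1))" for x
  have E: "elem_bounded E"
  proof -
    obtain h' where "\<And>x. (cd x + B x + 1) * (cd x + B x + 1) \<le> tower h' (cd x)"
      using bnd_mult[OF bnd_add[OF bnd_add[OF bnd_id B] bnd_const] bnd_add[OF bnd_add[OF bnd_id B] bnd_const], of 1 1]
      unfolding elem_bounded_def by blast
    then have "E x \<le> tower (h + h') (cd x)" for x
      unfolding E_def tower_tower[symmetric] by (intro tower_mono)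
    then show ?thesis unfolding elem_bounded_def by blast
  qed
  have sem_iter: "sem (Iter p) (cd (n x, x, a x)) = cd (x, (F x ^^ n x) (a x))" for x
  proof -
    have "prod_decode (cd (n x, x, a x)) = (n x, cd (x, a x))"
      by (simp add: cd_prod_def cd_nat_def)
    then show ?thesis by (simp add: iter)
  qed
  show ?thesis
  proof (rule elementaryI[of "Comp Snd (Comp (Iter p) q)"])
    fix x show "sem (Comp Snd (Comp (Iter p) q)) (cd x) = cd ((F x ^^ n x) (a x))"
      unfolding sem.simps(8) q(1) sem_iter by (simp add: cd_prod_def)
  next
    let ?z = "\<lambda>x. cd (n x, x, a x)" and ?y = "\<lambda>x. (cd x + B x + 1) * (cd x + B x + 1)"
    have z: "elem_bounded ?z" by (rule bnd_elementary[OF el_Pair[OF n el_Pair[OF el_id a]]])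
    have "elem_bounded (\<lambda>x. cost q (cd x) + (quad (?z x) + (n x * (E x + 3) + 1 + (4 * ?y x + 1))) +
        (quad (?y x) + ((3 * ?y x + 1) + (4 * ?y x + 1))))"
      by (intro bnd_add bnd_mult bnd_const bnd_id q(2) z E B bnd_nat n)
    then show "elem_bounded (\<lambda>x :: 'a. cost (Comp Snd (Comp (Iter p) q)) (cd x))"
    proof (rule bnd_le)
      fix x
      have dec: "prod_decode (?z x) = (n x, cd (x, a x))" by (simp add: cd_prod_def cd_nat_def)
      have "(\<Sum>j<n x. cost p ((sem p ^^ j) (cd (x, a x))) + 3) \<le> (\<Sum>j<n x. E x + 3)"
      proof (intro sum_mono add_mono order.refl)
        fix j assume "j \<in> {..<n x}"
        then show "cost p ((sem p ^^ j) (cd (x, a x))) \<le> E x"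
          unfolding iter E_def by (intro order.trans[OF h] tower_mono cdle) simp
      qed
      then have "cost (Iter p) (?z x) \<le> quad (?z x) + (n x * (E x + 3) + 1 + (4 * ?y x + 1))"
        using cdle[of "n x" x] unfolding cost.simps dec fst_conv snd_conv iter by simp
      moreover have "cost Snd (cd (x, (F x ^^ n x) (a x))) \<le> quad (?y x) + ((3 * ?y x + 1) + (4 * ?y x + 1))"
        unfolding cost.simps using cdle[of "n x" x] by (intro add_mono mult_le_mono) simp_all
      ultimately show "cost (Comp Snd (Comp (Iter p) q)) (cd x) \<le>
          cost q (cd x) + (quad (?z x) + (n x * (E x + 3) + 1 + (4 * ?y x + 1))) +
          (quad (?y x) + ((3 * ?y x + 1) + (4 * ?y x + 1)))"
        unfolding cost.simps(8) sem.simps(8) q(1) sem_iter by linarith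
    qed
  qed
qed

lemma el_of_bool: "elementary P \<Longrightarrow> elementary (\<lambda>x. if P x then 1 else 0 :: nat)"
  by (rule elementary_recode[of P]) (simp_all add: cd_nat_def cd_bool_def)

lemma el_cd: "elementary f \<Longrightarrow> elementary (\<lambda>x. cd (f x))"
  by (rule elementary_recode[of f]) (simp_all add: cd_nat_def)

text \<open>A conditional is an iteration of the constant function with value \<open>f x\<close>,
  performed once or not at all.\<close>

lemma el_if:
  assumes P: "elementary P" and f: "elementary f" and g: "elementary g"
  shows "elementary (\<lambda>x. if P x then f x else g x)"
proof -
  have "elementary (\<lambda>x. ((\<lambda>_. f x) ^^ (if P x then 1 else 0)) (g x))"
  proof (rule el_funpow[OF el_of_bool[OF P] g])
    show "elementary (\<lambda>z. f (fst z))" by (rule el_compose[OF f el_fst_base])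
    show "elem_bounded (\<lambda>x. cd (f x) + cd (g x))" by (intro bnd_add bnd_elementary f g)
    show "cd (((\<lambda>_. f x) ^^ i) (g x)) \<le> cd (f x) + cd (g x)" for x i by (cases i) auto
  qed
  then show ?thesis by (rule elementary_recode) simp
qed

lemma el_Not: "elementary P \<Longrightarrow> elementary (\<lambda>x. \<not> P x)"
  by (rule elementary_recode[OF el_if[of P "\<lambda>_. False" "\<lambda>_. True"]]) (simp_all add: el_const)

lemma el_conj: "elementary P \<Longrightarrow> elementary Q \<Longrightarrow> elementary (\<lambda>x. P x \<and> Q x)"
  by (rule elementary_recode[OF el_if[of P Q "\<lambda>_. False"]]) (simp_all add: el_const)

lemma el_disj: "elementary P \<Longrightarrow> elementary Q \<Longrightarrow> elementary (\<lambda>x. P x \<or> Q x)"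
  by (rule elementary_recode[OF el_if[of P "\<lambda>_. True" Q]]) (simp_all add: el_const)

lemma el_imp: "elementary P \<Longrightarrow> elementary Q \<Longrightarrow> elementary (\<lambda>x. P x \<longrightarrow> Q x)"
  by (rule elementary_recode[OF el_if[of P Q "\<lambda>_. True"]]) (simp_all add: el_const)

lemma el_iff: "elementary P \<Longrightarrow> elementary Q \<Longrightarrow> elementary (\<lambda>x. P x = (Q x :: bool))"
  by (rule elementary_recode[OF el_if[of P Q "\<lambda>x. \<not> Q x"]]) (simp_all add: el_Not)

lemma el_is_zero: "elementary f \<Longrightarrow> elementary (\<lambda>x. f x = (0 :: nat))"
proof -
  assume f: "elementary f"
  have "elementary (\<lambda>x. ((\<lambda>_. False) ^^ f x) True)"
  proof (rule el_funpow[OF f el_const el_const bnd_const[of 1]])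
    show "cd (((\<lambda>_. False) ^^ i) True) \<le> 1" for i :: nat by (simp add: cd_bool_def)
  qed
  moreover have "((\<lambda>_. False) ^^ n) True = (n = 0)" for n :: nat by (cases n) auto
  ultimately show ?thesis by simp
qed

lemma el_add: "elementary f \<Longrightarrow> elementary g \<Longrightarrow> elementary (\<lambda>x. f x + g x :: nat)"
proof -
  assume f: "elementary f" and g: "elementary g"
  have it: "(Suc ^^ i) m = i + m" for i m by (induction i) auto
  have "elementary (\<lambda>x. (Suc ^^ f x) (g x))"
    by (rule el_funpow[OF f g el_Suc[OF el_snd_base] bnd_add[OF bnd_nat[OF f] bnd_nat[OF g]]])
      (simp add: it cd_nat_def)
  then show ?thesis by (simp add: it)
qed

lemma el_diff: "elementary f \<Longrightarrow> elementary g \<Longrightarrow> elementary (\<lambda>x. f x - g x :: nat)"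
proof -
  assume f: "elementary f" and g: "elementary g"
  have it: "((\<lambda>n. n - 1) ^^ i) m = m - i" for i m :: nat by (induction i) auto
  then have "((\<lambda>n. n - 1) ^^ i) m \<le> m" for i m :: nat by simp
  note le = this
  have "elementary (\<lambda>x. ((\<lambda>n. n - 1) ^^ g x) (f x))"
    by (rule el_funpow[OF g f el_pred[OF el_snd_base] bnd_nat[OF f]]) (simp only: le cd_nat_def)
  then show ?thesis by (simp only: it)
qed

lemma el_mult: "elementary f \<Longrightarrow> elementary g \<Longrightarrow> elementary (\<lambda>x. f x * g x :: nat)"
proof -
  assume f: "elementary f" and g: "elementary g"
  have it: "((+) n ^^ i) 0 = i * n" for i n :: nat by (induction i) auto
  have "elementary (\<lambda>x. ((+) (g x) ^^ f x) 0)"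
  proof (rule el_funpow[OF f el_const])
    show "elementary (\<lambda>z. g (fst z) + snd z)"
      by (intro el_add el_compose[OF g] el_fst_base el_snd_base)
    show "elem_bounded (\<lambda>x. f x * g x)" by (intro bnd_mult bnd_nat f g)
  qed (simp add: it cd_nat_def)
  then show ?thesis by (simp add: it)
qed

lemma el_le: "elementary f \<Longrightarrow> elementary g \<Longrightarrow> elementary (\<lambda>x. f x \<le> (g x :: nat))"
  by (rule elementary_recode[OF el_is_zero[OF el_diff[of f g]]]) simp_all

lemma el_less: "elementary f \<Longrightarrow> elementary g \<Longrightarrow> elementary (\<lambda>x. f x < (g x :: nat))"
  by (rule elementary_recode[OF el_le[OF el_Suc[of f] , of g]]) (simp_all add: Suc_le_eq)

lemma el_eq:
  assumes "elementary f" "elementary g"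
  shows "elementary (\<lambda>x. f x = g x)"
proof (rule elementary_recode)
  show "elementary (\<lambda>x. cd (f x) \<le> cd (g x) \<and> cd (g x) \<le> cd (f x))"
    by (intro el_conj el_le el_cd assms)
  have "(f x = g x) = (cd (f x) \<le> cd (g x) \<and> cd (g x) \<le> cd (f x))" for x
    using cd_eq_iff[of "f x" "g x"] by auto
  then show "cd (f x = g x) = cd (cd (f x) \<le> cd (g x) \<and> cd (g x) \<le> cd (f x))" for x by (simp only:)
qed

section \<open>List functions, obtained by bounded iteration\<close>

lemma cd_Nil: "cd [] = 0"
  and cd_Cons: "cd (x # xs) = Suc (prod_encode (cd x, cd xs))"
  by (simp_all add: cd_list_def)

lemma length_le_cd: "length xs \<le> cd xs"
proof (induction xs)
  case (Cons x xs)
  then show ?case using le_prod_encode(2)[of "cd xs" "cd x"] by (simp add: cd_Cons)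
qed simp

lemma member_le_cd: "x \<in> set xs \<Longrightarrow> cd x \<le> cd xs"
proof (induction xs)
  case (Cons y ys)
  then show ?case
    using le_prod_encode(1)[of "cd y" "cd ys"] le_prod_encode(2)[of "cd ys" "cd y"] by (auto simp: cd_Cons)
qed simp

text \<open>Pairing at most squares, up to lower terms, so each further entry at most raises the
  bound to its fourth power; the summand 2 makes the base large enough to absorb those
  terms.\<close>

lemma cd_list_le:
  assumes "length xs \<le> L" "\<And>x. x \<in> set xs \<Longrightarrow> cd x \<le> B"
  shows "cd xs \<le> (B + 2) ^ (4 ^ L)"
proof -
  have "cd xs + B + 2 \<le> (B + 2) ^ (4 ^ length xs)" if "\<And>x. x \<in> set xs \<Longrightarrow> cd x \<le> B" for xs :: "'a list"
    using that
  proof (induction xs)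
    case Nil
    then show ?case by (simp add: cd_Nil)
  next
    case (Cons x xs)
    define e where "e = cd xs + B + 2"
    have e2: "2 \<le> e" by (simp add: e_def)
    have "prod_encode (cd x, cd xs) < (cd x + cd xs + 1) * (cd x + cd xs + 1)" by (rule prod_encode_less)
    also have "\<dots> \<le> e * e" using Cons.prems[of x] by (intro mult_le_mono) (simp_all add: e_def)
    finally have "cd (x # xs) + B + 2 \<le> e * e + e" by (simp add: cd_Cons e_def)
    also have "\<dots> \<le> e * e + e * e" by simp
    also have "\<dots> \<le> (e * e) * (e * e)"
    proof -
      have "2 \<le> e * e" using mult_le_mono[of 2 e 1 e] e2 by simp
      from mult_le_mono1[OF this, of "e * e"] show ?thesis by (simp only: mult_2)
    qed
    also have "\<dots> = e ^ 4" by (simp add: eval_nat_numeral)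
    also have "\<dots> \<le> ((B + 2) ^ (4 ^ length xs)) ^ 4"
      unfolding e_def using Cons by (intro power_mono) auto
    also have "\<dots> = (B + 2) ^ (4 ^ length (x # xs))" by (simp add: power_mult[symmetric] mult.commute)
    finally show ?case .
  qed
  from this[of xs] assms(2) have "cd xs \<le> (B + 2) ^ (4 ^ length xs)" by fastforce
  also have "\<dots> \<le> (B + 2) ^ (4 ^ L)" using assms(1) by (intro power_increasing) auto
  finally show ?thesis .
qed

lemma bnd_list:
  assumes "elem_bounded B" "elem_bounded L"
  shows "elem_bounded (\<lambda>x. (B x + 2) ^ (4 ^ L x))"
  by (intro bnd_power bnd_add bnd_const assms)

lemma el_Cons: "elementary f \<Longrightarrow> elementary g \<Longrightarrow> elementary (\<lambda>x. f x # g x)"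
  by (rule elementary_recode[OF el_Suc[OF el_cd[OF el_Pair[of f g]]]])
    (simp_all add: cd_Cons cd_nat_def cd_prod_def)

lemma el_is_Nil: "elementary f \<Longrightarrow> elementary (\<lambda>x. f x = [])"
  by (rule el_eq[OF _ el_const])

lemma elementary_nat:
  assumes "\<And>x. sem p x = f x" "elem_bounded (\<lambda>x :: nat. cost p (cd x))"
  shows "elementary (f :: nat \<Rightarrow> nat)"
  using assms by (intro elementaryI[of p]) (simp_all add: cd_nat_def)

lemma el_fst_decode: "elementary f \<Longrightarrow> elementary (\<lambda>x. fst (prod_decode (f x)))"
  by (rule el_compose[of "\<lambda>n. fst (prod_decode n)"], rule elementary_nat[of Fst], simp,
      simp only: cost.simps, intro bnd_add bnd_mult bnd_const bnd_id)

lemma el_snd_decode: "elementary f \<Longrightarrow> elementary (\<lambda>x. snd (prod_decode (f x)))"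
  by (rule el_compose[of "\<lambda>n. snd (prod_decode n)"], rule elementary_nat[of Snd], simp,
      simp only: cost.simps, intro bnd_add bnd_mult bnd_const bnd_id)

text \<open>The unspecified value \<open>hd []\<close> is a constant, so its code can be supplied.\<close>

lemma el_hd:
  fixes f :: "'a::codable \<Rightarrow> 'b::codable list"
  assumes "elementary f"
  shows "elementary (\<lambda>x. hd (f x))"
proof (rule elementary_recode)
  show "elementary (\<lambda>x. if f x = [] then cd (hd [] :: 'b) else fst (prod_decode (cd (f x) - 1)))"
    by (intro el_if el_is_Nil el_const el_fst_decode el_pred el_cd assms)
  show "cd (hd (f x)) = cd (if f x = [] then cd (hd [] :: 'b) else fst (prod_decode (cd (f x) - 1)))" for x
    by (cases "f x") (simp_all add: cd_Cons cd_nat_def)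
qed

lemma el_tl:
  assumes "elementary f"
  shows "elementary (\<lambda>x. tl (f x))"
proof (rule elementary_recode)
  show "elementary (\<lambda>x. if f x = [] then 0 else snd (prod_decode (cd (f x) - 1)))"
    by (intro el_if el_is_Nil el_const el_snd_decode el_pred el_cd assms)
  show "cd (tl (f x)) = cd (if f x = [] then 0 else snd (prod_decode (cd (f x) - 1)))" for x
    by (cases "f x") (simp_all add: cd_Cons cd_nat_def cd_Nil)
qed

lemma cd_drop_le: "cd (drop k xs) \<le> cd xs"
proof (induction xs arbitrary: k)
  case (Cons x xs)
  show ?case
  proof (cases k)
    case (Suc k')
    have "cd (drop k' xs) \<le> cd xs" by (rule Cons.IH)
    also have "\<dots> \<le> cd (x # xs)" using le_prod_encode(2)[of "cd xs" "cd x"] by (simp add: cd_Cons)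
    finally show ?thesis by (simp add: Suc)
  qed simp
qed simp

text \<open>The state is the accumulator with the rest of the list. \<open>cd (l x)\<close> rounds
  are at least as many as the length, which is not yet known to be elementary; a round with empty
  rest changes nothing.\<close>

lemma el_foldl:
  fixes F :: "'a::codable \<Rightarrow> 'b::codable \<Rightarrow> 'c::codable \<Rightarrow> 'b"
  assumes F: "elementary (\<lambda>z. F (fst z) (fst (snd z)) (snd (snd z)))"
    and a: "elementary a" and l: "elementary l"
    and B: "elem_bounded B" "\<And>x k. cd (foldl (F x) (a x) (take k (l x))) \<le> B x"
  shows "elementary (\<lambda>x. foldl (F x) (a x) (l x))"
proof -
  define G where "G x s = (if snd s = [] then s else (F x (fst s) (hd (snd s)), tl (snd s)))" for x s
  have iter: "(G x ^^ k) (b, xs) = (foldl (F x) b (take k xs), drop k xs)" for x k b xs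
  proof (induction k)
    case (Suc k)
    show ?case
    proof (cases "k < length xs")
      case True
      then have "take (Suc k) xs = take k xs @ [hd (drop k xs)]" "tl (drop k xs) = drop (Suc k) xs"
        by (simp_all add: take_Suc_conv_app_nth hd_drop_conv_nth drop_Suc tl_drop)
      then show ?thesis using Suc True by (simp add: G_def)
    qed (use Suc in \<open>simp add: G_def\<close>)
  qed simp
  have FF: "elementary (\<lambda>z :: 'a \<times> 'b \<times> 'c list. F (fst z) (fst (snd z)) (hd (snd (snd z))))"
    using el_compose[OF F, of "\<lambda>z. (fst z, fst (snd z), hd (snd (snd z)))"]
      el_Pair[OF el_fst_base el_Pair[OF el_fst[OF el_snd_base] el_hd[OF el_snd[OF el_snd_base]]]] by simp
  have "elementary (\<lambda>x. (G x ^^ cd (l x)) (a x, l x))"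
  proof (rule el_funpow[OF el_cd[OF l] el_Pair[OF a l]])
    show "elementary (\<lambda>z. G (fst z) (snd z))"
      unfolding G_def
      by (intro el_if el_is_Nil el_Pair FF el_tl el_snd_base el_snd[OF el_snd_base])
    show "elem_bounded (\<lambda>x. (B x + cd (l x) + 1) * (B x + cd (l x) + 1))"
      by (intro bnd_mult bnd_add bnd_const B(1) bnd_elementary l)
    fix x i
    have "cd ((G x ^^ i) (a x, l x)) \<le> (cd (foldl (F x) (a x) (take i (l x))) + cd (drop i (l x)) + 1) *
        (cd (foldl (F x) (a x) (take i (l x))) + cd (drop i (l x)) + 1)"
      unfolding iter cd_prod_def fst_conv snd_conv by (rule less_imp_le[OF prod_encode_less])
    also have "\<dots> \<le> (B x + cd (l x) + 1) * (B x + cd (l x) + 1)"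
      using B(2)[of x i] cd_drop_le[of i "l x"] by (intro mult_le_mono) simp_all
    finally show "cd ((G x ^^ i) (a x, l x)) \<le> (B x + cd (l x) + 1) * (B x + cd (l x) + 1)" .
  qed
  then have "elementary (\<lambda>x. fst ((G x ^^ cd (l x)) (a x, l x)))" by (rule el_fst)
  then show ?thesis by (simp add: iter length_le_cd)
qed

lemma el_foldl_list:
  fixes F :: "'a::codable \<Rightarrow> 'b::codable list \<Rightarrow> 'c::codable \<Rightarrow> 'b list"
  assumes "elementary (\<lambda>z. F (fst z) (fst (snd z)) (snd (snd z)))" "elementary a" "elementary l"
    and "elem_bounded L" "\<And>x k. length (foldl (F x) (a x) (take k (l x))) \<le> L x"
    and "elem_bounded B" "\<And>x k y. y \<in> set (foldl (F x) (a x) (take k (l x))) \<Longrightarrow> cd y \<le> B x"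
  shows "elementary (\<lambda>x. foldl (F x) (a x) (l x))"
  by (rule el_foldl[OF assms(1-3) bnd_list[OF assms(6,4)]]) (rule cd_list_le[OF assms(5,7)])

lemma rev_conv_foldl: "foldl (\<lambda>acc y. f y # acc) a xs = rev (map f xs) @ a"
  by (induction xs arbitrary: a) auto

text \<open>A left fold that pushes its results reverses them. With the identity for
  \<open>F\<close> this gives \<open>rev\<close>, and a second reversal gives
  \<open>map\<close>.\<close>

lemma el_rev_map:
  fixes F :: "'a::codable \<Rightarrow> 'b::codable \<Rightarrow> 'c::codable"
  assumes F: "elementary (\<lambda>z. F (fst z) (snd z))" and l: "elementary l"
  shows "elementary (\<lambda>x. rev (map (F x) (l x)))"
proof -
  obtain h where h: "\<And>z. cd (F (fst z) (snd z)) \<le> tower h (cd z)"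
    using bnd_elementary[OF F] unfolding elem_bounded_def by blast
  have hF: "cd (F x y) \<le> tower h (prod_encode (cd x, cd (l x)))" if "y \<in> set (l x)" for x y
  proof -
    have "cd (F x y) \<le> tower h (cd (x, y))" using h[of "(x, y)"] by simp
    also have "\<dots> \<le> tower h (prod_encode (cd x, cd (l x)))"
    proof (rule tower_mono)
      have "cd y \<le> cd (l x)" using that by (rule member_le_cd)
      then show "cd (x, y) \<le> prod_encode (cd x, cd (l x))"
        using triangle_mono[of "cd x + cd y" "cd x + cd (l x)"] by (simp add: cd_prod_def prod_encode_def)
    qed
    finally show ?thesis .
  qed
  have "elem_bounded (\<lambda>x. prod_encode (cd x, cd (l x)))"
    by (intro bnd_prod_encode bnd_id bnd_elementary l)
  then obtain h' where "\<And>x. prod_encode (cd x, cd (l x)) \<le> tower h' (cd x)"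
    unfolding elem_bounded_def by blast
  then have B: "elem_bounded (\<lambda>x. tower h (prod_encode (cd x, cd (l x))))"
    unfolding elem_bounded_def
    by (intro exI[of _ "h + h'"]) (simp add: tower_mono flip: tower_tower)
  have "elementary (\<lambda>x. foldl (\<lambda>acc y. F x y # acc) [] (l x))"
  proof (rule el_foldl_list[OF _ el_const l bnd_elementary[OF l] _ B])
    have "elementary (\<lambda>z :: 'a \<times> 'c list \<times> 'b. F (fst z) (snd (snd z)))"
      using el_compose[OF F el_Pair[OF el_fst_base el_snd[OF el_snd_base]]] by simp
    then show "elementary (\<lambda>z :: 'a \<times> 'c list \<times> 'b. F (fst z) (snd (snd z)) # fst (snd z))"
      by (intro el_Cons el_fst el_snd_base)
    show "length (foldl (\<lambda>acc y. F x y # acc) [] (take k (l x))) \<le> cd (l x)" for x k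
      using length_le_cd[of "l x"] by (simp add: rev_conv_foldl)
    show "cd y \<le> tower h (prod_encode (cd x, cd (l x)))"
      if "y \<in> set (foldl (\<lambda>acc y. F x y # acc) [] (take k (l x)))" for x k y
      using that hF by (auto simp: rev_conv_foldl dest: in_set_takeD)
  qed
  then show ?thesis by (simp add: rev_conv_foldl)
qed

lemma el_rev: "elementary f \<Longrightarrow> elementary (\<lambda>x. rev (f x))"
  using el_rev_map[of "\<lambda>_ y. y", OF el_snd_base] by simp

lemma el_map:
  fixes F :: "'a::codable \<Rightarrow> 'b::codable \<Rightarrow> 'c::codable"
  shows "elementary l \<Longrightarrow> elementary (\<lambda>z. F (fst z) (snd z)) \<Longrightarrow> elementary (\<lambda>x. map (F x) (l x))"
  using el_rev[OF el_rev_map[of F l]] by simp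

lemma el_append:
  fixes f g :: "'a::codable \<Rightarrow> 'b::codable list"
  assumes f: "elementary f" and g: "elementary g"
  shows "elementary (\<lambda>x. f x @ g x)"
proof -
  have "elementary (\<lambda>x. foldl (\<lambda>acc y. y # acc) (g x) (rev (f x)))"
  proof (rule el_foldl_list[OF _ g el_rev[OF f], where L = "\<lambda>x. cd (f x) + cd (g x)" and B = "\<lambda>x. cd (f x) + cd (g x)"])
    show "elementary (\<lambda>z :: 'a \<times> 'b list \<times> 'b. snd (snd z) # fst (snd z))"
      by (intro el_Cons el_fst el_snd el_snd_base)
    show "length (foldl (\<lambda>acc y. y # acc) (g x) (take k (rev (f x)))) \<le> cd (f x) + cd (g x)" for x k
      using length_le_cd[of "f x"] length_le_cd[of "g x"] by (simp add: rev_conv_foldl[of "\<lambda>y. y"])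
    show "cd y \<le> cd (f x) + cd (g x)" if "y \<in> set (foldl (\<lambda>acc y. y # acc) (g x) (take k (rev (f x))))" for x k y
    proof -
      have "y \<in> set (f x) \<or> y \<in> set (g x)"
        using that by (auto simp: rev_conv_foldl[of "\<lambda>y. y"] dest: in_set_takeD)
      then show ?thesis using member_le_cd[of y "f x"] member_le_cd[of y "g x"] by auto
    qed
  qed (intro bnd_add bnd_elementary f g)+
  then show ?thesis by (simp add: rev_conv_foldl[of "\<lambda>y. y"])
qed

lemma foldl_append_concat: "foldl (\<lambda>acc y. acc @ y) a xs = a @ concat xs"
  by (induction xs arbitrary: a) auto

lemma length_concat_le: "(\<And>x. x \<in> set xs \<Longrightarrow> length x \<le> B) \<Longrightarrow> length (concat xs) \<le> length xs * B"
  by (induction xs) (auto intro: add_mono)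

lemma el_concat:
  fixes f :: "'a::codable \<Rightarrow> 'b::codable list list"
  assumes f: "elementary f"
  shows "elementary (\<lambda>x. concat (f x))"
proof -
  have len: "length y \<le> cd (f x)" if "y \<in> set (f x)" for x y
    using member_le_cd[OF that] length_le_cd[of y] by simp
  have "elementary (\<lambda>x. foldl (\<lambda>acc y. acc @ y) [] (f x))"
  proof (rule el_foldl_list[OF _ el_const f, where L = "\<lambda>x. cd (f x) * cd (f x)" and B = "\<lambda>x. cd (f x)"])
    show "elementary (\<lambda>z :: 'a \<times> 'b list \<times> 'b list. fst (snd z) @ snd (snd z))"
      by (intro el_append el_fst el_snd el_snd_base)
    show "length (foldl (\<lambda>acc y. acc @ y) [] (take k (f x))) \<le> cd (f x) * cd (f x)" for x k
    proof -
      have "length (concat (take k (f x))) \<le> length (take k (f x)) * cd (f x)"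
        using len by (intro length_concat_le) (auto dest: in_set_takeD)
      also have "\<dots> \<le> cd (f x) * cd (f x)" using length_le_cd[of "f x"] by (intro mult_le_mono1) simp
      finally show ?thesis by (simp add: foldl_append_concat)
    qed
    show "cd y \<le> cd (f x)" if y: "y \<in> set (foldl (\<lambda>acc y. acc @ y) [] (take k (f x)))" for x k y
    proof -
      obtain ys where "ys \<in> set (f x)" "y \<in> set ys"
        using y by (auto simp: foldl_append_concat dest: in_set_takeD)
      then show ?thesis using member_le_cd[of y ys] member_le_cd[of ys "f x"] by simp
    qed
  qed (intro bnd_mult bnd_elementary f)+
  then show ?thesis by (simp add: foldl_append_concat)
qed

lemma el_filter:
  fixes P :: "'a::codable \<Rightarrow> 'b::codable \<Rightarrow> bool"
  assumes "elementary l" "elementary (\<lambda>z. P (fst z) (snd z))"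
  shows "elementary (\<lambda>x. filter (P x) (l x))"
proof -
  have "filter Q xs = concat (map (\<lambda>y. if Q y then [y] else []) xs)" for Q and xs :: "'b list"
    by (induction xs) auto
  then show ?thesis
    using assms by (simp only:) (intro el_concat el_map el_if el_Cons el_const el_snd_base)
qed

lemma el_Bex:
  fixes P :: "'a::codable \<Rightarrow> 'b::codable \<Rightarrow> bool"
  assumes "elementary l" "elementary (\<lambda>z. P (fst z) (snd z))"
  shows "elementary (\<lambda>x. \<exists>y \<in> set (l x). P x y)"
  by (rule elementary_recode[OF el_Not[OF el_is_Nil[OF el_filter[OF assms]]]])
    (auto simp: filter_empty_conv)

lemma el_Ball:
  fixes P :: "'a::codable \<Rightarrow> 'b::codable \<Rightarrow> bool"
  assumes "elementary l" "elementary (\<lambda>z. P (fst z) (snd z))"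
  shows "elementary (\<lambda>x. \<forall>y \<in> set (l x). P x y)"
  by (rule elementary_recode[OF el_Not[OF el_Bex[OF assms(1) el_Not[OF assms(2)]]]]) simp

lemma el_member:
  assumes "elementary f" "elementary l"
  shows "elementary (\<lambda>x. f x \<in> set (l x))"
proof -
  have "elementary (\<lambda>x. \<exists>y \<in> set (l x). f x = y)"
    by (intro el_Bex el_eq assms(2) el_compose[OF assms(1)] el_fst_base el_snd_base)
  then show ?thesis by (rule elementary_recode) simp
qed

lemma el_length: "elementary f \<Longrightarrow> elementary (\<lambda>x. length (f x))"
proof -
  assume f: "elementary f"
  have len: "foldl (\<lambda>n _. Suc n) a xs = a + length xs" for a and xs :: "'b list"
    by (induction xs arbitrary: a) auto
  have "elementary (\<lambda>x. foldl (\<lambda>n _. Suc n) 0 (f x))"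
  proof (rule el_foldl[OF _ el_const f bnd_elementary[OF f]])
    show "cd (foldl (\<lambda>n _. Suc n) 0 (take k (f x))) \<le> cd (f x)" for x k
      using length_le_cd[of "f x"] by (simp add: len cd_nat_def)
  qed (intro el_Suc el_fst el_snd_base)
  then show ?thesis by (simp add: len)
qed

lemma el_upt: "elementary f \<Longrightarrow> elementary (\<lambda>x. [0..<f x])"
proof -
  assume f: "elementary f"
  have it: "((\<lambda>l. l @ [length l]) ^^ n) [] = [0..<n]" for n by (induction n) auto
  have "elementary (\<lambda>x. ((\<lambda>l. l @ [length l]) ^^ f x) [])"
  proof (rule el_funpow[OF f el_const])
    show "elementary (\<lambda>z :: _ \<times> nat list. snd z @ [length (snd z)])"
      by (intro el_append el_Cons el_length el_snd_base el_const)
    show "elem_bounded (\<lambda>x. (f x + 2) ^ (4 ^ f x))" by (intro bnd_list bnd_nat f)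
    show "cd (((\<lambda>l. l @ [length l]) ^^ i) []) \<le> (f x + 2) ^ (4 ^ f x)" if "i \<le> f x" for x i
      unfolding it using that by (intro cd_list_le) (auto simp: cd_nat_def)
  qed
  then show ?thesis by (simp add: it)
qed

lemma el_drop:
  assumes n: "elementary n" and f: "elementary (f :: 'a::codable \<Rightarrow> 'b::codable list)"
  shows "elementary (\<lambda>x. drop (n x) (f x))"
proof -
  have it: "(tl ^^ k) xs = drop k xs" for k and xs :: "'b list"
    by (induction k) (simp_all add: drop_Suc tl_drop)
  have "elementary (\<lambda>x. (tl ^^ n x) (f x))"
    by (rule el_funpow[OF n f el_tl[OF el_snd_base] bnd_elementary[OF f]]) (simp only: it cd_drop_le)
  then show ?thesis by (simp add: it)
qed

lemma el_nth_default:
  assumes "elementary l" "elementary i"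
  shows "elementary (\<lambda>x. nth_default d (l x) (i x))"
proof (rule elementary_recode)
  show "elementary (\<lambda>x. if i x < length (l x) then hd (drop (i x) (l x)) else d)"
    by (intro el_if el_less el_length el_hd el_drop el_const assms)
qed (simp add: nth_default_def hd_drop_conv_nth)

lemma el_n_lists:
  fixes l :: "'a::codable \<Rightarrow> 'b::codable list"
  assumes n: "elementary n" and l: "elementary l"
  shows "elementary (\<lambda>x. List.n_lists (n x) (l x))"
proof -
  define F where "F x acc = concat (map (\<lambda>ys. map (\<lambda>y. y # ys) (l x)) acc)" for x acc
  have it: "(F x ^^ k) [[]] = List.n_lists k (l x)" for x k
    by (induction k) (simp_all add: F_def)
  let ?B = "\<lambda>x. (cd (l x) + 2) ^ (4 ^ n x)"
  have B: "elem_bounded ?B" by (intro bnd_list bnd_nat bnd_elementary n l)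
  have "elementary (\<lambda>x. (F x ^^ n x) [[]])"
  proof (rule el_funpow[OF n el_const])
    show "elementary (\<lambda>z. F (fst z) (snd z))"
      unfolding F_def
      by (intro el_concat el_map el_Cons el_compose[OF l] el_fst el_snd el_fst_base el_snd_base)
    \<comment> \<open>At most \<open>(cd (l x) + 1) ^ n x\<close> lists occur at any stage, each
      with a code of at most \<open>?B x\<close>.\<close>
    show "elem_bounded (\<lambda>x. (?B x + 2) ^ (4 ^ ((cd (l x) + 1) ^ n x)))"
      by (intro bnd_list B bnd_power bnd_add bnd_const bnd_elementary bnd_nat n l)
    fix x k assume k: "k \<le> n x"
    show "cd ((F x ^^ k) [[]]) \<le> (?B x + 2) ^ (4 ^ ((cd (l x) + 1) ^ n x))"
      unfolding it
    proof (rule cd_list_le)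
      have "length (l x) ^ k \<le> (cd (l x) + 1) ^ k" using length_le_cd[of "l x"] by (intro power_mono) simp_all
      also have "\<dots> \<le> (cd (l x) + 1) ^ n x" using k by (intro power_increasing) simp_all
      finally show "length (List.n_lists k (l x)) \<le> (cd (l x) + 1) ^ n x" by (simp add: length_n_lists)
      fix ys assume "ys \<in> set (List.n_lists k (l x))"
      then show "cd ys \<le> ?B x"
        using k member_le_cd[of _ "l x"] by (intro cd_list_le) (auto simp: set_n_lists)
    qed
  qed
  then show ?thesis by (simp add: it)
qed

text \<open>Turns the recursion on the tail into a loop that consumes the list from its end.\<close>

lemma subseqs_foldl: "subseqs (rev xs) = foldl (\<lambda>acc y. map (Cons y) acc @ acc) [[]] xs"
  by (induction xs rule: rev_induct) (simp_all add: Let_def)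

lemma subseqs_member: "ys \<in> set (subseqs xs) \<Longrightarrow> length ys \<le> length xs \<and> set ys \<subseteq> set xs"
proof (induction xs arbitrary: ys)
  case (Cons x xs)
  then show ?case by (fastforce simp: Let_def)
qed simp

lemma el_subseqs:
  fixes l :: "'a::codable \<Rightarrow> 'b::codable list"
  assumes l: "elementary l"
  shows "elementary (\<lambda>x. subseqs (l x))"
proof -
  let ?B = "\<lambda>x. (cd (l x) + 2) ^ (4 ^ cd (l x))"
  have "elementary (\<lambda>x. foldl (\<lambda>acc y. map (Cons y) acc @ acc) [[]] (rev (l x)))"
  proof (rule el_foldl_list[OF _ el_const el_rev[OF l], where L = "\<lambda>x. 2 ^ cd (l x)" and B = ?B])
    show "elementary (\<lambda>z :: 'a \<times> 'b list list \<times> 'b. map (Cons (snd (snd z))) (fst (snd z)) @ fst (snd z))"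
      by (intro el_append el_map el_Cons el_fst el_snd el_snd_base el_fst_base)
    fix x k
    have fold: "foldl (\<lambda>acc y. map (Cons y) acc @ acc) [[]] (take k (rev (l x))) = subseqs (rev (take k (rev (l x))))"
      by (simp add: subseqs_foldl)
    have "length (take k (rev (l x))) \<le> cd (l x)" using length_le_cd[of "l x"] by simp
    then show "length (foldl (\<lambda>acc y. map (Cons y) acc @ acc) [[]] (take k (rev (l x)))) \<le> 2 ^ cd (l x)"
      unfolding fold length_subseqs by (intro power_increasing) simp_all
    fix y assume "y \<in> set (foldl (\<lambda>acc y. map (Cons y) acc @ acc) [[]] (take k (rev (l x))))"
    then have "length y \<le> length (rev (take k (rev (l x))))" "set y \<subseteq> set (rev (take k (rev (l x))))"
      unfolding fold using subseqs_member by blast+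
    then show "cd y \<le> ?B x"
      using length_le_cd[of "l x"] member_le_cd[of _ "l x"]
      by (intro cd_list_le) (auto dest!: subsetD in_set_takeD)
  qed (intro bnd_list bnd_exp bnd_elementary l)+
  then show ?thesis by (simp flip: subseqs_foldl)
qed

section \<open>Elementarity of the decision procedure, the encoding and the decoding\<close>

section \<open>The rewriting algorithm is elementary\<close>

lemma el_Atom: "elementary p \<Longrightarrow> elementary as \<Longrightarrow> elementary (\<lambda>x. Atom (p x) (as x))"
  by (rule elementary_recode[OF el_Pair[of p as]]) (simp_all add: cd_atom_def)

lemma el_pred_atom: "elementary a \<Longrightarrow> elementary (\<lambda>x. atom.pred (a x))"
proof (rule el_compose[of atom.pred])
  have "elementary (\<lambda>a. (atom.pred a, args a))"
    by (rule elementary_recode[OF el_id]) (simp add: cd_atom_def)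
  from el_fst[OF this] show "elementary atom.pred" by simp
qed

lemma el_args: "elementary a \<Longrightarrow> elementary (\<lambda>x. args (a x))"
proof (rule el_compose[of args])
  have "elementary (\<lambda>a. (atom.pred a, args a))"
    by (rule elementary_recode[OF el_id]) (simp add: cd_atom_def)
  from el_snd[OF this] show "elementary args" by simp
qed

lemma el_Dexr: "elementary b \<Longrightarrow> elementary hs \<Longrightarrow> elementary (\<lambda>x. Dexr (b x) (hs x))"
  by (rule elementary_recode[OF el_Pair[of b hs]]) (simp_all add: cd_dexr_def)

lemma el_body: "elementary r \<Longrightarrow> elementary (\<lambda>x. body (r x))"
proof (rule el_compose[of body])
  have "elementary (\<lambda>r. (body r, heads r))"
    by (rule elementary_recode[OF el_id]) (simp add: cd_dexr_def)
  from el_fst[OF this] show "elementary body" by simp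
qed

lemma el_heads: "elementary r \<Longrightarrow> elementary (\<lambda>x. heads (r x))"
proof (rule el_compose[of heads])
  have "elementary (\<lambda>r. (body r, heads r))"
    by (rule elementary_recode[OF el_id]) (simp add: cd_dexr_def)
  from el_snd[OF this] show "elementary heads" by simp
qed

text \<open>Powers of 2 are obtained as numbers of subsequences.\<close>

lemma el_exp2: "elementary n \<Longrightarrow> elementary (\<lambda>x. 2 ^ n x :: nat)"
  using el_length[OF el_subseqs[OF el_upt[of n]]] by (simp add: length_subseqs)

lemma el_ren:
  "elementary a \<Longrightarrow> elementary (\<lambda>z. F (fst z) (snd z)) \<Longrightarrow> elementary (\<lambda>x. ren (F x) (a x))"
  unfolding ren_def by (intro el_Atom el_map el_pred_atom el_args)

text \<open>These rules follow the structure of a defining term. They are the reason why the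
  quantifiers of the algorithm range over lists.\<close>

lemmas el_intros =
  el_id el_fst_base el_snd_base el_Atom el_pred_atom el_args el_Dexr el_body el_heads el_ren
  el_fst el_snd el_Pair el_if el_Not el_conj el_disj el_imp el_iff el_Ball el_Bex el_member
  el_is_Nil el_Cons el_append el_concat el_map el_filter el_length el_upt el_nth_default
  el_n_lists el_subseqs el_exp2 el_eq el_le el_less el_Suc el_add el_mult el_const

text \<open>Below a binder the argument has become a pair; \<open>assms[THEN el_compose]\<close>
  reaches the parameters through its projections.\<close>

lemma el_atoms_upto:
  assumes "elementary S" "elementary M"
  shows "elementary (\<lambda>x. atoms_upto (S x) (M x))"
  unfolding atoms_upto_def by (intro el_intros assms[THEN el_compose])

lemma el_uvars: "elementary r \<Longrightarrow> elementary (\<lambda>x. uvars (r x))"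
  unfolding uvars_def by (intro el_intros) 

lemma el_hom_exists:
  assumes "elementary N" "elementary L" "elementary X" "elementary q" "elementary C"
  shows "elementary (\<lambda>x. hom_exists (N x) (L x) (X x) (q x) (C x))"
  unfolding hom_exists_def by (intro el_intros assms[THEN el_compose])

lemma el_queries:
  assumes "elementary S" "elementary K"
  shows "elementary (\<lambda>x. queries (S x) (K x))"
  unfolding queries_def by (intro el_intros el_atoms_upto assms[THEN el_compose])

lemma el_width:
  assumes "elementary S" "elementary K"
  shows "elementary (\<lambda>x. width (S x) (K x))"
  unfolding width_def by (intro el_intros el_queries assms[THEN el_compose])

lemma el_mosaics:
  assumes "elementary S" "elementary K"
  shows "elementary (\<lambda>x. mosaics (S x) (K x))"
  unfolding mosaics_def by (intro el_intros el_atoms_upto el_width assms[THEN el_compose])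

lemma el_same_type:
  assumes "elementary S" "elementary K" "elementary X" "elementary C" "elementary C'"
  shows "elementary (\<lambda>x. same_type (S x) (K x) (X x) (C x) (C' x))"
  unfolding same_type_def
  by (intro el_intros el_queries el_hom_exists el_width assms[THEN el_compose])

lemma el_closed:
  assumes "elementary S" "elementary K" "elementary R" "elementary T"
  shows "elementary (\<lambda>x. closed (S x) (K x) (R x) (T x))"
  unfolding closed_def by (intro el_intros el_same_type el_uvars assms[THEN el_compose])

lemma el_coherent:
  assumes "elementary S" "elementary K" "elementary R"
  shows "elementary (\<lambda>x. coherent (S x) (K x) (R x))"
  unfolding coherent_def by (intro el_intros el_mosaics el_closed assms[THEN el_compose])

lemma el_heads_for:
  assumes "elementary S" "elementary K" "elementary R" "elementary b"
  shows "elementary (\<lambda>x. heads_for (S x) (K x) (R x) (b x))"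
  unfolding heads_for_def by (intro el_intros el_coherent assms[THEN el_compose])

lemma el_rewriting:
  assumes "elementary S" "elementary K" "elementary R"
  shows "elementary (\<lambda>x. rewriting (S x) (K x) (R x))"
  unfolding rewriting_def by (intro el_intros el_heads_for el_atoms_upto assms[THEN el_compose])

lemma el_glue:
  assumes "elementary N" "elementary bs" "elementary Cs"
  shows "elementary (\<lambda>x. glue (N x) (bs x) (Cs x))"
  unfolding glue_def by (intro el_intros assms[THEN el_compose])

lemma el_separable:
  assumes "elementary S" "elementary K" "elementary R"
  shows "elementary (\<lambda>x. separable (S x) (K x) (R x))"
  unfolding separable_def
  by (intro el_intros el_mosaics el_heads_for el_hom_exists el_width el_uvars el_glue
      assms[THEN el_compose])

text \<open>Halving by counting: \<open>k\<close> qualifies iff twice \<open>Suc k\<close> is at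
  most \<open>m\<close>.\<close>

lemma div_2_conv: "length (filter (\<lambda>k. k + k + 2 \<le> m) [0..<m]) = m div 2"
proof -
  have "length (filter (\<lambda>k. k + k + 2 \<le> m) [0..<m]) = card {k. k < m \<and> k + k + 2 \<le> m}"
    by (simp add: length_filter_conv_card cong: conj_cong)
  also have "{k. k < m \<and> k + k + 2 \<le> m} = {..<m div 2}" by auto
  finally show ?thesis by simp
qed

lemma el_div2: "elementary f \<Longrightarrow> elementary (\<lambda>x. f x div 2 :: nat)"
proof (rule el_compose[of "\<lambda>m. m div 2"])
  have "elementary (\<lambda>m :: nat. length (filter (\<lambda>k. k + k + 2 \<le> m) [0..<m]))"
    by (intro el_intros)
  then show "elementary (\<lambda>m :: nat. m div 2)" by (simp only: div_2_conv)
qed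

lemma binary_0 [simp]: "binary 0 = []"
  by (subst binary.simps) simp

lemma length_binary_le: "length (binary n) \<le> n"
proof (induction n rule: less_induct)
  case (less n)
  show ?case
  proof (cases "n = 0")
    case False
    then have "n div 2 < n" by simp
    with less.IH[OF this] have "Suc (length (binary (n div 2))) \<le> n" by simp
    then show ?thesis by (simp add: binary.simps[of n])
  qed simp
qed

text \<open>The state holds the number still to be written and the digits so far. That number
  decreases until it is 0, so \<open>n\<close> rounds suffice.\<close>

lemma el_binary: "elementary f \<Longrightarrow> elementary (\<lambda>x. binary (f x))"
proof (rule el_compose[of binary])
  define B where "B s = (if fst s = 0 then s else
    (fst s div 2, snd s @ [if fst s div 2 + fst s div 2 = fst s then Zero else One]))" for s :: "nat \<times> letter list"
  have inv: "fst ((B ^^ k) (n, [])) \<le> n - k \<and>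
      snd ((B ^^ k) (n, [])) @ binary (fst ((B ^^ k) (n, []))) = binary n" for k n
  proof (induction k)
    case (Suc k)
    obtain m w where mw: "(B ^^ k) (n, []) = (m, w)" by force
    have "m div 2 + m div 2 = m \<longleftrightarrow> even m" by presburger
    then have B: "B (m, w) = (if m = 0 then (m, w) else (m div 2, w @ [if even m then Zero else One]))"
      by (simp only: B_def fst_conv snd_conv)
    from Suc have IH: "m \<le> n - k" "w @ binary m = binary n" unfolding mw by simp_all
    show ?case
    proof (cases "m = 0")
      case False
      then have "m div 2 < m" by simp
      with IH(1) have "m div 2 \<le> n - Suc k" by linarith
      moreover have "binary m = (if even m then Zero else One) # binary (m div 2)"
        using False by (subst binary.simps) simp
      ultimately show ?thesis using False IH(2) by (simp add: mw B)
    next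
      case True
      have "B (m, w) = (m, w)" by (subst B) (simp add: True)
      moreover have "m \<le> n - Suc k" using True by simp
      ultimately show ?thesis using IH(2) by (simp add: mw)
    qed
  qed simp
  have "elementary (\<lambda>n. (B ^^ n) (n, []))"
  proof (rule el_funpow[OF el_id])
    show "elementary (\<lambda>n :: nat. (n, [] :: letter list))" by (intro el_intros)
    show "elementary (\<lambda>z :: nat \<times> nat \<times> letter list. B (snd z))"
      unfolding B_def by (intro el_intros el_div2)
    show "elem_bounded (\<lambda>n :: nat. prod_encode (cd n, (7 + 2) ^ (4 ^ n)) + (n + (7 + 2) ^ (4 ^ n) + 1) * (n + (7 + 2) ^ (4 ^ n) + 1))"
      by (intro bnd_add bnd_mult bnd_prod_encode bnd_list[where B = "\<lambda>_. 7"] bnd_const bnd_nat el_id bnd_id)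
    fix n i :: nat
    obtain m w where mw: "(B ^^ i) (n, []) = (m, w)" by force
    have m: "m \<le> n" and w: "length w \<le> n"
      using inv[of i n] length_binary_le[of n] unfolding mw
      by (auto dest!: arg_cong[of _ _ length])
    have "cd l \<le> 7" for l :: letter by (cases l) (simp_all add: cd_letter_def)
    then have "cd w \<le> (7 + 2) ^ (4 ^ n)" using w by (intro cd_list_le) auto
    then have "(m + cd w + 1) * (m + cd w + 1) \<le> (n + (7 + 2) ^ (4 ^ n) + 1) * (n + (7 + 2) ^ (4 ^ n) + 1)"
      using m by (intro mult_le_mono) auto
    moreover have "cd (m, w) < (m + cd w + 1) * (m + cd w + 1)"
      unfolding cd_prod_def by (simp add: cd_nat_def) (use prod_encode_less[of m "cd w"] in simp)
    ultimately show "cd ((B ^^ i) (n, [])) \<le> prod_encode (cd n, (7 + 2) ^ (4 ^ n)) + (n + (7 + 2) ^ (4 ^ n) + 1) * (n + (7 + 2) ^ (4 ^ n) + 1)"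
      unfolding mw by linarith
  qed
  then have "elementary (\<lambda>n. snd ((B ^^ n) (n, [])))" by (rule el_snd)
  moreover have "snd ((B ^^ n) (n, [])) = binary n" for n
  proof -
    have "fst ((B ^^ n) (n, [])) = 0" using conjunct1[OF inv[of n n]] by simp
    then show ?thesis using conjunct2[OF inv[of n n]] by simp
  qed
  ultimately show "elementary binary" by simp
qed

lemma el_enc_nat: "elementary f \<Longrightarrow> elementary (\<lambda>x. enc_nat (f x))"
  unfolding enc_nat_def by (intro el_intros el_binary)

lemma el_enc_list:
  "elementary l \<Longrightarrow> elementary (\<lambda>z. F (fst z) (snd z)) \<Longrightarrow> elementary (\<lambda>x. enc_list (F x) (l x))"
  unfolding enc_list_def by (intro el_intros)

lemma el_enc_dexrs: "elementary f \<Longrightarrow> elementary (\<lambda>x. enc_dexrs (f x))"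
  unfolding enc_dexrs_def enc_dexr_def enc_atom_def by (intro el_intros el_enc_list el_enc_nat)

lemma el_enc_input:
  assumes "elementary S" "elementary R"
  shows "elementary (\<lambda>x. enc_input (S x) (R x))"
  unfolding enc_input_def enc_schema_def case_prod_unfold
  by (intro el_intros el_enc_dexrs el_enc_list el_enc_nat assms[THEN el_compose])

section \<open>A finite search space that contains every input with an encoding of given
  length\<close>

definition lists_upto :: "nat \<Rightarrow> 'a list \<Rightarrow> 'a list list" where
  "lists_upto L A = concat (map (\<lambda>n. List.n_lists n A) [0..<Suc L])"

lemma set_lists_upto: "set (lists_upto L A) = {xs. length xs \<le> L \<and> set xs \<subseteq> set A}"
  by (auto simp: lists_upto_def set_n_lists)

lemma el_lists_upto:
  assumes "elementary L" "elementary A"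
  shows "elementary (\<lambda>x. lists_upto (L x) (A x))"
  unfolding lists_upto_def by (intro el_intros assms[THEN el_compose])

text \<open>Within an encoding of length \<open>L\<close>, numbers are below \<open>2 ^ L\<close>
  and lists have at most \<open>L\<close> entries. The enumerations built on this may also contain
  objects with longer encodings.\<close>

definition nats_of :: "nat \<Rightarrow> nat list" where
  "nats_of L = [0..<2 ^ L]"

definition atoms_of :: "nat \<Rightarrow> atom list" where
  "atoms_of L = concat (map (\<lambda>R. map (Atom R) (lists_upto L (nats_of L))) (nats_of L))"

definition bodies_of :: "nat \<Rightarrow> atom list list" where
  "bodies_of L = lists_upto L (atoms_of L)"

definition dexrs_of :: "nat \<Rightarrow> dexr list" where
  "dexrs_of L = concat (map (\<lambda>b. map (Dexr b) (lists_upto L (bodies_of L))) (bodies_of L))"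

definition schemas_of :: "nat \<Rightarrow> schema list" where
  "schemas_of L = lists_upto L (concat (map (\<lambda>R. map (\<lambda>n. (R, n)) (nats_of L)) (nats_of L)))"

definition inputs_of :: "nat \<Rightarrow> (schema \<times> dexr list) list" where
  "inputs_of L = concat (map (\<lambda>S. map (\<lambda>rs. (S, rs)) (lists_upto L (dexrs_of L))) (schemas_of L))"

lemma el_inputs_of:
  assumes "elementary L"
  shows "elementary (\<lambda>x. inputs_of (L x))"
  unfolding inputs_of_def schemas_of_def dexrs_of_def bodies_of_def atoms_of_def nats_of_def
  by (intro el_intros el_lists_upto assms[THEN el_compose])

lemma less_exp_binary: "n < 2 ^ length (binary n)"
proof (induction n rule: less_induct)
  case (less n)
  show ?case
  proof (cases "n = 0")
    case False
    then have "n div 2 < 2 ^ length (binary (n div 2))" by (intro less.IH) simp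
    then have "n < 2 * 2 ^ length (binary (n div 2))" by linarith
    then show ?thesis using False by (simp add: binary.simps[of n])
  qed simp
qed

lemma nat_in_nats_of: "length (enc_nat n) \<le> L \<Longrightarrow> n \<in> set (nats_of L)"
proof -
  assume "length (enc_nat n) \<le> L"
  then have "(2 :: nat) ^ length (binary n) \<le> 2 ^ L" by (intro power_increasing) (simp_all add: enc_nat_def)
  with less_exp_binary[of n] have "n < 2 ^ L" by (rule less_le_trans)
  then show ?thesis by (simp add: nats_of_def)
qed

lemma enc_list_member: "x \<in> set xs \<Longrightarrow> length (f x) \<le> length (enc_list f xs)"
  by (induction xs) (auto simp: enc_list_def)

lemma enc_list_length:
  assumes "\<And>x. f x \<noteq> []"
  shows "length xs \<le> length (enc_list f xs)"
proof -
  have "length xs \<le> length (concat (map f xs))"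
  proof (induction xs)
    case (Cons x xs)
    obtain y ys where "f x = y # ys" using assms[of x] by (cases "f x") auto
    with Cons show ?case by simp
  qed simp
  then show ?thesis by (simp add: enc_list_def)
qed

text \<open>Each entry contributes a nonempty part to the encoding of the list, which bounds both
  the number and the size of the entries.\<close>

lemma list_in_lists_upto:
  assumes "length (enc_list f xs) \<le> L" "\<And>x. f x \<noteq> []"
    and "\<And>x. length (f x) \<le> L \<Longrightarrow> x \<in> set A"
  shows "xs \<in> set (lists_upto L A)"
  using enc_list_member[of _ xs f] enc_list_length[of f xs] assms
  by (force simp: set_lists_upto)

lemma enc_list_ne: "enc_list f xs \<noteq> []"
  by (simp add: enc_list_def)

lemma enc_nat_ne: "enc_nat n \<noteq> []"
  by (simp add: enc_nat_def)

lemma enc_list_tl: "length (enc_list f xs) \<le> length (enc_list f (x # xs))"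
  by (simp add: enc_list_def)

lemma atom_in_atoms_of:
  assumes "length (enc_atom a) \<le> L"
  shows "a \<in> set (atoms_of L)"
proof -
  have 1: "length (enc_list enc_nat (atom.pred a # args a)) \<le> L" using assms by (simp add: enc_atom_def)
  then have "args a \<in> set (lists_upto L (nats_of L))"
    using enc_list_tl[of enc_nat "args a" "atom.pred a"]
    by (intro list_in_lists_upto[of enc_nat] enc_nat_ne nat_in_nats_of) auto
  moreover have "atom.pred a \<in> set (nats_of L)"
    using 1 enc_list_member[of "atom.pred a" "atom.pred a # args a" enc_nat] by (intro nat_in_nats_of) simp
  ultimately show ?thesis by (cases a) (auto simp: atoms_of_def)
qed

lemma body_in_bodies_of:
  "length (enc_list enc_atom b) \<le> L \<Longrightarrow> b \<in> set (bodies_of L)"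
  unfolding bodies_of_def
  by (rule list_in_lists_upto[of enc_atom]) (auto simp: atom_in_atoms_of enc_atom_def enc_list_ne)

lemma dexr_in_dexrs_of:
  assumes "length (enc_dexr r) \<le> L"
  shows "r \<in> set (dexrs_of L)"
proof -
  have 1: "length (enc_list (enc_list enc_atom) (body r # heads r)) \<le> L" using assms by (simp add: enc_dexr_def)
  then have "heads r \<in> set (lists_upto L (bodies_of L))"
    using enc_list_tl[of "enc_list enc_atom" "heads r" "body r"]
    by (intro list_in_lists_upto[of "enc_list enc_atom"] enc_list_ne body_in_bodies_of) auto
  moreover have "body r \<in> set (bodies_of L)"
    using 1 enc_list_member[of "body r" "body r # heads r" "enc_list enc_atom"]
    by (intro body_in_bodies_of) simp
  ultimately show ?thesis by (cases r) (auto simp: dexrs_of_def)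
qed

lemma input_in_inputs_of: "(S, \<Sigma>) \<in> set (inputs_of (length (enc_input S \<Sigma>)))"
proof -
  let ?L = "length (enc_input S \<Sigma>)"
  have "\<Sigma> \<in> set (lists_upto ?L (dexrs_of ?L))"
    by (rule list_in_lists_upto[of enc_dexr])
      (auto simp: enc_input_def enc_dexrs_def enc_dexr_def enc_list_ne dexr_in_dexrs_of)
  moreover have "S \<in> set (schemas_of ?L)"
    unfolding schemas_of_def
  proof (rule list_in_lists_upto[of "\<lambda>(R, n). enc_list enc_nat [R, n]"])
    fix p :: "nat \<times> nat"
    assume "length (case p of (R, n) \<Rightarrow> enc_list enc_nat [R, n]) \<le> ?L"
    then have "fst p \<in> set (nats_of ?L)" "snd p \<in> set (nats_of ?L)"
      by (auto simp: enc_list_def split: prod.splits intro!: nat_in_nats_of)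
    then show "p \<in> set (concat (map (\<lambda>R. map (\<lambda>n. (R, n)) (nats_of ?L)) (nats_of ?L)))"
      by (cases p) auto
  qed (auto simp: enc_input_def enc_schema_def enc_list_ne)
  ultimately show ?thesis by (auto simp: inputs_of_def)
qed

text \<open>\<open>2 ^ length w\<close> exceeds all variables of an input encoded by
  \<open>w\<close>. If \<open>w\<close> encodes no input, the filtered list may be empty and the
  answer is arbitrary.\<close>

definition solve :: "letter list \<Rightarrow> letter list" where
  "solve w =
     (let (S, \<Sigma>) = hd (filter (\<lambda>i. enc_input (fst i) (snd i) = w) (inputs_of (length w))) in
      if separable S (2 ^ length w) \<Sigma> then enc_dexrs (rewriting S (2 ^ length w) \<Sigma>) else [Fail])"

lemma el_solve: "elementary solve"
  unfolding solve_def Let_def case_prod_unfold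
  by (intro el_intros el_hd el_separable el_enc_dexrs el_rewriting el_inputs_of el_enc_input)

lemma solve_enc_input:
  fixes S \<Sigma>
  defines "w \<equiv> enc_input S \<Sigma>"
  shows "solve w = (if separable S (2 ^ length w) \<Sigma> then enc_dexrs (rewriting S (2 ^ length w) \<Sigma>) else [Fail])"
proof -
  let ?xs = "filter (\<lambda>i. enc_input (fst i) (snd i) = w) (inputs_of (length w))"
  have "(S, \<Sigma>) \<in> set ?xs" using input_in_inputs_of[of S \<Sigma>] by (simp add: w_def)
  then have "?xs \<noteq> []" by (metis empty_iff empty_set)
  then have "hd ?xs \<in> set ?xs" by (rule hd_in_set)
  then have "enc_input (fst (hd ?xs)) (snd (hd ?xs)) = enc_input S \<Sigma>" by (auto simp: w_def)
  then have "hd ?xs = (S, \<Sigma>)" unfolding enc_input_inject by (simp add: prod_eq_iff)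
  then show ?thesis by (simp add: solve_def)
qed

section \<open>Converting between words on tapes and numbers in registers\<close>

section \<open>Input and output\<close>

fun incs :: "nat \<Rightarrow> nat \<Rightarrow> com" where
  "incs 0 r = Skip"
| "incs (Suc n) r = Inc r ;; incs n r"

fun read_symbol :: "nat \<Rightarrow> nat \<Rightarrow> com" where
  "read_symbol 0 k = Skip"
| "read_symbol (Suc m) k = If 0 k (incs k 3) (read_symbol m (Suc k))"

fun write_symbol :: "nat \<Rightarrow> nat \<Rightarrow> com" where
  "write_symbol 0 k = Skip"
| "write_symbol (Suc m) k = If 2 1 (Wr k) (Dec 2 ;; write_symbol m (Suc k))"

text \<open>The letter goes to register 3, and register 4 holds the code of the letters read before;
  \<open>mkpair\<close> and \<open>Inc\<close> form the code of a \<open>Cons\<close>. Letters are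
  pushed, so the word is collected in reverse. The arguments 6 and 2 are the number of letters and
  the first letter symbol.\<close>

definition read_body :: com where
  "read_body = read_symbol 6 2 ;; (mkpair 2 ;; (Inc 2 ;; (move 2 4 ;; Inc 0)))"

text \<open>\<open>Dec\<close> and \<open>unpair\<close> take the code of a \<open>Cons\<close>
  apart: register 2 then counts down to select the symbol, while register 3 keeps the tail.\<close>

definition write_body :: com where
  "write_body = Dec 2 ;; (unpair 2 ;; (write_symbol 8 0 ;; move 3 2))"

text \<open>\<open>Inc 0\<close> passes over the left end marker of the input, and
  \<open>Wr 1\<close> rewrites the marker of the output tape in order to move its head to cell 1.
  Reading stops at the blank, writing at 0, the code of the empty list.\<close>

definition io_program :: "pf \<Rightarrow> com" where
  "io_program p = Inc 0 ;; (Wr 1 ;; (While 0 0 read_body ;; (move 4 2 ;; (code p 2 ;; While 2 1 write_body))))"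

lemma runs_incs: "runs (incs n r) T s (s(r := s r + n)) n"
proof (induction n arbitrary: s)
  case 0
  then show ?case using runs_Skip[of T s] by simp
next
  case (Suc n)
  have "(s(r := s r + 1))(r := (s(r := s r + 1)) r + n) = s(r := s r + Suc n)" by simp
  with runs_Seq[OF runs_Inc[OF refl, of r T s] Suc[of "s(r := s r + 1)"]] show ?case
    by (simp only: incs.simps plus_1_eq_Suc)
qed

lemma runs_read_symbol:
  "k \<le> T 0 (s 0) \<Longrightarrow> T 0 (s 0) < k + m \<Longrightarrow>
    runs (read_symbol m k) T s (s(3 := s 3 + T 0 (s 0))) (T 0 (s 0) + m + 2)"
proof (induction m arbitrary: k)
  case (Suc m)
  show ?case
  proof (cases "T 0 (s 0) = k")
    case True
    from runs_IfT[where T = T and r = 0 and s = s and k = k, OF True runs_incs[of k 3]] show ?thesis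
      unfolding read_symbol.simps True by (rule runs_mono) simp
  next
    case False
    then have "runs (read_symbol m (Suc k)) T s (s(3 := s 3 + T 0 (s 0))) (T 0 (s 0) + m + 2)"
      using Suc.prems by (intro Suc.IH) auto
    from runs_IfF[of T 0 s k, OF False this] show ?thesis
      unfolding read_symbol.simps by (rule runs_mono) simp
  qed
qed simp

lemma exec_write_symbol:
  "plain T \<Longrightarrow> s 2 < m \<Longrightarrow> \<exists>t \<le> 3 * m. exec (write_symbol m k) (T, s) t
     (T(1 := (T 1)(s 1 := k + s 2)), s(1 := s 1 + 1, 2 := 0))"
proof (induction m arbitrary: k s)
  case (Suc m)
  show ?case
  proof (cases "s 2 = 0")
    case True
    then have c: "fst (T, s) 2 (snd (T, s) 2) = 1" using plain_zero[OF Suc.prems(1), of 2] by simp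
    have ex: "exec (write_symbol (Suc m) k) (T, s) (1 + 2)
        (T(1 := (T 1)(s 1 := k)), s(1 := s 1 + 1))"
      unfolding write_symbol.simps by (rule exec.IfT[OF c exec.Wr])
    have eq: "s(1 := s 1 + 1, 2 := 0) = s(1 := s 1 + 1)" "k + s 2 = k"
      using True by (auto simp: fun_eq_iff)
    show ?thesis unfolding eq by (intro exI[of _ "1 + 2"] conjI ex) simp
  next
    case False
    let ?s = "s(2 := s 2 - 1)"
    have "?s 2 < m" using Suc.prems(2) False by simp
    from Suc.IH[where s = ?s and k = "Suc k", OF Suc.prems(1) this] obtain t where t: "t \<le> 3 * m"
      "exec (write_symbol m (Suc k)) (T, ?s) t (T(1 := (T 1)(?s 1 := Suc k + ?s 2)), ?s(1 := ?s 1 + 1, 2 := 0))"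
      by blast
    have eq: "?s(1 := s 1 + 1, 2 := 0) = s(1 := s 1 + 1, 2 := 0)" "?s 1 = s 1" "Suc k + ?s 2 = k + s 2"
      using False by (auto simp: fun_eq_iff)
    have "fst (T, s) 2 (snd (T, s) 2) \<noteq> 1" using plain_zero[OF Suc.prems(1), of 2] False by simp
    note ex = exec.IfF[OF this exec.Seq[OF exec.Dec t(2)], unfolded eq]
    show ?thesis unfolding write_symbol.simps
      by (rule exI[of _ "1 + t + 1"], rule conjI[OF _ ex]) (use t(1) in simp)
  qed
qed simp

lemma cd_letter_bounds: "cd (l :: letter) = letter_symbol l" "2 \<le> letter_symbol l" "letter_symbol l < 8"
  by (simp add: cd_letter_def, (cases l; simp)+)

text \<open>The induction needs an arbitrary starting cell. That cells outside the written block
  keep their content ensures that the output is followed by a blank.\<close>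

lemma exec_write_loop:
  assumes "plain T" "clean 2 s" "s 2 = cd (v :: letter list)" "cd v \<le> Z"
  shows "\<exists>t \<le> length v * (quad Z + 4 * Z + 30) + 1. \<exists>T' s'. exec (While 2 1 write_body) (T, s) t (T', s') \<and>
    (\<forall>i < length v. T' 1 (s 1 + i) = letter_symbol (v ! i)) \<and>
    (\<forall>p. p < s 1 \<or> s 1 + length v \<le> p \<longrightarrow> T' 1 p = T 1 p)"
  using assms
proof (induction v arbitrary: T s)
  case Nil
  then have "fst (T, s) 2 (snd (T, s) 2) = 1" using plain_zero[OF Nil(1), of 2] by (simp add: cd_Nil)
  from exec.WhileF[OF this] show ?case by (intro exI[of _ 1] conjI exI[of _ T] exI[of _ s]) auto
next
  case (Cons x xs)
  let ?k = "letter_symbol x"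
  let ?s1 = "s(2 := prod_encode (?k, cd xs))"
  let ?s2 = "s(2 := ?k, 3 := cd xs)"
  let ?T3 = "T(1 := (T 1)(s 1 := ?k))"
  let ?s3 = "s(1 := s 1 + 1, 2 := 0, 3 := cd xs)"
  let ?s4 = "s(1 := s 1 + 1, 2 := cd xs)"
  have s2: "s 2 = Suc (prod_encode (?k, cd xs))" using Cons.prems(3) by (simp add: cd_Cons cd_letter_bounds)
  have s3: "s 3 = 0" "s 4 = 0" using Cons.prems(2) by (auto simp: clean_def)
  have Z: "prod_encode (?k, cd xs) \<le> Z" "cd xs \<le> Z"
    using Cons.prems(3,4) s2 le_prod_encode(2)[of "cd xs" ?k] by auto
  have "runs (Dec 2) T s ?s1 1" by (rule runs_Dec) (simp add: s2)
  then obtain t1 where t1: "t1 \<le> 1" "exec (Dec 2) (T, s) t1 (T, ?s1)" unfolding runs_def by blast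
  have "runs (unpair 2) T ?s1 ?s2 (quad (?s1 2))"
    using Cons.prems(1) s3 by (intro runs_unpair) (auto simp: fun_eq_iff)
  then obtain t2 where t2: "t2 \<le> quad (?s1 2)" "exec (unpair 2) (T, ?s1) t2 (T, ?s2)"
    unfolding runs_def by blast
  have "quad (?s1 2) \<le> quad Z" using Z(1) by (intro mult_le_mono) simp_all
  with t2(1) have t2': "t2 \<le> quad Z" by (rule le_trans)
  have e: "?s2(1 := s 1 + 1, 2 := 0) = ?s3" "?s2 1 = s 1" "0 + ?s2 2 = ?k" by (auto simp: fun_eq_iff)
  have "?s2 2 < 8" using cd_letter_bounds(3)[of x] by simp
  from exec_write_symbol[of T ?s2 8 0, OF Cons.prems(1) this, unfolded e]
  obtain t3 where t3: "t3 \<le> 3 * 8" "exec (write_symbol 8 0) (T, ?s2) t3 (?T3, ?s3)" by blast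
  have pT: "plain ?T3" using Cons.prems(1) by (simp add: plain_def)
  have "runs (move 3 2) ?T3 ?s3 ?s4 (4 * ?s3 3 + 1)"
    using pT s3 by (intro runs_move) (auto simp: fun_eq_iff)
  then obtain t4 where t4: "t4 \<le> 4 * ?s3 3 + 1" "exec (move 3 2) (?T3, ?s3) t4 (?T3, ?s4)"
    unfolding runs_def by blast
  from t4(1) have t4': "t4 \<le> 4 * Z + 1" using Z(2) by simp
  have body: "exec write_body (T, s) (t1 + (t2 + (t3 + t4))) (?T3, ?s4)"
    unfolding write_body_def by (intro exec.Seq[OF t1(2)] exec.Seq[OF t2(2)] exec.Seq[OF t3(2)] t4(2))
  have s4: "clean 2 ?s4" "?s4 2 = cd xs" "?s4 1 = s 1 + 1" using Cons.prems(2) by (simp_all add: clean_def)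
  from Cons.IH[OF pT s4(1,2) Z(2), unfolded s4(3)] obtain t T' s' where t: "t \<le> length xs * (quad Z + 4 * Z + 30) + 1"
    "exec (While 2 1 write_body) (?T3, ?s4) t (T', s')"
    "\<And>i. i < length xs \<Longrightarrow> T' 1 (s 1 + 1 + i) = letter_symbol (xs ! i)"
    "\<And>p. p < s 1 + 1 \<or> s 1 + 1 + length xs \<le> p \<Longrightarrow> T' 1 p = ?T3 1 p"
    by blast
  have "fst (T, s) 2 (snd (T, s) 2) \<noteq> 1" using plain_zero[OF Cons.prems(1), of 2] by (simp add: s2)
  from exec.WhileT[OF this body t(2)]
  have ex: "exec (While 2 1 write_body) (T, s) (t1 + (t2 + (t3 + t4)) + 2 + t) (T', s')" .
  have le: "t1 + (t2 + (t3 + t4)) + 2 + t \<le> length (x # xs) * (quad Z + 4 * Z + 30) + 1"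
    using t1(1) t2' t3(1) t4' t(1) by simp
  have out: "T' 1 (s 1 + i) = letter_symbol ((x # xs) ! i)" if "i < length (x # xs)" for i
    using t(3)[of "i - 1"] t(4)[of "s 1"] that by (cases i) auto
  have rest: "T' 1 p = T 1 p" if "p < s 1 \<or> s 1 + length (x # xs) \<le> p" for p
    using t(4)[of p] that by auto
  show ?case using ex le out rest by blast
qed

lemma writes_code: "writes (code p b) = {}"
  by (induction p arbitrary: b) (auto simp: clear_def move_def copy_def unpair_def mkpair_def)

lemma writes_io: "writes (io_program p) \<subseteq> {..<8}"
proof -
  have "writes (incs n r) = {}" for n r by (induction n) auto
  then have r: "writes (read_symbol m k) = {}" for m k by (induction m arbitrary: k) auto
  have w: "writes (write_symbol m k) \<subseteq> {k..<k + m}" for m k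
  proof (induction m arbitrary: k)
    case (Suc m)
    from Suc[of "Suc k"] show ?case by auto
  qed simp
  from w[of 8 0] show ?thesis
    by (auto simp: io_program_def read_body_def write_body_def r writes_code move_def unpair_def mkpair_def copy_def)
qed

definition read_state :: "letter list \<Rightarrow> nat \<Rightarrow> nat \<Rightarrow> nat" where
  "read_state w j = (\<lambda>_. 0)(0 := j + 1, 1 := 1, 4 := cd (rev (take j w)))"

lemma runs_read_body:
  assumes T: "plain T" "T 0 = word_content w" and j: "j < length w" and Y: "cd (rev (take (Suc j) w)) \<le> Y"
  shows "runs read_body T (read_state w j) (read_state w (Suc j)) (quad Y + 4 * Y + 30)"
proof -
  let ?k = "letter_symbol (w ! j)" and ?a = "cd (rev (take j w))"
  let ?y = "prod_encode (?k, ?a)"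
  let ?s0 = "read_state w j"
  let ?s1 = "?s0(3 := ?k)"
  let ?s2 = "?s0(2 := ?y, 3 := 0, 4 := 0)"
  let ?s3 = "?s2(2 := Suc ?y)"
  let ?s4 = "?s2(2 := 0, 4 := Suc ?y)"
  have tk: "T 0 (?s0 0) = ?k" using j by (simp add: T(2) word_content_def read_state_def)
  have "cd (rev (take (Suc j) w)) = Suc ?y"
    using j by (simp add: take_Suc_conv_app_nth cd_Cons cd_letter_bounds)
  note cs = this
  have yY: "Suc ?y \<le> Y" using Y cs by simp
  have "runs (read_symbol 6 2) T ?s0 (?s0(3 := ?s0 3 + T 0 (?s0 0))) (T 0 (?s0 0) + 6 + 2)"
    unfolding tk using cd_letter_bounds(2,3)[of "w ! j"] runs_read_symbol[of 2 T ?s0 6, unfolded tk] by simp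
  moreover have "?s0(3 := ?s0 3 + T 0 (?s0 0)) = ?s1" unfolding tk by (simp add: read_state_def)
  ultimately have 1: "runs (read_symbol 6 2) T ?s0 ?s1 (?k + 6 + 2)" unfolding tk by simp
  have 2: "runs (mkpair 2) T ?s1 ?s2 (quad ?y)"
    using T(1) by (intro runs_mkpair) (auto simp: read_state_def fun_eq_iff)
  have 3: "runs (Inc 2) T ?s2 ?s3 1" by (rule runs_Inc) (simp add: fun_eq_iff)
  have 4: "runs (move 2 4) T ?s3 ?s4 (4 * ?s3 2 + 1)"
    using T(1) by (intro runs_move) (auto simp: fun_eq_iff)
  have 5: "runs (Inc 0) T ?s4 (read_state w (Suc j)) 1"
    by (rule runs_Inc) (auto simp: read_state_def fun_eq_iff cs)
  have "quad ?y \<le> quad Y" using yY by (intro mult_le_mono) simp_all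
  then have le: "?k + 6 + 2 + (quad ?y + (1 + (4 * ?s3 2 + 1 + 1))) \<le> quad Y + 4 * Y + 30"
    using yY cd_letter_bounds(3)[of "w ! j"] by simp
  show ?thesis unfolding read_body_def
    by (rule runs_mono[OF runs_Seq[OF 1 runs_Seq[OF 2 runs_Seq[OF 3 runs_Seq[OF 4 5]]]] le])
qed

lemma runs_read_loop:
  assumes T: "plain T" "T 0 = word_content w" and Y: "cd (rev w) \<le> Y"
  shows "runs (While 0 0 read_body) T (read_state w 0) (read_state w (length w))
    (length w * (quad Y + 4 * Y + 32) + 1)"
proof -
  \<comment> \<open>What has been read, in reverse, is a tail of the reversed word, so its code
    stays below that of the whole.\<close>
  have prefix: "cd (rev (take j w)) \<le> Y" for j
  proof -
    have "rev (take j w) = drop (length w - j) (rev w)"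
      by (cases "j \<le> length w") (simp_all add: drop_rev)
    then show ?thesis using cd_drop_le[of "length w - j" "rev w"] Y by simp
  qed
  have "runs (While 0 0 read_body) T (read_state w (length w - i)) (read_state w (length w))
      (i * (quad Y + 4 * Y + 32) + 1)" if "i \<le> length w" for i
    using that
  proof (induction i)
    case 0
    have "T 0 (read_state w (length w) 0) = 0" by (simp add: T(2) read_state_def word_content_def)
    then have "runs (While 0 0 read_body) T (read_state w (length w)) (read_state w (length w)) 1"
      by (rule runs_WhileF)
    then show ?case by simp
  next
    case (Suc i)
    let ?j = "length w - Suc i"
    have j: "?j < length w" "Suc ?j = length w - i" using Suc.prems by auto
    have "T 0 (read_state w ?j 0) = letter_symbol (w ! ?j)"
      using j(1) by (simp add: T(2) read_state_def word_content_def)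
    then have "T 0 (read_state w ?j 0) \<noteq> 0" using cd_letter_bounds(2)[of "w ! ?j"] by simp
    from runs_WhileT[OF this runs_read_body[OF T j(1) prefix, unfolded j(2)] Suc.IH[OF Suc_leD[OF Suc.prems]]]
    show ?case by (rule runs_mono) simp
  qed
  from this[of "length w"] show ?thesis by simp
qed

lemma io_program_computes:
  assumes p: "sem p (cd (rev w)) = cd v" and Y: "cd (rev w) \<le> Y" and Z: "cd v \<le> Z"
    and t: "length w * (quad Y + 4 * Y + 32) + 4 * Y + cost p (cd (rev w)) + length v * (quad Z + 4 * Z + 30) + 5 \<le> t"
  shows "computes_in (com_machine (io_program p)) w v t"
proof -
  define T where "T = fst (initial_store w)"
  have T0: "T 0 = word_content w" and T: "plain T" and T1: "T 1 = word_content []"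
    by (auto simp: T_def initial_store_def plain_def)
  let ?s0 = "\<lambda>_ :: nat. 0 :: nat"
  let ?n = "length w" and ?x = "cd (rev w)"
  let ?s3 = "read_state w ?n"
  let ?s4 = "?s0(0 := ?n + 1, 1 := 1, 2 := ?x)"
  let ?s5 = "?s4(2 := cd v)"
  have 1: "exec (Inc 0) (T, ?s0) 1 (T, ?s0(0 := 1))"
    using exec.Inc[of 0 T ?s0] by simp
  have "(T 1)(0 := 1) = T 1"
    by (rule fun_upd_idem) (simp only: T1, simp add: word_content_def)
  then have "T(1 := (T 1)(0 := 1)) = T" by (simp only: fun_upd_triv)
  moreover have "?s0(0 := 1, 1 := 1) = read_state w 0" by (auto simp: read_state_def fun_eq_iff cd_Nil)
  ultimately have 2: "exec (Wr 1) (T, ?s0(0 := 1)) 1 (T, read_state w 0)"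
    using exec.Wr[of 1 T "?s0(0 := 1)"] by simp
  obtain t3 where t3: "t3 \<le> ?n * (quad Y + 4 * Y + 32) + 1"
    "exec (While 0 0 read_body) (T, read_state w 0) t3 (T, ?s3)"
    using runs_read_loop[OF T T0 Y] unfolding runs_def by blast
  have "runs (move 4 2) T ?s3 ?s4 (4 * ?s3 4 + 1)"
    using T by (intro runs_move) (auto simp: read_state_def fun_eq_iff)
  then obtain t4 where t4: "t4 \<le> 4 * ?s3 4 + 1" "exec (move 4 2) (T, ?s3) t4 (T, ?s4)"
    unfolding runs_def by blast
  have t4': "t4 \<le> 4 * Y + 1" using t4(1) Y by (simp add: read_state_def)
  have "runs (code p 2) T ?s4 ?s5 (cost p (?s4 2))"
    using T p by (intro runs_code) (auto simp: clean_def fun_eq_iff)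
  then obtain t5 where t5: "t5 \<le> cost p (?s4 2)" "exec (code p 2) (T, ?s4) t5 (T, ?s5)"
    unfolding runs_def by blast
  have t5': "t5 \<le> cost p ?x" using t5(1) by simp
  have "clean 2 ?s5" "?s5 2 = cd v" "?s5 1 = 1" by (auto simp: clean_def)
  from exec_write_loop[OF T this(1,2) Z, unfolded this(3)]
  obtain t6 T' s' where t6: "t6 \<le> length v * (quad Z + 4 * Z + 30) + 1"
    "exec (While 2 1 write_body) (T, ?s5) t6 (T', s')"
    "\<And>i. i < length v \<Longrightarrow> T' 1 (1 + i) = letter_symbol (v ! i)"
    "\<And>p. 1 + length v \<le> p \<Longrightarrow> T' 1 p = T 1 p"
    by blast
  have ex: "exec (io_program p) (T, ?s0) (1 + (1 + (t3 + (t4 + (t5 + t6))))) (T', s')"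
    unfolding io_program_def
    by (intro exec.Seq[OF 1] exec.Seq[OF 2] exec.Seq[OF t3(2)] exec.Seq[OF t4(2)] exec.Seq[OF t5(2)] t6(2))
  have init: "initial_store w = (T, ?s0)" by (simp add: T_def initial_store_def)
  show ?thesis
  proof (rule com_machine_computes[OF writes_io ex[folded init]])
    show "1 + (1 + (t3 + (t4 + (t5 + t6)))) \<le> t" using t t3(1) t4' t5' t6(1) by linarith
    show "T' 1 (i + 1) = letter_symbol (v ! i)" if "i < length v" for i
      using t6(3)[OF that] by (simp add: add.commute)
    show "T' 1 (length v + 1) = 0" using t6(4)[of "length v + 1"] unfolding T1 by (simp add: word_content_def)
  qed
qed

lemma elementary_computable:
  assumes "elementary f"
  shows "\<exists>M T. turing_machine M \<and> elementary_bound T \<and> (\<forall>w. computes_in M w (f w) (T (length w)))"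
proof -
  \<comment> \<open>Reading delivers the word reversed, so the program has to compute
    \<open>f\<close> after \<open>rev\<close>.\<close>
  have "elementary (\<lambda>u. f (rev u))" by (rule el_compose[OF assms el_rev[OF el_id]])
  then obtain p where p: "\<And>u. sem p (cd u) = cd (f (rev u))" "elem_bounded (\<lambda>u :: letter list. cost p (cd u))"
    unfolding elementary_def by blast
  define time where "time w = length w * (quad (cd (rev w)) + 4 * cd (rev w) + 32) + 4 * cd (rev w) +
    cost p (cd (rev w)) + length (f w) * (quad (cd (f w)) + 4 * cd (f w) + 30) + 5" for w
  have "elem_bounded time"
  proof -
    have 1: "elem_bounded (\<lambda>w :: letter list. length w)"
      by (rule bnd_nat[OF el_length[OF el_id]])
    have 2: "elem_bounded (\<lambda>w :: letter list. cd (rev w))"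
      by (rule bnd_elementary[OF el_rev[OF el_id]])
    have 3: "elem_bounded (\<lambda>w :: letter list. cost p (cd (rev w)))"
      by (rule bnd_compose[OF p(2) 2])
    have 4: "elem_bounded (\<lambda>w. length (f w))"
      by (rule bnd_nat[OF el_length[OF assms]])
    have 5: "elem_bounded (\<lambda>w. cd (f w))"
      by (rule bnd_elementary[OF assms])
    show ?thesis
      unfolding time_def by (intro bnd_add bnd_mult bnd_const 1 2 3 4 5)
  qed
  then obtain h where h: "\<And>w. time w \<le> tower h (cd w)" unfolding elem_bounded_def by blast
  \<comment> \<open>So far the time is bounded by a tower in the code of the word; this bounds the
    code by a tower in its length. Letter codes are at most 7.\<close>
  have "elem_bounded (\<lambda>n :: nat. (7 + 2) ^ (4 ^ n))"
    by (intro bnd_list[where B = "\<lambda>_. 7"] bnd_const bnd_nat el_id)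
  then obtain h' where h': "\<And>n :: nat. (7 + 2) ^ (4 ^ n) \<le> tower h' n"
    unfolding elem_bounded_def cd_nat_def by blast
  have "computes_in (com_machine (io_program p)) w (f w) (tower (h + h') (length w))" for w
  proof (rule io_program_computes[OF _ order.refl order.refl])
    show "sem p (cd (rev w)) = cd (f w)" by (simp add: p(1))
    have "cd w \<le> (7 + 2) ^ (4 ^ length w)"
      using cd_letter_bounds(1,3) by (intro cd_list_le) (auto simp: less_Suc_eq_le[symmetric])
    also have "\<dots> \<le> tower h' (length w)" by (rule h')
    finally have "tower h (cd w) \<le> tower (h + h') (length w)"
      unfolding tower_tower[symmetric] by (rule tower_mono)
    with h[of w] show "length w * (quad (cd (rev w)) + 4 * cd (rev w) + 32) + 4 * cd (rev w) +
      cost p (cd (rev w)) + length (f w) * (quad (cd (f w)) + 4 * cd (f w) + 30) + 5 \<le> tower (h + h') (length w)"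
      unfolding time_def by (rule le_trans)
  qed
  moreover have "turing_machine (com_machine (io_program p))"
    by (rule turing_machine_com[OF writes_io]) (simp add: io_program_def)
  moreover have "elementary_bound (tower (h + h'))" unfolding elementary_bound_def by blast
  ultimately show ?thesis by blast
qed

text \<open>The bound is read off from the enumeration, which uses only arguments below
  \<open>2 ^ L\<close>.\<close>

lemma input_variables:
  assumes "(S, \<Sigma>) \<in> set (inputs_of L)" "r \<in> set \<Sigma>"
  shows "a \<in> set (body r) \<Longrightarrow> set (args a) \<subseteq> {..<2 ^ L}"
    and "\<psi> \<in> set (heads r) \<Longrightarrow> a \<in> set \<psi> \<Longrightarrow> set (args a) \<subseteq> {..<2 ^ L}"
proof -
  have "r \<in> set (dexrs_of L)" using assms by (auto simp: inputs_of_def set_lists_upto)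
  then have "set (body r) \<subseteq> set (atoms_of L)" "\<forall>\<psi> \<in> set (heads r). set \<psi> \<subseteq> set (atoms_of L)"
    by (auto simp: dexrs_of_def bodies_of_def set_lists_upto)
  moreover have "set (args a) \<subseteq> {..<2 ^ L}" if "a \<in> set (atoms_of L)" for a
    using that by (auto simp: atoms_of_def set_lists_upto nats_of_def)
  ultimately show "a \<in> set (body r) \<Longrightarrow> set (args a) \<subseteq> {..<2 ^ L}"
    "\<psi> \<in> set (heads r) \<Longrightarrow> a \<in> set \<psi> \<Longrightarrow> set (args a) \<subseteq> {..<2 ^ L}" by blast+
qed

theorem theorem4:
  shows "\<exists>M T. turing_machine M \<and> elementary_bound T \<and>
    (\<forall>S \<Sigma>. is_schema S \<and> (\<forall>r \<in> set \<Sigma>. dexr_over S r \<and> guarded r) \<longrightarrow>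
      (if \<exists>\<Sigma>'. linear_rewriting S (set \<Sigma>) \<Sigma>'
       then \<exists>\<Sigma>'. linear_rewriting S (set \<Sigma>) (set \<Sigma>') \<and>
              computes_in M (enc_input S \<Sigma>) (enc_dexrs \<Sigma>') (T (length (enc_input S \<Sigma>)))
       else computes_in M (enc_input S \<Sigma>) [Fail] (T (length (enc_input S \<Sigma>)))))"
proof -
  obtain M T where M: "turing_machine M" "elementary_bound T"
    and comp: "\<And>w. computes_in M w (solve w) (T (length w))"
    using elementary_computable[OF el_solve] by blast
  have "if \<exists>\<Sigma>'. linear_rewriting S (set \<Sigma>) \<Sigma>'
       then \<exists>\<Sigma>'. linear_rewriting S (set \<Sigma>) (set \<Sigma>') \<and>
              computes_in M (enc_input S \<Sigma>) (enc_dexrs \<Sigma>') (T (length (enc_input S \<Sigma>)))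
       else computes_in M (enc_input S \<Sigma>) [Fail] (T (length (enc_input S \<Sigma>)))"
    if \<Sigma>: "\<forall>r \<in> set \<Sigma>. dexr_over S r \<and> guarded r" for S \<Sigma>
  proof -
    define K where "K = (2 :: nat) ^ length (enc_input S \<Sigma>)"
    interpret guarded_rules S K \<Sigma>
      using \<Sigma> input_variables[OF input_in_inputs_of] by unfold_locales (auto simp: K_def)
    \<comment> \<open>Any linear rewriting, of whatever size, forces separability; hence
      \<open>Fail\<close> is correct when the test fails.\<close>
    have "(\<exists>\<Sigma>'. linear_rewriting S (set \<Sigma>) \<Sigma>') \<longleftrightarrow> separable S K \<Sigma>"
      using rewriting_correct separable_if_rewritable by blast
    then show ?thesis
      using comp[of "enc_input S \<Sigma>"] rewriting_correct
      unfolding solve_enc_input K_def[symmetric] by (auto split: if_splits)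
  qed
  with M show ?thesis by blast
qed

end
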